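(* Let $T\in\mathbb N$, $s^0\in\mathbb N$ and $K\in\mathbb N$ with $s^0\le K$. Let $\eta\in(0,1)$, $r\in\left(0,1/\sqrt{2\,g_\infty L_2}\right)$, and let $$\delta^\star\ge\sigma_T\,\Sigma(\eta,r,s)\quad\text{and}\quad\delta^0\ge\sigma_T\,\Sigma(\eta,r,s^0).$$ Assume we observe the random element $y=\beta^\star\Phi_T(\vartheta^\star)+w_T$ of $L^2(\lambda_T)$ with unknown parameters $s\in\mathbb N$ such that $s\le K$, $\beta^\star\in(\mathbb R^* )^s$ and $\vartheta^\star=(\theta_1^\star,\dots,\theta_s^\star)\in\Theta_T^s(\delta^\star)$. Let $\beta^0\in(\mathbb R^* )^{s^0}$ and $\vartheta^0=(\theta_1^0,\dots,\theta_{s^0}^0)\in\Theta_T^{s^0}(\delta^0)$. Suppose that the Main Assumption (see context), with the given $T,r,\eta$, holds for the set $\mathcal Q^\star=\{\theta_1^\star,\dots,\theta_s^\star\}\subset\Theta_T$ of cardinal $s$ and for the set $\mathcal Q^0=\{\theta_1^0,\dots,\theta^0_{s^0}\}\subset\Theta_T$ of cardinal $s^0$. Suppose also that $w_T$ satisfies the Noise Assumption (see context) for a noise level $\overline\sigma>0$ and a decay rate $\Delta_T>0$. Suppose finally that $|\Theta_T|/\sigma_T\ge1$. Then there exist finite positive constants $c$ and $C$, depending only on $r$ and the function $F$, such that the minimax separation rate $\rho^\star(\alpha)$ for the test problem $H_0$ against $H_1(\rho)$ defined in the context satisfies, for any $\alpha\in(0,1)$, $$\rho^\star(\alpha)\le\rho^{(2)}(\alpha),\qquad\rho^{(2)}(\alpha):=C\,\overline\sigma\,\sqrt{(s\vee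 s^0\vee1)\,\Delta_T\log\left(\frac{c\,|\Theta_T|}{\alpha\,\sigma_T}\right)}.$$
   Context: **Model.** $\mathbb N=\{0,1,\dots\}$, $\mathbb R^*=\mathbb R\setminus\{0\}$, $a\vee b=\max(a,b)$, $a\wedge b=\min(a,b)$. $\Theta$ is either $\mathbb R$ or the torus $\mathbb R/\mathbb Z$, with Lebesgue measure $\mathrm{Leb}$; $|x-y|$ is the Euclidean distance on $\Theta$ (on the torus it takes values in $[0,1/2]$). $T\in\mathbb N$ is an index, $\lambda_T$ is a measure on the Borel $\sigma$-field of $\Theta$, $\mathfrak S\subset(0,\infty)$ is a set of scale parameters, $\sigma_T\in\mathfrak S$, and $h:\Theta\times\mathfrak S\to\mathbb R$. The features are $\varphi_T(\theta)=h(\theta-\cdot,\sigma_T)\in L^2(\lambda_T)$, normalized as $\phi_T(\theta)=\varphi_T(\theta)/\|\varphi_T(\theta)\|_{L^2(\lambda_T)}$, $\theta\in\Theta$. $\Theta_T$ is a compact interval of $\Theta$ ($\Theta_T=\Theta$ is allowed on the torus) of Euclidean length $|\Theta_T|$. For $\vartheta=(\theta_1,\dots,\theta_s)\in\Theta^s$ and $\beta\in\mathbb R^s$ write $\beta\Phi_T(\vartheta)=\sum_{k=1}^s\beta_k\phi_T(\theta_k)$; for $s=0$, $A^0=\{0\}$ for any set $A$ and $\beta\Phi_T(\vartheta)=0$. The noise $w_T$ is a random element of $L^2(\lambda_T)$. **Noise Assumption** (noise level $\overline\sigma>0$, decay rate $\Delta_T>0$). $w_T$ is a Gaussian process with $\mathbb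 E[\|w_T\|_{L^2(\lambda_T)}^4]<\infty$ and, for all $f\in L^2(\lambda_T)$, $\langle f,w_T\rangle_{L^2(\lambda_T)}$ is a centered Gaussian variable with variance at most $\overline\sigma^2\Delta_T\|f\|^2_{L^2(\lambda_T)}$. **Smoothness of the features.** $\theta\mapsto h(\theta,\sigma_T)$ is of class $\mathcal C^3$ on $\Theta$, $\|h(\cdot,\sigma_T)\|_{L^2(\mathrm{Leb})}=1$, and for all $\theta\in\Theta$ and $i\in\{0,\dots,3\}$: $\|h(\theta-\cdot,\sigma_T)\|_{L^2(\lambda_T)}>0$, $\|\partial_\theta^ih(\cdot,\sigma_T)\|_{L^2(\mathrm{Leb})}<\infty$, $\|\partial_\theta^ih(\theta-\cdot,\sigma_T)\|_{L^2(\lambda_T)}<\infty$. **Positivity:** $g_T(\theta):=\|\partial_\theta\phi_T(\theta)\|^2_{L^2(\lambda_T)}>0$ for all $\theta\in\Theta$. **Properties of $F$.** $F:\mathbb R_+\to\mathbb R$ is of class $\mathcal C^6$, $F(0)=1$, $F^{(1)}(0)=F^{(3)}(0)=F^{(5)}(0)=0$, $g_\infty:=-F''(0)>0$, $L_6:=g_\infty^{-3}|F^{(6)}(0)|<\infty$, and $L_i:=g_\infty^{-i/2}\|F^{(i)}\|_\infty<\infty$ for $i\in\{0,\dots,4\}$ (sup norms). $F$ also denotes its even extension to $\mathbb R$. **Kernels.** $\mathcal K_T(\theta,\theta')=\langle\phi_T(\theta),\phi_T(\theta')\rangle_{L^2(\lambda_T)}$. Set $\tilde D_{0}[f]=f$,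 $\tilde D_{1}[f]=g_T^{-1/2}f'$, $\tilde D_{i}[f]=\tilde D_{1}[\tilde D_{i-1}[f]]$ for $i\ge2$, and $\mathcal K_T^{[i,j]}(\theta,\theta')=\langle\tilde D_i[\phi_T](\theta),\tilde D_j[\phi_T](\theta')\rangle_{L^2(\lambda_T)}$ for $i,j\in\{0,\dots,3\}$. The approximating kernel is $\mathcal K_T^{\rm prox}(\theta,\theta')=F(|\theta-\theta'|/\sigma_T)$, with $\mathcal K_T^{{\rm prox}[i,j]}(\theta,\theta')=(-1)^jg_\infty^{-(i+j)/2}F^{(i+j)}((\theta-\theta')/\sigma_T)$ (on the torus $\theta-\theta'$ is represented in $(-1/2,1/2]$) and $g_{\mathcal K_T^{\rm prox}}(\theta)=g_\infty/\sigma_T^2$. For $\mathcal K\in\{\mathcal K_T,\mathcal K_T^{\rm prox}\}$ let $h_{\mathcal K}(\theta)=\mathcal K^{[3,3]}(\theta,\theta)$. Define $$C_T=\max\left(\sup_{\Theta_T}\sqrt{g_{\mathcal K_T^{\rm prox}}/g_T},\ \sup_{\Theta_T}\sqrt{g_T/g_{\mathcal K_T^{\rm prox}}}\right),$$ $$\mathcal V_T=\max\left(\max_{i,j\in\{0,1,2\}}\sup_{\Theta_T^2}|\mathcal K_T^{[i,j]}-\mathcal K_T^{{\rm prox}[i,j]}|,\ \sup_{\Theta_T}|h_{\mathcal K_T}-h_{\mathcal K_T^{\rm prox}}|\right).$$ **Quantities from $F$.** For $r>0$: $\varepsilon(r)=1-\sup\{|F(r')|:r'\ge r\}$, $\nu(r)=-\sup\{F''(r')/g_\infty:r'\in[0,r]\}$,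 $$H^{(1)}_\infty(r)=\tfrac12\wedge L_2\wedge L_3\wedge L_4\wedge L_6\wedge\tfrac{\nu(2r)}{10}\wedge\tfrac{\varepsilon(r/2)}{10},$$ $$H^{(2)}_\infty(r)=\tfrac16\wedge\tfrac{8\varepsilon(r/2)}{10(5+2L_1)}\wedge\tfrac{8\nu(2r)}{9(2L_2+2L_3+4)}.$$ For $u>0$, $s\in\mathbb N$ (empty sums and maxima are $0$, $\inf\emptyset=+\infty$): $$\delta(u,s)=\inf\Big\{\delta>0:\ \max_{1\le\ell\le s}\sum_{k\ne\ell}g_\infty^{-i/2}|F^{(i)}(|x_\ell-x_k|)|\le u\ \text{ for all } i\in\{0,1,2,3\},\ (x_1,\dots,x_s)\in\mathbb R^s(\delta)\Big\},$$ where $A^s(\delta)=\{(\theta_1,\dots,\theta_s)\in A^s:|\theta_\ell-\theta_k|>\delta\text{ for all distinct }k,\ell\}$, $A^0(\delta)=\{0\}$, $A^1(\delta)=A$. Finally $\Sigma(\eta,r,s)=4\max\left(r\,g_\infty^{-1/2},\,2\,\delta(\eta H^{(2)}_\infty(r),s)\right)$. **Main Assumption** (for $T,s\in\mathbb N$, $r\in(0,1/\sqrt{2g_\infty L_2})$, $\eta\in(0,1)$ and a set $\mathcal Q\subset\Theta_T$ of cardinal $s$). (i) The smoothness of the features and the positivity of $g_T$ hold. (ii) The properties of $F$ hold, and $\varepsilon(r/2)>0$, $\nu(2r)>0$. (iii) $C_T\le2$ and, if $s\ge1$, $\mathcal V_T\le H^{(1)}_\infty(r)$ and $(s-1)\mathcal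 V_T\le(1-\eta)H^{(2)}_\infty(r)$. (iv) If $s\ge1$, $\delta(\eta H_\infty^{(2)}(r),s)<\infty$ and $|\theta-\theta'|>\sigma_T\,\Sigma(\eta,r,s)$ for all $\theta\ne\theta'$ in $\mathcal Q$. (For the sets $\mathcal Q^\star$, $\mathcal Q^0$ of components of vectors in $\Theta_T^s(\delta^\star)$, $\Theta_T^{s^0}(\delta^0)$, the pairwise separation in (iv) is automatic from the choice of $\delta^\star,\delta^0$.) **Test problem.** For given $\beta^0,\vartheta^0$ and $\rho\ge0$ (and given $s$, $\delta^\star$): $H_0$: $(\beta^\star,\vartheta^\star)\in(\mathbb R^* )^s\times\Theta_T^s(\delta^\star)$ with $\beta^\star\Phi_T(\vartheta^\star)=\beta^0\Phi_T(\vartheta^0)$; $H_1(\rho)$: $(\beta^\star,\vartheta^\star)\in(\mathbb R^* )^s\times\Theta_T^s(\delta^\star)$ with $\|\beta^\star\Phi_T(\vartheta^\star)-\beta^0\Phi_T(\vartheta^0)\|_{L^2(\lambda_T)}\ge\rho$. A test $\Psi$ is a measurable function of $y$ with values in $\{0,1\}$. Its maximal testing risk is $$R_\rho(\Psi)=\sup_{(\beta^\star,\vartheta^\star)\in H_0}\mathbb E_{(\beta^\star,\vartheta^\star)}[\Psi]+\sup_{(\beta^\star,\vartheta^\star)\in H_1(\rho)}\mathbb E_{(\beta^\star,\vartheta^\star)}[1-\Psi],$$ where under $\mathbb E_{(\beta^\star,\vartheta^\star)}$ one has $y=\beta^\star\Phi_T(\vartheta^\star)+w_T$. Under $H_0$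 one has $y=\beta^0\Phi_T(\vartheta^0)+w_T$, and the first term (maximal type I error) is written $\mathbb E_{(\beta^0,\vartheta^0)}[\Psi]$. The minimax testing risk is $R^\star_\rho=\inf_\Psi R_\rho(\Psi)$ (infimum over measurable functions from $L^2(\lambda_T)$ to $\{0,1\}$) and the minimax separation rate is $\rho^\star(\alpha)=\inf\{\rho>0:R^\star_\rho\le\alpha\}$. *)

theory Defs
  imports "HOL-Probability.Probability"
begin

section \<open>The space $L^2(\lambda)$\<close>

text \<open>
  Elements of $L^2(\lambda)$ are represented by square-integrable functions, not by equivalence
  classes. The open sets below are those of the $L^2$ seminorm; they are closed under almost
  everywhere equality, so the sigma-algebra they generate is the Borel sigma-algebra of the
  quotient, and its measurable functions are those of the quotient.
\<close>

definition L2 :: "real measure \<Rightarrow> (real \<Rightarrow> real) set" where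
  "L2 \<mu> = {f \<in> borel_measurable \<mu>. integrable \<mu> (\<lambda>x. (f x)\<^sup>2)}"

definition L2_inner :: "real measure \<Rightarrow> (real \<Rightarrow> real) \<Rightarrow> (real \<Rightarrow> real) \<Rightarrow> real" where
  "L2_inner \<mu> f g = (\<integral>x. f x * g x \<partial>\<mu>)"

definition L2_norm :: "real measure \<Rightarrow> (real \<Rightarrow> real) \<Rightarrow> real" where
  "L2_norm \<mu> f = sqrt (L2_inner \<mu> f f)"

definition L2_open :: "real measure \<Rightarrow> (real \<Rightarrow> real) set \<Rightarrow> bool" where
  "L2_open \<mu> U \<longleftrightarrow> U \<subseteq> L2 \<mu> \<and>
     (\<forall>f\<in>U. \<exists>e>0. \<forall>g\<in>L2 \<mu>. L2_norm \<mu> (\<lambda>x. g x - f x) < e \<longrightarrow> g \<in> U)"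

definition L2_borel :: "real measure \<Rightarrow> (real \<Rightarrow> real) measure" where
  "L2_borel \<mu> = sigma (L2 \<mu>) {U. L2_open \<mu> U}"

text \<open>Derivative at \<open>\<theta>\<close> of a map from the reals to $L^2(\mu)$; it is unique up to null sets, so the
  norms and inner products of \<open>L2_deriv\<close> do not depend on the choice.\<close>

definition L2_has_deriv ::
  "real measure \<Rightarrow> (real \<Rightarrow> real \<Rightarrow> real) \<Rightarrow> (real \<Rightarrow> real) \<Rightarrow> real \<Rightarrow> bool" where
  "L2_has_deriv \<mu> f d \<theta> \<longleftrightarrow> d \<in> L2 \<mu> \<and> (\<forall>\<^sub>F t in nhds \<theta>. f t \<in> L2 \<mu>) \<and>
     ((\<lambda>t. L2_norm \<mu> (\<lambda>x. (f t x - f \<theta> x) / (t - \<theta>) - d x)) \<longlongrightarrow> 0) (at \<theta>)"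

definition L2_deriv :: "real measure \<Rightarrow> (real \<Rightarrow> real \<Rightarrow> real) \<Rightarrow> real \<Rightarrow> real \<Rightarrow> real" where
  "L2_deriv \<mu> f \<theta> = (SOME d. L2_has_deriv \<mu> f d \<theta>)"


section \<open>Functions of class $C^n$\<close>

primrec nderiv :: "real set \<Rightarrow> nat \<Rightarrow> (real \<Rightarrow> real) \<Rightarrow> real \<Rightarrow> real" where
  "nderiv S 0 f = f"
| "nderiv S (Suc n) f = (\<lambda>x. vector_derivative (nderiv S n f) (at x within S))"

definition Ck_on :: "nat \<Rightarrow> (real \<Rightarrow> real) \<Rightarrow> real set \<Rightarrow> bool" where
  "Ck_on n f S \<longleftrightarrow>
     (\<forall>i<n. \<forall>x\<in>S. nderiv S i f differentiable (at x within S)) \<and> continuous_on S (nderiv S n f)"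


section \<open>The parameter space\<close>

text \<open>
  Points of the torus are represented in $[0,1)$, which identifies the Borel sigma-algebras;
  functions on the torus are 1-periodic functions on the reals.
\<close>

datatype domain = Line | Torus

fun points :: "domain \<Rightarrow> real set" where
  "points Line = UNIV"
| "points Torus = {0..<1}"

fun proj :: "domain \<Rightarrow> real \<Rightarrow> real" where
  "proj Line x = x"
| "proj Torus x = frac x"

text \<open>On the torus, the representative in $(-1/2,1/2]$ of a difference.\<close>

fun offset :: "domain \<Rightarrow> real \<Rightarrow> real" where
  "offset Line d = d"
| "offset Torus d = d - of_int \<lceil>d - 1 / 2\<rceil>"

definition gap :: "domain \<Rightarrow> real \<Rightarrow> real \<Rightarrow> real" where
  "gap D x y = \<bar>offset D (x - y)\<bar>"

definition Leb :: "domain \<Rightarrow> real measure" where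
  "Leb D = restrict_space lborel (points D)"

definition compact_interval :: "domain \<Rightarrow> real set \<Rightarrow> bool" where
  "compact_interval D I \<longleftrightarrow>
     (\<exists>a b. a \<le> b \<and> (D = Torus \<longrightarrow> b - a \<le> 1) \<and> I = proj D ` {a..b})"

text \<open>Vectors of length \<open>s\<close> are lists; \<open>sep_vecs D A s d\<close> is $A^s(d)$.\<close>

definition sep_vecs :: "domain \<Rightarrow> real set \<Rightarrow> nat \<Rightarrow> real \<Rightarrow> real list set" where
  "sep_vecs D A s d = {xs. length xs = s \<and> set xs \<subseteq> A \<and>
     (\<forall>k<s. \<forall>l<s. k \<noteq> l \<longrightarrow> gap D (xs ! l) (xs ! k) > d)}"

definition nonzero_vecs :: "nat \<Rightarrow> real list set" where
  "nonzero_vecs s = {bs. length bs = s \<and> 0 \<notin> set bs}"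


section \<open>The model\<close>

text \<open>The fields are $\Theta$, $\mathfrak S$, $h$, $\lambda_T$, $\sigma_T$ and $\Theta_T$.\<close>

record model =
  dom_of :: domain
  Scales :: "real set"
  hfun :: "real \<Rightarrow> real \<Rightarrow> real"
  lam :: "nat \<Rightarrow> real measure"
  sig :: "nat \<Rightarrow> real"
  ThetaT :: "nat \<Rightarrow> real set"

definition valid_model :: "model \<Rightarrow> nat \<Rightarrow> bool" where
  "valid_model M T \<longleftrightarrow>
     Scales M \<subseteq> {0<..} \<and> sig M T \<in> Scales M \<and>
     (dom_of M = Torus \<longrightarrow> (\<forall>\<sigma>\<in>Scales M. \<forall>x. hfun M (x + 1) \<sigma> = hfun M x \<sigma>)) \<and>
     sets (lam M T) = sets (restrict_space borel (points (dom_of M))) \<and>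
     compact_interval (dom_of M) (ThetaT M T)"

definition len :: "model \<Rightarrow> nat \<Rightarrow> real" where
  "len M T = measure lborel (ThetaT M T)"

definition varphi :: "model \<Rightarrow> nat \<Rightarrow> real \<Rightarrow> real \<Rightarrow> real" where
  "varphi M T \<theta> = (\<lambda>x. hfun M (\<theta> - x) (sig M T))"

definition phi :: "model \<Rightarrow> nat \<Rightarrow> real \<Rightarrow> real \<Rightarrow> real" where
  "phi M T \<theta> = (\<lambda>x. varphi M T \<theta> x / L2_norm (lam M T) (varphi M T \<theta>))"

definition mixture :: "model \<Rightarrow> nat \<Rightarrow> real list \<Rightarrow> real list \<Rightarrow> real \<Rightarrow> real" where
  "mixture M T \<beta> \<theta>s = (\<lambda>x. \<Sum>k<length \<theta>s. \<beta> ! k * phi M T (\<theta>s ! k) x)"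

definition gT :: "model \<Rightarrow> nat \<Rightarrow> real \<Rightarrow> real" where
  "gT M T \<theta> = (L2_norm (lam M T) (L2_deriv (lam M T) (phi M T) \<theta>))\<^sup>2"

primrec Dtilde ::
  "model \<Rightarrow> nat \<Rightarrow> nat \<Rightarrow> (real \<Rightarrow> real \<Rightarrow> real) \<Rightarrow> real \<Rightarrow> real \<Rightarrow> real" where
  "Dtilde M T 0 f = f"
| "Dtilde M T (Suc i) f =
     (\<lambda>\<theta> x. L2_deriv (lam M T) (Dtilde M T i f) \<theta> x / sqrt (gT M T \<theta>))"

definition KT :: "model \<Rightarrow> nat \<Rightarrow> nat \<Rightarrow> nat \<Rightarrow> real \<Rightarrow> real \<Rightarrow> real" where
  "KT M T i j \<theta> \<theta>' =
     L2_inner (lam M T) (Dtilde M T i (phi M T) \<theta>) (Dtilde M T j (phi M T) \<theta>')"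

definition smooth_features :: "model \<Rightarrow> nat \<Rightarrow> bool" where
  "smooth_features M T \<longleftrightarrow>
     (let h = (\<lambda>\<theta>. hfun M \<theta> (sig M T)); D = dom_of M in
       Ck_on 3 h UNIV \<and> L2_norm (Leb D) h = 1 \<and>
       (\<forall>\<theta>\<in>points D. L2_norm (lam M T) (\<lambda>x. h (\<theta> - x)) > 0 \<and>
          (\<forall>i\<le>3. nderiv UNIV i h \<in> L2 (Leb D) \<and>
                  (\<lambda>x. nderiv UNIV i h (\<theta> - x)) \<in> L2 (lam M T))))"

text \<open>
  The derivatives of $\theta \mapsto \phi_T(\theta) \in L^2(\lambda_T)$ occurring in $g_T$ and in
  $\mathcal K_T^{[i,j]}$, $i,j \le 3$, exist. This is what makes these objects meaningful: for a
  general $\lambda_T$ it does not follow from pointwise smoothness and finiteness of the norms.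
\<close>

definition features_differentiable :: "model \<Rightarrow> nat \<Rightarrow> bool" where
  "features_differentiable M T \<longleftrightarrow>
     (\<forall>i<3. \<forall>\<theta>\<in>points (dom_of M). \<exists>d. L2_has_deriv (lam M T) (Dtilde M T i (phi M T)) d \<theta>)"

definition positive_gT :: "model \<Rightarrow> nat \<Rightarrow> bool" where
  "positive_gT M T \<longleftrightarrow> (\<forall>\<theta>\<in>points (dom_of M). gT M T \<theta> > 0)"


section \<open>The function $F$\<close>

text \<open>\<open>F\<close> matters on $[0,\infty)$ only, with one-sided derivatives at 0; \<open>Fd_even\<close> gives the
  derivatives of the even extension to the reals.\<close>

definition Fd :: "(real \<Rightarrow> real) \<Rightarrow> nat \<Rightarrow> real \<Rightarrow> real" where
  "Fd F i = nderiv {0..} i F"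

definition Fd_even :: "(real \<Rightarrow> real) \<Rightarrow> nat \<Rightarrow> real \<Rightarrow> real" where
  "Fd_even F i = nderiv UNIV i (\<lambda>x. F \<bar>x\<bar>)"

definition ginf :: "(real \<Rightarrow> real) \<Rightarrow> real" where
  "ginf F = - Fd F 2 0"

definition Lsup :: "(real \<Rightarrow> real) \<Rightarrow> nat \<Rightarrow> real" where
  "Lsup F i = ginf F powr (- real i / 2) * (SUP x\<in>{0..}. \<bar>Fd F i x\<bar>)"

definition L6 :: "(real \<Rightarrow> real) \<Rightarrow> real" where
  "L6 F = ginf F powr (-3) * \<bar>Fd F 6 0\<bar>"

definition F_properties :: "(real \<Rightarrow> real) \<Rightarrow> bool" where
  "F_properties F \<longleftrightarrow> Ck_on 6 F {0..} \<and> F 0 = 1 \<and>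
     Fd F 1 0 = 0 \<and> Fd F 3 0 = 0 \<and> Fd F 5 0 = 0 \<and> ginf F > 0 \<and>
     (\<forall>i\<le>4. bdd_above ((\<lambda>x. \<bar>Fd F i x\<bar>) ` {0..}))"

definition eps :: "(real \<Rightarrow> real) \<Rightarrow> real \<Rightarrow> real" where
  "eps F r = 1 - (SUP x\<in>{r..}. \<bar>F x\<bar>)"

definition nu :: "(real \<Rightarrow> real) \<Rightarrow> real \<Rightarrow> real" where
  "nu F r = - (SUP x\<in>{0..r}. Fd F 2 x / ginf F)"

definition H1inf :: "(real \<Rightarrow> real) \<Rightarrow> real \<Rightarrow> real" where
  "H1inf F r = Min {1 / 2, Lsup F 2, Lsup F 3, Lsup F 4, L6 F, nu F (2 * r) / 10, eps F (r / 2) / 10}"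

definition H2inf :: "(real \<Rightarrow> real) \<Rightarrow> real \<Rightarrow> real" where
  "H2inf F r = Min {1 / 6, 8 * eps F (r / 2) / (10 * (5 + 2 * Lsup F 1)),
     8 * nu F (2 * r) / (9 * (2 * Lsup F 2 + 2 * Lsup F 3 + 4))}"

definition delta :: "(real \<Rightarrow> real) \<Rightarrow> real \<Rightarrow> nat \<Rightarrow> ereal" where
  "delta F u s = Inf (ereal ` {d. d > 0 \<and>
     (\<forall>i\<le>3. \<forall>xs\<in>sep_vecs Line UNIV s d. \<forall>l<s.
        (\<Sum>k\<in>{..<s} - {l}. ginf F powr (- real i / 2) * \<bar>Fd F i \<bar>xs ! l - xs ! k\<bar>\<bar>) \<le> u)})"

definition Sigma_sep :: "(real \<Rightarrow> real) \<Rightarrow> real \<Rightarrow> real \<Rightarrow> nat \<Rightarrow> ereal" where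
  "Sigma_sep F \<eta> r s =
     4 * max (ereal (r * ginf F powr (- 1 / 2))) (2 * delta F (\<eta> * H2inf F r) s)"


section \<open>Comparison with the approximating kernel\<close>

definition Kprox :: "(real \<Rightarrow> real) \<Rightarrow> model \<Rightarrow> nat \<Rightarrow> nat \<Rightarrow> nat \<Rightarrow> real \<Rightarrow> real \<Rightarrow> real" where
  "Kprox F M T i j \<theta> \<theta>' = (- 1) ^ j * ginf F powr (- real (i + j) / 2) *
     Fd_even F (i + j) (offset (dom_of M) (\<theta> - \<theta>') / sig M T)"

definition gprox :: "(real \<Rightarrow> real) \<Rightarrow> model \<Rightarrow> nat \<Rightarrow> real" where
  "gprox F M T = ginf F / (sig M T)\<^sup>2"

definition CT :: "(real \<Rightarrow> real) \<Rightarrow> model \<Rightarrow> nat \<Rightarrow> ereal" where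
  "CT F M T = max (SUP \<theta>\<in>ThetaT M T. ereal (sqrt (gprox F M T / gT M T \<theta>)))
                  (SUP \<theta>\<in>ThetaT M T. ereal (sqrt (gT M T \<theta> / gprox F M T)))"

definition VT :: "(real \<Rightarrow> real) \<Rightarrow> model \<Rightarrow> nat \<Rightarrow> ereal" where
  "VT F M T = max
     (SUP i\<in>{0..2}. SUP j\<in>{0..2}. SUP \<theta>\<in>ThetaT M T. SUP \<theta>'\<in>ThetaT M T.
        ereal \<bar>KT M T i j \<theta> \<theta>' - Kprox F M T i j \<theta> \<theta>'\<bar>)
     (SUP \<theta>\<in>ThetaT M T. ereal \<bar>KT M T 3 3 \<theta> \<theta> - Kprox F M T 3 3 \<theta> \<theta>\<bar>)"

definition main_assumption ::
  "(real \<Rightarrow> real) \<Rightarrow> model \<Rightarrow> nat \<Rightarrow> nat \<Rightarrow> real \<Rightarrow> real \<Rightarrow> real set \<Rightarrow> bool" where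
  "main_assumption F M T s r \<eta> Q \<longleftrightarrow>
     Q \<subseteq> ThetaT M T \<and> finite Q \<and> card Q = s \<and>
     smooth_features M T \<and> features_differentiable M T \<and> positive_gT M T \<and>
     F_properties F \<and> eps F (r / 2) > 0 \<and> nu F (2 * r) > 0 \<and>
     CT F M T \<le> 2 \<and>
     (s \<ge> 1 \<longrightarrow> VT F M T \<le> ereal (H1inf F r) \<and>
        ereal (real s - 1) * VT F M T \<le> ereal ((1 - \<eta>) * H2inf F r)) \<and>
     (s \<ge> 1 \<longrightarrow> delta F (\<eta> * H2inf F r) s < \<infinity> \<and>
        (\<forall>\<theta>\<in>Q. \<forall>\<theta>'\<in>Q. \<theta> \<noteq> \<theta>' \<longrightarrow>
           ereal (gap (dom_of M) \<theta> \<theta>') > ereal (sig M T) * Sigma_sep F \<eta> r s))"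


section \<open>The noise\<close>

definition gaussian :: "real \<Rightarrow> real \<Rightarrow> real measure" where
  "gaussian m v = (if v = 0 then return borel m else density lborel (normal_density m (sqrt v)))"

text \<open>
  \<open>W\<close> is the law on $L^2(\mu)$ of the noise. Inner products are linear in \<open>f\<close>, so the last
  conjunct makes all their finite families jointly Gaussian.
\<close>

definition noise_assumption :: "real measure \<Rightarrow> (real \<Rightarrow> real) measure \<Rightarrow> real \<Rightarrow> real \<Rightarrow> bool" where
  "noise_assumption \<mu> W \<sigma>bar \<Delta> \<longleftrightarrow>
     prob_space W \<and> sets W = sets (L2_borel \<mu>) \<and>
     (\<integral>\<^sup>+ w. ennreal (L2_norm \<mu> w ^ 4) \<partial>W) < \<infinity> \<and>
     (\<forall>f\<in>L2 \<mu>. \<exists>v. 0 \<le> v \<and> v \<le> \<sigma>bar\<^sup>2 * \<Delta> * (L2_norm \<mu> f)\<^sup>2 \<and>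
        distr W borel (\<lambda>w. L2_inner \<mu> f w) = gaussian 0 v)"


section \<open>The test problem\<close>

definition params :: "model \<Rightarrow> nat \<Rightarrow> nat \<Rightarrow> real \<Rightarrow> (real list \<times> real list) set" where
  "params M T s d = nonzero_vecs s \<times> sep_vecs (dom_of M) (ThetaT M T) s d"

definition H0 :: "model \<Rightarrow> nat \<Rightarrow> nat \<Rightarrow> real \<Rightarrow> real list \<Rightarrow> real list \<Rightarrow> (real list \<times> real list) set" where
  "H0 M T s d \<beta>0 \<theta>0 = {(\<beta>, \<theta>s) \<in> params M T s d.
     AE x in lam M T. mixture M T \<beta> \<theta>s x = mixture M T \<beta>0 \<theta>0 x}"

definition H1 ::
  "model \<Rightarrow> nat \<Rightarrow> nat \<Rightarrow> real \<Rightarrow> real list \<Rightarrow> real list \<Rightarrow> real \<Rightarrow> (real list \<times> real list) set" where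
  "H1 M T s d \<beta>0 \<theta>0 \<rho> = {(\<beta>, \<theta>s) \<in> params M T s d.
     L2_norm (lam M T) (\<lambda>x. mixture M T \<beta> \<theta>s x - mixture M T \<beta>0 \<theta>0 x) \<ge> \<rho>}"

definition tests :: "real measure \<Rightarrow> ((real \<Rightarrow> real) \<Rightarrow> real) set" where
  "tests \<mu> = {\<Psi> \<in> borel_measurable (L2_borel \<mu>). \<forall>y\<in>L2 \<mu>. \<Psi> y \<in> {0, 1}}"

text \<open>Expectation of a nonnegative function of the observation under the parameters \<open>(\<beta>, \<theta>s)\<close>.\<close>

definition expect ::
  "model \<Rightarrow> nat \<Rightarrow> (real \<Rightarrow> real) measure \<Rightarrow> real list \<times> real list \<Rightarrow> ((real \<Rightarrow> real) \<Rightarrow> real) \<Rightarrow> ennreal" where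
  "expect M T W p f = (\<integral>\<^sup>+ w. ennreal (f (\<lambda>x. mixture M T (fst p) (snd p) x + w x)) \<partial>W)"

text \<open>
  All members of \<open>H0\<close> have the law of the observation under \<open>(\<beta>0, \<theta>0)\<close>. Inserting
  \<open>(\<beta>0, \<theta>0)\<close> makes the first term the type I error under \<open>(\<beta>0, \<theta>0)\<close> even when no mixture
  of \<open>s\<close> features represents the null signal and \<open>H0\<close> is empty; it can only increase the risk.
\<close>

definition risk ::
  "model \<Rightarrow> nat \<Rightarrow> (real \<Rightarrow> real) measure \<Rightarrow> nat \<Rightarrow> real \<Rightarrow> real list \<Rightarrow> real list \<Rightarrow> real
     \<Rightarrow> ((real \<Rightarrow> real) \<Rightarrow> real) \<Rightarrow> ennreal" where
  "risk M T W s d \<beta>0 \<theta>0 \<rho> \<Psi> =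
     (SUP p\<in>insert (\<beta>0, \<theta>0) (H0 M T s d \<beta>0 \<theta>0). expect M T W p \<Psi>) +
     (SUP p\<in>H1 M T s d \<beta>0 \<theta>0 \<rho>. expect M T W p (\<lambda>y. 1 - \<Psi> y))"

definition minimax_risk ::
  "model \<Rightarrow> nat \<Rightarrow> (real \<Rightarrow> real) measure \<Rightarrow> nat \<Rightarrow> real \<Rightarrow> real list \<Rightarrow> real list \<Rightarrow> real \<Rightarrow> ennreal" where
  "minimax_risk M T W s d \<beta>0 \<theta>0 \<rho> = (INF \<Psi>\<in>tests (lam M T). risk M T W s d \<beta>0 \<theta>0 \<rho> \<Psi>)"

definition separation_rate ::
  "model \<Rightarrow> nat \<Rightarrow> (real \<Rightarrow> real) measure \<Rightarrow> nat \<Rightarrow> real \<Rightarrow> real list \<Rightarrow> real list \<Rightarrow> real \<Rightarrow> ereal" where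
  "separation_rate M T W s d \<beta>0 \<theta>0 \<alpha> =
     Inf (ereal ` {\<rho>. \<rho> > 0 \<and> minimax_risk M T W s d \<beta>0 \<theta>0 \<rho> \<le> ennreal \<alpha>})"

end

theory Submission
  imports Defs
begin

text \<open>
  The test that achieves the rate compares the centred observation \<open>y - f\<^sub>0\<close>, where \<open>f\<^sub>0\<close> is the
  null signal, with finitely many fixed directions of norm at most one, and rejects if one of the
  inner products is large. By the noise assumption each inner product of the noise with a direction
  is Gaussian with variance at most \<open>\<sigma>\<^sup>2 \<Delta>\<close>, so a union bound controls the event that the noise
  alone crosses a threshold. Outside that event the null hypothesis is accepted, and an alternative
  is rejected as soon as one direction sees twice its threshold
  (\<open>minimax_risk_le_finite_test\<close>). What has to be shown is that a signal \<open>f\<close> at distance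
  \<open>\<rho>\<close> from \<open>f\<^sub>0\<close> is seen by one of few directions.

  Cut the parameter interval into cells whose width is a small multiple of \<open>\<sigma>\<^sub>T\<close>; there are
  \<open>N\<close> of them, with \<open>N\<close> of the order of \<open>\<bar>\<Theta>\<^sub>T\<bar> / \<sigma>\<^sub>T\<close>. Two mixtures belong to the same class if
  their \<open>k\<close>-th parameters lie in the same cell for every \<open>k\<close>. There are at most \<open>N ^ s\<close> classes, and
  the logarithm of this number is at most of the order of the squared rate: one direction per class, with a
  threshold of order \<open>sqrt (s ln N)\<close>, is affordable. For each class take a reference \<open>f\<^sub>A\<close> among its
  alternatives whose distance to \<open>f\<^sub>0\<close> is minimal up to a factor two, and use the direction of
  \<open>f\<^sub>A - f\<^sub>0\<close>. It remains to handle \<open>f - f\<^sub>A\<close>, a difference of two mixtures of the same class, since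
  \<open>\<parallel>f - f\<^sub>0\<parallel>\<^sup>2\<close> is the sum of the inner products of \<open>f - f\<^sub>0\<close> with \<open>f - f\<^sub>A\<close> and with \<open>f\<^sub>A - f\<^sub>0\<close>
  (\<open>L2_norm_le_from_reference\<close>).

  The normalized features form a curve on the unit sphere. Inside a cell this curve is almost
  straight, so that \<open>f - f\<^sub>A\<close> is, up to a small relative error, a combination of the features
  and of the unit velocities at the base points of the \<open>s\<close> cells. The separation of the parameters
  makes these \<open>2 s\<close> vectors nearly orthonormal: the sums of the kernel and its derivatives off the
  diagonal are at most $1/6$. Hence the coefficients are controlled by \<open>\<parallel>f - f\<^sub>A\<parallel>\<close>, and the
  inner product of \<open>f - f\<^sub>0\<close> with \<open>f - f\<^sub>A\<close> is small if those with the base vectors are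
  (\<open>cell_comparison\<close>). Over all classes there are only \<open>2 N\<close> base vectors, so their threshold is of
  order \<open>sqrt (ln N)\<close>; the factor \<open>sqrt s\<close> appears when the \<open>2 s\<close> coordinates are summed with the
  Cauchy-Schwarz inequality. Both kinds of directions thus lead to the same rate
  (\<open>minimax_risk_le_classes\<close>).

  Only mixtures of the same class are compared with each other. Their parameters are matched cell
  by cell, so neither nearly coinciding parameters of different mixtures nor parameters at the two
  ends of an interval that almost covers the torus require a separate treatment.
\<close>

section \<open>Square-integrable functions\<close>

lemma L2_measurable: "f \<in> L2 \<mu> \<Longrightarrow> f \<in> borel_measurable \<mu>"
  and L2_square_integrable: "f \<in> L2 \<mu> \<Longrightarrow> integrable \<mu> (\<lambda>x. (f x)\<^sup>2)"
  by (auto simp: L2_def)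

lemma L2_integrable_mult:
  assumes "f \<in> L2 \<mu>" "g \<in> L2 \<mu>"
  shows "integrable \<mu> (\<lambda>x. f x * g x)"
proof (rule Bochner_Integration.integrable_bound)
  show "integrable \<mu> (\<lambda>x. (f x)\<^sup>2 + (g x)\<^sup>2)"
    using assms by (intro Bochner_Integration.integrable_add L2_square_integrable)
  show "(\<lambda>x. f x * g x) \<in> borel_measurable \<mu>"
    using assms by (intro borel_measurable_times L2_measurable)
  have "\<bar>u * v\<bar> \<le> u\<^sup>2 + v\<^sup>2" for u v :: real
    using sum_squares_bound[of "\<bar>u\<bar>" "\<bar>v\<bar>"] mult_nonneg_nonneg[of "\<bar>u\<bar>" "\<bar>v\<bar>"]
    unfolding abs_mult power2_abs by linarith
  then show "AE x in \<mu>. norm (f x * g x) \<le> norm ((f x)\<^sup>2 + (g x)\<^sup>2)"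
    by simp
qed

lemma L2_zero [simp]: "(\<lambda>x. 0) \<in> L2 \<mu>"
  by (simp add: L2_def)

lemma L2_add [simp]:
  assumes "f \<in> L2 \<mu>" "g \<in> L2 \<mu>"
  shows "(\<lambda>x. f x + g x) \<in> L2 \<mu>"
proof -
  have "integrable \<mu> (\<lambda>x. (f x)\<^sup>2 + (g x)\<^sup>2 + 2 * (f x * g x))"
    using assms by (intro Bochner_Integration.integrable_add integrable_mult_right
        L2_square_integrable L2_integrable_mult)
  moreover have "(\<lambda>x. (f x + g x)\<^sup>2) = (\<lambda>x. (f x)\<^sup>2 + (g x)\<^sup>2 + 2 * (f x * g x))"
    by (simp add: power2_sum algebra_simps)
  ultimately show ?thesis
    using assms by (auto simp: L2_def)
qed

lemma L2_scale [simp]: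
  assumes "f \<in> L2 \<mu>"
  shows "(\<lambda>x. c * f x) \<in> L2 \<mu>"
  using assms by (auto simp: L2_def power_mult_distrib)

lemma L2_diff [simp]: "f \<in> L2 \<mu> \<Longrightarrow> g \<in> L2 \<mu> \<Longrightarrow> (\<lambda>x. f x - g x) \<in> L2 \<mu>"
  using L2_add[of f \<mu> "\<lambda>x. - 1 * g x"] L2_scale[of g \<mu> "- 1"] by simp

lemma L2_divide [simp]: "f \<in> L2 \<mu> \<Longrightarrow> (\<lambda>x. f x / c) \<in> L2 \<mu>"
  using L2_scale[of f \<mu> "1 / c"] by simp

lemma L2_sum:
  "(\<And>i. i \<in> A \<Longrightarrow> e i \<in> L2 \<mu>) \<Longrightarrow> (\<lambda>x. \<Sum>i\<in>A. e i x) \<in> L2 \<mu>"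
  by (induction A rule: infinite_finite_induct) simp_all

lemma L2_sum_scale [simp]:
  "(\<And>i. i \<in> A \<Longrightarrow> e i \<in> L2 \<mu>) \<Longrightarrow> (\<lambda>x. \<Sum>i\<in>A. a i * e i x) \<in> L2 \<mu>"
  by (intro L2_sum L2_scale)

lemma L2_inner_commute: "L2_inner \<mu> f g = L2_inner \<mu> g f"
  by (simp add: L2_inner_def mult.commute)

lemma L2_inner_zero_right [simp]: "L2_inner \<mu> f (\<lambda>x. 0) = 0"
  by (simp add: L2_inner_def)

lemma L2_inner_scale_right [simp]: "L2_inner \<mu> f (\<lambda>x. c * g x) = c * L2_inner \<mu> f g"
proof -
  have "(\<lambda>x. f x * (c * g x)) = (\<lambda>x. c * (f x * g x))" by (simp add: ac_simps)
  then show ?thesis by (simp add: L2_inner_def)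
qed

lemma L2_inner_divide_right [simp]: "L2_inner \<mu> f (\<lambda>x. g x / c) = L2_inner \<mu> f g / c"
  using L2_inner_scale_right[of \<mu> f "1 / c" g] by simp

lemma L2_inner_add_right [simp]:
  "f \<in> L2 \<mu> \<Longrightarrow> g \<in> L2 \<mu> \<Longrightarrow> h \<in> L2 \<mu> \<Longrightarrow>
    L2_inner \<mu> f (\<lambda>x. g x + h x) = L2_inner \<mu> f g + L2_inner \<mu> f h"
  by (simp add: L2_inner_def distrib_left L2_integrable_mult)

lemma L2_inner_diff_right [simp]:
  "f \<in> L2 \<mu> \<Longrightarrow> g \<in> L2 \<mu> \<Longrightarrow> h \<in> L2 \<mu> \<Longrightarrow>
    L2_inner \<mu> f (\<lambda>x. g x - h x) = L2_inner \<mu> f g - L2_inner \<mu> f h"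
  by (simp add: L2_inner_def right_diff_distrib L2_integrable_mult)

lemma L2_inner_sum_right:
  assumes "f \<in> L2 \<mu>" "\<And>i. i \<in> A \<Longrightarrow> e i \<in> L2 \<mu>"
  shows "L2_inner \<mu> f (\<lambda>x. \<Sum>i\<in>A. a i * e i x) = (\<Sum>i\<in>A. a i * L2_inner \<mu> f (e i))"
  using assms(2)
proof (induction A rule: infinite_finite_induct)
  case (insert j A)
  then have "(\<lambda>x. \<Sum>i\<in>A. a i * e i x) \<in> L2 \<mu>" "e j \<in> L2 \<mu>" by simp_all
  then show ?case using insert assms(1) by simp
qed simp_all

lemma L2_inner_add_left [simp]:
  "f \<in> L2 \<mu> \<Longrightarrow> g \<in> L2 \<mu> \<Longrightarrow> h \<in> L2 \<mu> \<Longrightarrow>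
    L2_inner \<mu> (\<lambda>x. g x + h x) f = L2_inner \<mu> g f + L2_inner \<mu> h f"
  by (simp add: L2_inner_commute[of _ _ f])

lemma L2_inner_diff_left [simp]:
  "f \<in> L2 \<mu> \<Longrightarrow> g \<in> L2 \<mu> \<Longrightarrow> h \<in> L2 \<mu> \<Longrightarrow>
    L2_inner \<mu> (\<lambda>x. g x - h x) f = L2_inner \<mu> g f - L2_inner \<mu> h f"
  by (simp add: L2_inner_commute[of _ _ f])

lemma L2_inner_scale_left [simp]: "L2_inner \<mu> (\<lambda>x. c * g x) f = c * L2_inner \<mu> g f"
  by (simp add: L2_inner_commute[of _ _ f])

lemma L2_inner_sum_left:
  assumes "f \<in> L2 \<mu>" "\<And>i. i \<in> A \<Longrightarrow> e i \<in> L2 \<mu>"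
  shows "L2_inner \<mu> (\<lambda>x. \<Sum>i\<in>A. a i * e i x) f = (\<Sum>i\<in>A. a i * L2_inner \<mu> (e i) f)"
  using L2_inner_sum_right[OF assms] by (simp add: L2_inner_commute[of _ _ f])

lemma L2_inner_self_nonneg [simp]: "0 \<le> L2_inner \<mu> f f"
  by (simp add: L2_inner_def)

lemma L2_norm_nonneg [simp]: "0 \<le> L2_norm \<mu> f"
  by (simp add: L2_norm_def)

lemma L2_norm_square: "(L2_norm \<mu> f)\<^sup>2 = L2_inner \<mu> f f"
  by (simp add: L2_norm_def)

lemma L2_norm_scale [simp]: "L2_norm \<mu> (\<lambda>x. c * f x) = \<bar>c\<bar> * L2_norm \<mu> f"
  by (simp add: L2_norm_def L2_inner_commute[of _ "\<lambda>x. c * f x" f] real_sqrt_mult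
      flip: mult.assoc)

lemma L2_norm_divide [simp]: "L2_norm \<mu> (\<lambda>x. f x / c) = L2_norm \<mu> f / \<bar>c\<bar>"
  using L2_norm_scale[of \<mu> "1 / c" f] by simp

lemma L2_Cauchy_Schwarz:
  assumes "f \<in> L2 \<mu>" "g \<in> L2 \<mu>"
  shows "\<bar>L2_inner \<mu> f g\<bar> \<le> L2_norm \<mu> f * L2_norm \<mu> g"
proof -
  let ?a = "L2_inner \<mu> f f" and ?b = "L2_inner \<mu> g g" and ?c = "L2_inner \<mu> f g"
  have quad: "0 \<le> u\<^sup>2 * ?a + 2 * u * v * ?c + v\<^sup>2 * ?b" for u v :: real
  proof -
    have "0 \<le> L2_inner \<mu> (\<lambda>x. u * f x + v * g x) (\<lambda>x. u * f x + v * g x)" by simp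
    also have "\<dots> = u\<^sup>2 * ?a + 2 * u * v * ?c + v\<^sup>2 * ?b"
      using assms by (simp add: L2_inner_commute[of \<mu> g f] power2_eq_square algebra_simps)
    finally show ?thesis .
  qed
  have "?c\<^sup>2 \<le> ?a * ?b"
  proof (cases "?b = 0")
    case True
    have "0 \<le> ?a + 2 * v * ?c" for v using quad[of 1 v] True by simp
    from this[of "- (?a + 1) / (2 * ?c)"] have "?c = 0"
      by (cases "?c = 0") (simp_all add: field_simps)
    then show ?thesis by simp
  next
    case False
    then have "0 < ?b" using L2_inner_self_nonneg[of \<mu> g] by linarith
    have "0 \<le> ?b * (?a * ?b - ?c\<^sup>2)"
      using quad[of ?b "- ?c"] by (simp add: power2_eq_square algebra_simps)
    then show ?thesis using \<open>0 < ?b\<close> by (simp add: zero_le_mult_iff)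
  qed
  then have "sqrt (?c\<^sup>2) \<le> sqrt (?a * ?b)" by (rule real_sqrt_le_mono)
  then show ?thesis by (simp add: L2_norm_def real_sqrt_mult)
qed

lemma L2_norm_triangle:
  assumes "f \<in> L2 \<mu>" "g \<in> L2 \<mu>"
  shows "L2_norm \<mu> (\<lambda>x. f x + g x) \<le> L2_norm \<mu> f + L2_norm \<mu> g"
proof (rule power2_le_imp_le)
  have "(L2_norm \<mu> (\<lambda>x. f x + g x))\<^sup>2 =
      (L2_norm \<mu> f)\<^sup>2 + 2 * L2_inner \<mu> f g + (L2_norm \<mu> g)\<^sup>2"
    using assms by (simp add: L2_norm_square L2_inner_commute[of \<mu> g f])
  also have "\<dots> \<le> (L2_norm \<mu> f + L2_norm \<mu> g)\<^sup>2"
    using L2_Cauchy_Schwarz[OF assms] by (simp add: power2_sum)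
  finally show "(L2_norm \<mu> (\<lambda>x. f x + g x))\<^sup>2 \<le> (L2_norm \<mu> f + L2_norm \<mu> g)\<^sup>2" .
qed simp

lemma L2_norm_triangle_diff:
  assumes "f \<in> L2 \<mu>" "g \<in> L2 \<mu>"
  shows "L2_norm \<mu> (\<lambda>x. f x - g x) \<le> L2_norm \<mu> f + L2_norm \<mu> g"
  using L2_norm_triangle[OF assms(1) L2_scale[OF assms(2), of "-1"]] 
    L2_norm_scale[of \<mu> "-1" g] by simp

text \<open>Derivatives in \<open>L2\<close> enter the argument only through inner products with a fixed vector. These
  are real functions, to which the mean value theorem applies.\<close>

lemma L2_has_deriv_inner:
  assumes D: "L2_has_deriv \<mu> f d \<theta>" and w: "w \<in> L2 \<mu>"
  shows "((\<lambda>t. L2_inner \<mu> w (f t)) has_real_derivative L2_inner \<mu> w d) (at \<theta>)"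
proof -
  let ?q = "\<lambda>t x. (f t x - f \<theta> x) / (t - \<theta>)"
  have d: "d \<in> L2 \<mu>" and ev: "\<forall>\<^sub>F t in nhds \<theta>. f t \<in> L2 \<mu>"
    and lim: "((\<lambda>t. L2_norm \<mu> (\<lambda>x. ?q t x - d x)) \<longlongrightarrow> 0) (at \<theta>)"
    using D by (auto simp: L2_has_deriv_def)
  have f\<theta>: "f \<theta> \<in> L2 \<mu>" using ev by (rule eventually_nhds_x_imp_x)
  have "((\<lambda>t. (L2_inner \<mu> w (f t) - L2_inner \<mu> w (f \<theta>)) / (t - \<theta>) - L2_inner \<mu> w d) \<longlongrightarrow> 0) (at \<theta>)"
  proof (rule Lim_null_comparison)
    show "((\<lambda>t. L2_norm \<mu> w * L2_norm \<mu> (\<lambda>x. ?q t x - d x)) \<longlongrightarrow> 0) (at \<theta>)"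
      using tendsto_mult_right_zero[OF lim] by simp
    have "\<forall>\<^sub>F t in at \<theta>. f t \<in> L2 \<mu>"
      using ev by (simp add: eventually_at_filter eventually_mono)
    then show "\<forall>\<^sub>F t in at \<theta>.
        norm ((L2_inner \<mu> w (f t) - L2_inner \<mu> w (f \<theta>)) / (t - \<theta>) - L2_inner \<mu> w d)
          \<le> L2_norm \<mu> w * L2_norm \<mu> (\<lambda>x. ?q t x - d x)"
    proof eventually_elim
      case (elim t)
      have "(L2_inner \<mu> w (f t) - L2_inner \<mu> w (f \<theta>)) / (t - \<theta>) - L2_inner \<mu> w d =
          L2_inner \<mu> w (\<lambda>x. ?q t x - d x)"
        using elim w d f\<theta> by simp
      then show ?case using L2_Cauchy_Schwarz[of w \<mu> "\<lambda>x. ?q t x - d x"] elim w d f\<theta> by simp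
    qed
  qed
  then show ?thesis
    by (simp add: has_field_derivative_iff LIM_zero_iff)
qed

lemma L2_borel_space [simp]: "space (L2_borel \<mu>) = L2 \<mu>"
  and L2_open_sets: "L2_open \<mu> U \<Longrightarrow> U \<in> sets (L2_borel \<mu>)"
proof -
  have sub: "{U. L2_open \<mu> U} \<subseteq> Pow (L2 \<mu>)" by (auto simp: L2_open_def)
  show "space (L2_borel \<mu>) = L2 \<mu>"
    using sub by (simp add: L2_borel_def space_measure_of)
  show "L2_open \<mu> U \<Longrightarrow> U \<in> sets (L2_borel \<mu>)"
    using sub by (simp add: L2_borel_def sets_measure_of sigma_sets.Basic)
qed

text \<open>A linear functional is continuous for the seminorm, so the half-spaces from which rejection
  regions are built are open.\<close>

lemma L2_inner_measurable:
  assumes d: "d \<in> L2 \<mu>"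
  shows "(\<lambda>y. L2_inner \<mu> y d) \<in> borel_measurable (L2_borel \<mu>)"
proof (rule borel_measurableI_greater)
  fix c :: real
  let ?U = "{y \<in> L2 \<mu>. c < L2_inner \<mu> y d}"
  have "L2_open \<mu> ?U"
    unfolding L2_open_def
  proof (intro conjI ballI)
    fix f assume f: "f \<in> ?U"
    define e where "e = (L2_inner \<mu> f d - c) / (L2_norm \<mu> d + 1)"
    have pos: "0 < L2_norm \<mu> d + 1" using L2_norm_nonneg[of \<mu> d] by linarith
    have "0 < e" using f pos by (simp add: e_def)
    moreover have "g \<in> ?U" if g: "g \<in> L2 \<mu>" "L2_norm \<mu> (\<lambda>x. g x - f x) < e" for g
    proof -
      have "\<bar>L2_inner \<mu> g d - L2_inner \<mu> f d\<bar> \<le> L2_norm \<mu> (\<lambda>x. g x - f x) * L2_norm \<mu> d"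
        using L2_Cauchy_Schwarz[of "\<lambda>x. g x - f x" \<mu> d] f g d by simp
      also have "\<dots> \<le> L2_norm \<mu> (\<lambda>x. g x - f x) * (L2_norm \<mu> d + 1)"
        by (simp add: mult_left_mono)
      also have "\<dots> < e * (L2_norm \<mu> d + 1)"
        using g pos by (intro mult_strict_right_mono)
      also have "\<dots> = L2_inner \<mu> f d - c" using pos by (simp add: e_def)
      finally show ?thesis using g by auto
    qed
    ultimately show "\<exists>e>0. \<forall>g\<in>L2 \<mu>. L2_norm \<mu> (\<lambda>x. g x - f x) < e \<longrightarrow> g \<in> ?U" by blast
  qed auto
  then show "{y \<in> space (L2_borel \<mu>). c < L2_inner \<mu> y d} \<in> sets (L2_borel \<mu>)"
    by (simp add: L2_open_sets)
qed

section \<open>Nearly orthogonal families\<close>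

text \<open>Schur's test: splitting each product \<open>x k * y l\<close> into half the sum of the squares leaves the row
  sums as weights of the \<open>x k\<close> and the column sums as weights of the \<open>y l\<close>.\<close>

lemma Schur_bound:
  fixes m :: "'i \<Rightarrow> 'i \<Rightarrow> real"
  assumes A: "finite A"
    and rows: "\<And>k. k \<in> A \<Longrightarrow> (\<Sum>l\<in>A. \<bar>m k l\<bar>) \<le> \<rho>"
    and cols: "\<And>l. l \<in> A \<Longrightarrow> (\<Sum>k\<in>A. \<bar>m k l\<bar>) \<le> \<rho>"
  shows "\<bar>\<Sum>k\<in>A. \<Sum>l\<in>A. x k * y l * m k l\<bar> \<le> \<rho> * ((\<Sum>k\<in>A. (x k)\<^sup>2) + (\<Sum>k\<in>A. (y k)\<^sup>2)) / 2"
proof -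
  have "\<bar>\<Sum>k\<in>A. \<Sum>l\<in>A. x k * y l * m k l\<bar> \<le> (\<Sum>k\<in>A. \<Sum>l\<in>A. \<bar>x k * y l * m k l\<bar>)"
    by (rule order_trans[OF sum_abs sum_mono[OF sum_abs]])
  also have "\<dots> \<le> (\<Sum>k\<in>A. \<Sum>l\<in>A. (x k)\<^sup>2 / 2 * \<bar>m k l\<bar> + (y l)\<^sup>2 / 2 * \<bar>m k l\<bar>)"
  proof (intro sum_mono)
    fix k l
    have "\<bar>x k * y l\<bar> \<le> (x k)\<^sup>2 / 2 + (y l)\<^sup>2 / 2"
      using sum_squares_bound[of "\<bar>x k\<bar>" "\<bar>y l\<bar>"] by (simp add: abs_mult)
    then have "\<bar>x k * y l\<bar> * \<bar>m k l\<bar> \<le> ((x k)\<^sup>2 / 2 + (y l)\<^sup>2 / 2) * \<bar>m k l\<bar>"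
      by (rule mult_right_mono) simp
    then show "\<bar>x k * y l * m k l\<bar> \<le> (x k)\<^sup>2 / 2 * \<bar>m k l\<bar> + (y l)\<^sup>2 / 2 * \<bar>m k l\<bar>"
      by (simp add: abs_mult algebra_simps)
  qed
  also have "\<dots> = (\<Sum>k\<in>A. (x k)\<^sup>2 / 2 * (\<Sum>l\<in>A. \<bar>m k l\<bar>)) + (\<Sum>l\<in>A. (y l)\<^sup>2 / 2 * (\<Sum>k\<in>A. \<bar>m k l\<bar>))"
    unfolding sum.distrib sum_distrib_left
    by (subst (2) sum.swap) (rule refl)
  also have "\<dots> \<le> (\<Sum>k\<in>A. (x k)\<^sup>2 / 2 * \<rho>) + (\<Sum>l\<in>A. (y l)\<^sup>2 / 2 * \<rho>)"
    by (intro add_mono sum_mono mult_left_mono rows cols) auto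
  also have "\<dots> = \<rho> * ((\<Sum>k\<in>A. (x k)\<^sup>2) + (\<Sum>k\<in>A. (y k)\<^sup>2)) / 2"
    by (simp add: sum_divide_distrib[symmetric] sum_distrib_left[symmetric]
        sum_distrib_right[symmetric] algebra_simps add_divide_distrib)
  finally show ?thesis .
qed

text \<open>Two families indexed by the same set are compared because the features and the velocities at
  the base points must be separated from each other as well as among themselves.\<close>

lemma L2_inner_lincomb_off_diagonal:
  assumes A: "finite A"
    and e: "\<And>k. k \<in> A \<Longrightarrow> e k \<in> L2 \<mu>" and e': "\<And>k. k \<in> A \<Longrightarrow> e' k \<in> L2 \<mu>"
    and rows: "\<And>k. k \<in> A \<Longrightarrow> (\<Sum>l\<in>A - {k}. \<bar>L2_inner \<mu> (e k) (e' l)\<bar>) \<le> \<rho>"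
    and cols: "\<And>k. k \<in> A \<Longrightarrow> (\<Sum>l\<in>A - {k}. \<bar>L2_inner \<mu> (e' k) (e l)\<bar>) \<le> \<rho>"
  shows "\<bar>L2_inner \<mu> (\<lambda>t. \<Sum>k\<in>A. x k * e k t) (\<lambda>t. \<Sum>k\<in>A. y k * e' k t) -
      (\<Sum>k\<in>A. x k * y k * L2_inner \<mu> (e k) (e' k))\<bar>
    \<le> \<rho> * ((\<Sum>k\<in>A. (x k)\<^sup>2) + (\<Sum>k\<in>A. (y k)\<^sup>2)) / 2"
proof -
  define m where "m k l = (if k = l then 0 else L2_inner \<mu> (e k) (e' l))" for k l
  have off: "(\<Sum>l\<in>A. f l * (if k = l then 0 else u l)) = (\<Sum>l\<in>A - {k}. f l * u l)"
    if "k \<in> A" for k and f u :: "'a \<Rightarrow> real"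
    using A that by (subst sum.remove[of A k]) (auto intro!: sum.cong split: if_splits)
  have "L2_inner \<mu> (\<lambda>t. \<Sum>k\<in>A. x k * e k t) (\<lambda>t. \<Sum>k\<in>A. y k * e' k t) =
      (\<Sum>k\<in>A. x k * (\<Sum>l\<in>A. y l * L2_inner \<mu> (e k) (e' l)))"
    using e e' by (simp add: L2_inner_sum_left L2_inner_sum_right)
  also have "\<dots> = (\<Sum>k\<in>A. x k * y k * L2_inner \<mu> (e k) (e' k) + (\<Sum>l\<in>A. x k * y l * m k l))"
  proof (rule sum.cong[OF refl])
    fix k assume k: "k \<in> A"
    have "(\<Sum>l\<in>A. x k * y l * m k l) = (\<Sum>l\<in>A - {k}. x k * y l * L2_inner \<mu> (e k) (e' l))"
      unfolding m_def by (rule off[OF k])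
    then show "x k * (\<Sum>l\<in>A. y l * L2_inner \<mu> (e k) (e' l)) =
        x k * y k * L2_inner \<mu> (e k) (e' k) + (\<Sum>l\<in>A. x k * y l * m k l)"
      using A k by (subst sum.remove[of A k]) (simp_all add: sum_distrib_left algebra_simps)
  qed
  finally have "L2_inner \<mu> (\<lambda>t. \<Sum>k\<in>A. x k * e k t) (\<lambda>t. \<Sum>k\<in>A. y k * e' k t) -
      (\<Sum>k\<in>A. x k * y k * L2_inner \<mu> (e k) (e' k)) = (\<Sum>k\<in>A. \<Sum>l\<in>A. x k * y l * m k l)"
    by (simp add: sum.distrib)
  moreover have "(\<Sum>l\<in>A. \<bar>m k l\<bar>) \<le> \<rho>" if "k \<in> A" for k
    using off[OF that, of "\<lambda>_. 1" "\<lambda>l. \<bar>L2_inner \<mu> (e k) (e' l)\<bar>"] rows[OF that]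
    by (simp add: m_def if_distrib[of abs] cong: if_cong)
  moreover have "(\<Sum>k\<in>A. \<bar>m k l\<bar>) \<le> \<rho>" if "l \<in> A" for l
    using off[OF that, of "\<lambda>_. 1" "\<lambda>k. \<bar>L2_inner \<mu> (e k) (e' l)\<bar>"] cols[OF that]
    by (simp add: m_def if_distrib[of abs] eq_commute[of l] L2_inner_commute[of _ "e' l"] cong: if_cong)
  ultimately show ?thesis
    using Schur_bound[OF A, of m \<rho> x y] by simp
qed

section \<open>Curves of unit speed and cells\<close>

text \<open>
  \<open>P 0\<close> is a curve on the unit sphere of \<open>L2\<close>, traversed with speed \<open>\<gamma>\<close>; \<open>P 1\<close> is its unit
  velocity and \<open>P 2\<close> the derivative of the velocity by arc length. The speed may be discontinuous,
  so it is not normalized by a change of parameter; it is kept explicit, and quotients of increments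
  are formed in which it cancels.
\<close>

locale unit_speed_curve =
  fixes \<mu> :: "real measure" and P :: "nat \<Rightarrow> real \<Rightarrow> real \<Rightarrow> real"
    and \<gamma> :: "real \<Rightarrow> real" and a b G B :: real
  assumes P_L2 [simp]: "i \<le> 2 \<Longrightarrow> P i t \<in> L2 \<mu>"
    and P_deriv: "i < 2 \<Longrightarrow> w \<in> L2 \<mu> \<Longrightarrow>
      ((\<lambda>t. L2_inner \<mu> w (P i t)) has_real_derivative \<gamma> t * L2_inner \<mu> w (P (Suc i) t)) (at t)"
    and speed_pos: "0 < \<gamma> t"
    and speed_le: "t \<in> {a..b} \<Longrightarrow> \<gamma> t \<le> G"
    and P0_unit [simp]: "L2_norm \<mu> (P 0 t) = 1"
    and P1_unit [simp]: "L2_norm \<mu> (P (Suc 0) t) = 1"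
    and P2_norm: "t \<in> {a..b} \<Longrightarrow> L2_norm \<mu> (P 2 t) \<le> B"
    and B_nonneg: "0 \<le> B"
begin

abbreviation ip (infix "\<bullet>\<^sub>\<mu>" 70) where "f \<bullet>\<^sub>\<mu> g \<equiv> L2_inner \<mu> f g"

lemma P0_self [simp]: "P 0 t \<bullet>\<^sub>\<mu> P 0 t = 1" and P1_self [simp]: "P (Suc 0) t \<bullet>\<^sub>\<mu> P (Suc 0) t = 1"
  using L2_norm_square[of \<mu> "P 0 t"] L2_norm_square[of \<mu> "P (Suc 0) t"] by simp_all

text \<open>A curve on the unit sphere is orthogonal to its velocity: \<open>P 0 u\<close> has its largest component
  along \<open>P 0 t\<close> at \<open>u = t\<close>.\<close>

lemma P_orthogonal [simp]: "P 0 t \<bullet>\<^sub>\<mu> P (Suc 0) t = 0"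
proof -
  have "\<gamma> t * L2_inner \<mu> (P 0 t) (P (Suc 0) t) = 0"
  proof (rule DERIV_local_max)
    show "((\<lambda>u. P 0 t \<bullet>\<^sub>\<mu> P 0 u) has_real_derivative \<gamma> t * L2_inner \<mu> (P 0 t) (P (Suc 0) t)) (at t)"
      by (intro P_deriv P_L2) auto
    show "\<forall>u. \<bar>t - u\<bar> < 1 \<longrightarrow> P 0 t \<bullet>\<^sub>\<mu> P 0 u \<le> P 0 t \<bullet>\<^sub>\<mu> P 0 t"
      using L2_Cauchy_Schwarz[of "P 0 t" \<mu> "P 0 u" for u] by (simp add: abs_le_iff)
  qed simp
  then show ?thesis using speed_pos[of t] by simp
qed

lemma P_increment:
  assumes i: "i < 2" and w: "w \<in> L2 \<mu>" and x: "x \<in> {c..d}" and y: "y \<in> {c..d}"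
    and sub: "{c..d} \<subseteq> {a..b}"
  obtains z where "z \<in> {c..d}"
    "\<bar>w \<bullet>\<^sub>\<mu> P i x - w \<bullet>\<^sub>\<mu> P i y\<bar> \<le> G * (d - c) * \<bar>w \<bullet>\<^sub>\<mu> P (Suc i) z\<bar>"
proof -
  have *: "\<exists>z\<in>{c..d}. \<bar>w \<bullet>\<^sub>\<mu> P i x - w \<bullet>\<^sub>\<mu> P i y\<bar> \<le> G * (d - c) * \<bar>w \<bullet>\<^sub>\<mu> P (Suc i) z\<bar>"
    if xy: "x < y" "x \<in> {c..d}" "y \<in> {c..d}" for x y
  proof -
    obtain z where z: "x < z" "z < y"
      and eq: "w \<bullet>\<^sub>\<mu> P i y - w \<bullet>\<^sub>\<mu> P i x = (y - x) * (\<gamma> z * (w \<bullet>\<^sub>\<mu> P (Suc i) z))"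
      using MVT2[OF xy(1), of "\<lambda>t. w \<bullet>\<^sub>\<mu> P i t" "\<lambda>t. \<gamma> t * (w \<bullet>\<^sub>\<mu> P (Suc i) t)"] P_deriv[OF i w]
      by blast
    have z': "z \<in> {a..b}" "z \<in> {c..d}" using z xy sub by auto
    have "(y - x) * \<gamma> z \<le> (d - c) * G"
      using speed_pos[of z] speed_le[OF z'(1)] xy by (intro mult_mono) auto
    then have "(y - x) * \<gamma> z * \<bar>w \<bullet>\<^sub>\<mu> P (Suc i) z\<bar> \<le> (d - c) * G * \<bar>w \<bullet>\<^sub>\<mu> P (Suc i) z\<bar>"
      by (rule mult_right_mono) simp
    moreover have "\<bar>w \<bullet>\<^sub>\<mu> P i y - w \<bullet>\<^sub>\<mu> P i x\<bar> = (y - x) * \<gamma> z * \<bar>w \<bullet>\<^sub>\<mu> P (Suc i) z\<bar>"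
      unfolding eq using speed_pos[of z] xy(1) by (simp add: abs_mult)
    ultimately show ?thesis using z'(2) by (auto simp: abs_minus_commute mult.commute[of G])
  qed
  have "x = y \<or> x < y \<or> y < x" by auto
  then show ?thesis
  proof (elim disjE)
    assume "x = y"
    have "a \<le> x" "x \<le> b" "c \<le> d" using x sub by auto
    then have "0 \<le> G * (d - c)" using speed_pos[of x] speed_le[of x] by simp
    then show ?thesis using that[OF x] \<open>x = y\<close> by simp
  next
    assume "x < y" then show ?thesis using *[OF _ x y] that by blast
  next
    assume "y < x" then show ?thesis using *[OF _ y x] that by (auto simp: abs_minus_commute)
  qed
qed

end

text \<open>
  The cells \<open>{c k..d k}\<close> are short for the curve: its length inside a cell is at most \<open>\<eta>\<close>. They
  are far apart: however points are chosen in the cells, the inner products of one of them with all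
  the others have small absolute sums. The condition \<open>i + j \<le> 3\<close> reflects that the separation of
  the parameters controls three derivatives of the kernel.
\<close>

locale short_cells = unit_speed_curve +
  fixes s :: nat and c d :: "nat \<Rightarrow> real" and \<eta> :: real
  assumes cell_nonempty: "k < s \<Longrightarrow> c k \<le> d k"
    and cell_subset: "k < s \<Longrightarrow> {c k..d k} \<subseteq> {a..b}"
    and cell_short: "k < s \<Longrightarrow> G * (d k - c k) \<le> \<eta>"
    and \<eta>_nonneg: "0 \<le> \<eta>"
    and \<eta>_small: "2000 * (\<eta> * (1 + B)\<^sup>2) \<le> 1"
    and cell_rows: "k < s \<Longrightarrow> x \<in> {c k..d k} \<Longrightarrow> (\<And>l. l < s \<Longrightarrow> y l \<in> {c l..d l}) \<Longrightarrow>
      i \<le> 2 \<Longrightarrow> j \<le> 2 \<Longrightarrow> i + j \<le> 3 \<Longrightarrow>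
      (\<Sum>l\<in>{..<s} - {k}. \<bar>L2_inner \<mu> (P i x) (P j (y l))\<bar>) \<le> 1 / 6"
begin

text \<open>For the purpose of inner products, \<open>e\<close> is no larger than \<open>C\<close> times \<open>P i y\<close> at some order in \<open>I\<close>
  and some point of the cell. Order and point may depend on the test vector \<open>w\<close>, as they do when
  they come from a mean value theorem.\<close>

definition controlled :: "nat \<Rightarrow> nat set \<Rightarrow> real \<Rightarrow> (real \<Rightarrow> real) \<Rightarrow> bool" where
  "controlled k I C e \<longleftrightarrow> e \<in> L2 \<mu> \<and> 0 \<le> C \<and>
     (\<forall>w\<in>L2 \<mu>. \<exists>i\<in>I. \<exists>y\<in>{c k..d k}. \<bar>w \<bullet>\<^sub>\<mu> e\<bar> \<le> C * \<bar>w \<bullet>\<^sub>\<mu> P i y\<bar>)"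

text \<open>The row bound passes from the curve to controlled vectors. The point of cell \<open>k\<close> would depend on
  \<open>l\<close> if the inner products were estimated one by one. Testing \<open>e\<close> against the single vector
  \<open>w\<close>, the sum of the \<open>e' l\<close> with the signs of their inner products with \<open>e\<close>, gives a point that
  serves all \<open>l\<close>; only then is a point chosen in each of the other cells.\<close>

lemma controlled_rows:
  assumes k: "k < s" and e: "controlled k I C e"
    and e': "\<And>l. l < s \<Longrightarrow> controlled l {j} C' (e' l)"
    and I: "I \<subseteq> {..2}" "\<And>i. i \<in> I \<Longrightarrow> i + j \<le> 3" and j: "j \<le> 2" and C': "0 \<le> C'"
  shows "(\<Sum>l\<in>{..<s} - {k}. \<bar>e \<bullet>\<^sub>\<mu> e' l\<bar>) \<le> C * C' / 6"
proof -
  let ?A = "{..<s} - {k}"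
  define w where "w = (\<lambda>t. \<Sum>l\<in>?A. sgn (e \<bullet>\<^sub>\<mu> e' l) * e' l t)"
  have e'L2: "e' l \<in> L2 \<mu>" if "l \<in> ?A" for l using e'[of l] that by (simp add: controlled_def)
  have wL2: "w \<in> L2 \<mu>" unfolding w_def using e'L2 by (rule L2_sum_scale)
  have eL2: "e \<in> L2 \<mu>" and C: "0 \<le> C" using e by (auto simp: controlled_def)
  obtain i x where i: "i \<in> I" and x: "x \<in> {c k..d k}"
    and le: "\<bar>w \<bullet>\<^sub>\<mu> e\<bar> \<le> C * \<bar>w \<bullet>\<^sub>\<mu> P i x\<bar>"
    using e wL2 by (auto simp: controlled_def)
  have i2: "i \<le> 2" and ij: "i + j \<le> 3" using I i by auto
  have "\<exists>y\<in>{c l..d l}. \<bar>P i x \<bullet>\<^sub>\<mu> e' l\<bar> \<le> C' * \<bar>P i x \<bullet>\<^sub>\<mu> P j y\<bar>" if "l < s" for l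
    using e'[OF that] i2 by (auto simp: controlled_def)
  then obtain y where y: "\<And>l. l < s \<Longrightarrow> y l \<in> {c l..d l}"
    and yle: "\<And>l. l < s \<Longrightarrow> \<bar>P i x \<bullet>\<^sub>\<mu> e' l\<bar> \<le> C' * \<bar>P i x \<bullet>\<^sub>\<mu> P j (y l)\<bar>"
    by metis
  have "w \<bullet>\<^sub>\<mu> e = (\<Sum>l\<in>?A. sgn (e \<bullet>\<^sub>\<mu> e' l) * (e' l \<bullet>\<^sub>\<mu> e))"
    unfolding w_def using eL2 e'L2 by (intro L2_inner_sum_left) auto
  then have "(\<Sum>l\<in>?A. \<bar>e \<bullet>\<^sub>\<mu> e' l\<bar>) = w \<bullet>\<^sub>\<mu> e"
    by (simp add: L2_inner_commute[of _ _ e] abs_sgn mult.commute)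
  also have "\<dots> \<le> C * \<bar>w \<bullet>\<^sub>\<mu> P i x\<bar>" using le by simp
  also have "w \<bullet>\<^sub>\<mu> P i x = (\<Sum>l\<in>?A. sgn (e \<bullet>\<^sub>\<mu> e' l) * (e' l \<bullet>\<^sub>\<mu> P i x))"
    unfolding w_def using i2 e'L2 by (intro L2_inner_sum_left) auto
  also have "\<bar>\<dots>\<bar> \<le> (\<Sum>l\<in>?A. \<bar>e' l \<bullet>\<^sub>\<mu> P i x\<bar>)"
    by (rule order_trans[OF sum_abs sum_mono]) (simp add: abs_mult abs_sgn_eq)
  also have "\<dots> \<le> (\<Sum>l\<in>?A. C' * \<bar>P i x \<bullet>\<^sub>\<mu> P j (y l)\<bar>)"
    using yle by (intro sum_mono) (auto simp: L2_inner_commute[of _ "P i x"] intro: order_trans)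
  also have "\<dots> \<le> C' * (1 / 6)"
    unfolding sum_distrib_left[symmetric]
    by (intro mult_left_mono[OF cell_rows C'] k x y i2 j ij)
  finally show ?thesis using C by (simp add: mult_left_mono)
qed

lemma \<eta>_consequences: "\<eta> \<le> 1 / 2000" "\<eta> * B \<le> 1 / 2000" "\<eta> * (1 + B) \<le> 1 / 2000"
proof -
  have "1 * 1 \<le> (1 + B) * (1 + B)" "B * 1 \<le> (1 + B) * (1 + B)" "(1 + B) * 1 \<le> (1 + B) * (1 + B)"
    using mult_nonneg_nonneg[OF B_nonneg B_nonneg] B_nonneg by (simp_all add: algebra_simps)
  from this[THEN mult_left_mono[OF _ \<eta>_nonneg]]
  show "\<eta> \<le> 1 / 2000" "\<eta> * B \<le> 1 / 2000" "\<eta> * (1 + B) \<le> 1 / 2000"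
    using \<eta>_small by (auto simp: power2_eq_square)
qed

lemma increment_in_cell:
  assumes k: "k < s" and i: "i < 2" and w: "w \<in> L2 \<mu>"
    and x: "x \<in> {c k..d k}" and y: "y \<in> {c k..d k}"
  obtains z where "z \<in> {c k..d k}"
    "\<bar>w \<bullet>\<^sub>\<mu> P i x - w \<bullet>\<^sub>\<mu> P i y\<bar> \<le> \<eta> * \<bar>w \<bullet>\<^sub>\<mu> P (Suc i) z\<bar>"
proof -
  obtain z where z: "z \<in> {c k..d k}"
    "\<bar>w \<bullet>\<^sub>\<mu> P i x - w \<bullet>\<^sub>\<mu> P i y\<bar> \<le> G * (d k - c k) * \<bar>w \<bullet>\<^sub>\<mu> P (Suc i) z\<bar>"
    using P_increment[OF i w x y cell_subset[OF k]] by blast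
  have "G * (d k - c k) * \<bar>w \<bullet>\<^sub>\<mu> P (Suc i) z\<bar> \<le> \<eta> * \<bar>w \<bullet>\<^sub>\<mu> P (Suc i) z\<bar>"
    using cell_short[OF k] by (intro mult_right_mono) auto
  then show ?thesis using z by (intro that[of z]) auto
qed

lemma base_in_cell [simp]: "k < s \<Longrightarrow> c k \<in> {c k..d k}"
  using cell_nonempty[of k] by auto

lemma P2_in_cell: "k < s \<Longrightarrow> z \<in> {c k..d k} \<Longrightarrow> L2_norm \<mu> (P 2 z) \<le> B"
  using cell_subset[of k] P2_norm[of z] by auto

lemma P21_in_cell:
  assumes "k < s" "z \<in> {c k..d k}"
  shows "\<bar>P (Suc 0) t \<bullet>\<^sub>\<mu> P 2 z\<bar> \<le> B"
  using L2_Cauchy_Schwarz[of "P (Suc 0) t" \<mu> "P 2 z"] P2_in_cell[OF assms] by simp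

text \<open>By the mean value theorem the velocity turns by at most \<open>\<eta> * B\<close> inside a cell.\<close>

lemma velocity_correlation:
  assumes k: "k < s" and y: "y \<in> {c k..d k}"
  shows "9 / 10 \<le> P (Suc 0) (c k) \<bullet>\<^sub>\<mu> P (Suc 0) y"
proof -
  obtain z where z: "z \<in> {c k..d k}"
    "\<bar>P (Suc 0) (c k) \<bullet>\<^sub>\<mu> P (Suc 0) y - P (Suc 0) (c k) \<bullet>\<^sub>\<mu> P (Suc 0) (c k)\<bar>
      \<le> \<eta> * \<bar>P (Suc 0) (c k) \<bullet>\<^sub>\<mu> P (Suc (Suc 0)) z\<bar>"
    using increment_in_cell[OF k, of "Suc 0" "P (Suc 0) (c k)" y "c k"] k y by auto
  have "\<eta> * \<bar>P (Suc 0) (c k) \<bullet>\<^sub>\<mu> P (Suc (Suc 0)) z\<bar> \<le> \<eta> * B"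
    using P21_in_cell[OF k z(1)] \<eta>_nonneg by (intro mult_left_mono) (auto simp: numeral_2_eq_2)
  then show ?thesis using z(2) \<eta>_consequences(2) by auto
qed

text \<open>The component along the velocity at the base point of the displacement from \<open>y\<close> to \<open>x\<close>. It
  replaces the arc length as a measure of that displacement.\<close>

definition shift :: "nat \<Rightarrow> real \<Rightarrow> real \<Rightarrow> real" where
  "shift k x y = P (Suc 0) (c k) \<bullet>\<^sub>\<mu> P 0 x - P (Suc 0) (c k) \<bullet>\<^sub>\<mu> P 0 y"

text \<open>The displacement divided by its \<open>shift\<close> is close to the velocity at the base point; \<open>chord\<close> is
  the difference. For \<open>x = y\<close> it is zero so that it remains controlled.\<close>

definition chord :: "nat \<Rightarrow> real \<Rightarrow> real \<Rightarrow> real \<Rightarrow> real" where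
  "chord k x y = (if x = y then (\<lambda>t. 0)
     else (\<lambda>t. (P 0 x t - P 0 y t) / shift k x y - P (Suc 0) (c k) t))"

lemma chord_L2 [simp]: "chord k x y \<in> L2 \<mu>"
  by (simp add: chord_def)

text \<open>Cauchy's mean value theorem for two components of the curve: the unknown speed occurs in both
  derivatives and cancels.\<close>

lemma shift_quotient:
  assumes k: "k < s" and w: "w \<in> L2 \<mu>" and x: "x \<in> {c k..d k}" and y: "y \<in> {c k..d k}" and ne: "x \<noteq> y"
  obtains z where "z \<in> {c k..d k}" "shift k x y \<noteq> 0"
    "(w \<bullet>\<^sub>\<mu> P 0 x - w \<bullet>\<^sub>\<mu> P 0 y) / shift k x y
      = (w \<bullet>\<^sub>\<mu> P (Suc 0) z) / (P (Suc 0) (c k) \<bullet>\<^sub>\<mu> P (Suc 0) z)"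
proof -
  let ?u = "P (Suc 0) (c k)"
  have *: "\<exists>z\<in>{c k..d k}. shift k x y \<noteq> 0 \<and>
      (w \<bullet>\<^sub>\<mu> P 0 x - w \<bullet>\<^sub>\<mu> P 0 y) / shift k x y = (w \<bullet>\<^sub>\<mu> P (Suc 0) z) / (?u \<bullet>\<^sub>\<mu> P (Suc 0) z)"
    if lt: "y < x" and x: "x \<in> {c k..d k}" and y: "y \<in> {c k..d k}" for x y
  proof -
    have der: "((\<lambda>t. w \<bullet>\<^sub>\<mu> P 0 t) has_real_derivative \<gamma> t * (w \<bullet>\<^sub>\<mu> P (Suc 0) t)) (at t)"
      if "w \<in> L2 \<mu>" for w t
      using P_deriv[of 0 w] that by simp
    have u: "?u \<in> L2 \<mu>" by simp
    obtain z where z: "y < z" "z < x" and eq: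
      "(w \<bullet>\<^sub>\<mu> P 0 x - w \<bullet>\<^sub>\<mu> P 0 y) * (\<gamma> z * (?u \<bullet>\<^sub>\<mu> P (Suc 0) z)) =
       (?u \<bullet>\<^sub>\<mu> P 0 x - ?u \<bullet>\<^sub>\<mu> P 0 y) * (\<gamma> z * (w \<bullet>\<^sub>\<mu> P (Suc 0) z))"
      using GMVT'[OF lt DERIV_isCont[OF der[OF w]] DERIV_isCont[OF der[OF u]] der[OF u] der[OF w]]
      by auto
    obtain z' where z': "y < z'" "z' < x" and
      eq': "shift k x y = (x - y) * (\<gamma> z' * (?u \<bullet>\<^sub>\<mu> P (Suc 0) z'))"
      unfolding shift_def using MVT2[OF lt der[OF u]] by auto
    have zc: "z \<in> {c k..d k}" "z' \<in> {c k..d k}" using z z' x y by auto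
    have nz: "shift k x y \<noteq> 0" "?u \<bullet>\<^sub>\<mu> P (Suc 0) z \<noteq> 0"
      using velocity_correlation[OF k zc(2)] velocity_correlation[OF k zc(1)] speed_pos[of z'] lt
      by (auto simp: eq')
    have "(w \<bullet>\<^sub>\<mu> P 0 x - w \<bullet>\<^sub>\<mu> P 0 y) * (?u \<bullet>\<^sub>\<mu> P (Suc 0) z) = (w \<bullet>\<^sub>\<mu> P (Suc 0) z) * shift k x y"
      using eq speed_pos[of z] by (simp add: shift_def ac_simps)
    then show ?thesis
      using zc nz by (intro bexI[of _ z] conjI) (simp_all add: frac_eq_eq)
  qed
  show ?thesis
  proof (cases "y < x")
    case True then show ?thesis using *[OF True x y] that by blast
  next
    case False
    then have "x < y" using ne by simp
    from *[OF this y x] obtain z where z: "z \<in> {c k..d k}" "shift k y x \<noteq> 0"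
      "(w \<bullet>\<^sub>\<mu> P 0 y - w \<bullet>\<^sub>\<mu> P 0 x) / shift k y x = (w \<bullet>\<^sub>\<mu> P (Suc 0) z) / (?u \<bullet>\<^sub>\<mu> P (Suc 0) z)" by blast
    have "shift k y x = - shift k x y"
      and "(w \<bullet>\<^sub>\<mu> P 0 y - w \<bullet>\<^sub>\<mu> P 0 x) / shift k y x = (w \<bullet>\<^sub>\<mu> P 0 x - w \<bullet>\<^sub>\<mu> P 0 y) / shift k x y"
      by (simp_all add: shift_def divide_simps) (simp_all add: algebra_simps)
    then show ?thesis using z that by auto
  qed
qed

lemma chord_inner:
  assumes k: "k < s" and w: "w \<in> L2 \<mu>" and x: "x \<in> {c k..d k}" and y: "y \<in> {c k..d k}" and ne: "x \<noteq> y"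
  obtains z where "z \<in> {c k..d k}"
    "w \<bullet>\<^sub>\<mu> chord k x y = (w \<bullet>\<^sub>\<mu> P (Suc 0) z) / (P (Suc 0) (c k) \<bullet>\<^sub>\<mu> P (Suc 0) z) - w \<bullet>\<^sub>\<mu> P (Suc 0) (c k)"
proof -
  have "w \<bullet>\<^sub>\<mu> chord k x y = (w \<bullet>\<^sub>\<mu> P 0 x - w \<bullet>\<^sub>\<mu> P 0 y) / shift k x y - w \<bullet>\<^sub>\<mu> P (Suc 0) (c k)"
    using w ne by (simp add: chord_def)
  moreover obtain z where "z \<in> {c k..d k}"
    "(w \<bullet>\<^sub>\<mu> P 0 x - w \<bullet>\<^sub>\<mu> P 0 y) / shift k x y
      = (w \<bullet>\<^sub>\<mu> P (Suc 0) z) / (P (Suc 0) (c k) \<bullet>\<^sub>\<mu> P (Suc 0) z)"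
    using shift_quotient[OF k w x y ne] by blast
  ultimately show ?thesis using that by simp
qed

lemma controlled_P: "k < s \<Longrightarrow> i \<le> 2 \<Longrightarrow> x \<in> {c k..d k} \<Longrightarrow> controlled k {i} 1 (P i x)"
  by (auto simp: controlled_def)

text \<open>
  The two kinds of error vectors, displacements from the base point and chords, are both controlled
  in two ways: coarsely without loss of order, and finely with a small constant at the price of one
  more order. In the Gram matrix of the errors the fine control is used for one factor and the
  coarse one for the other. This makes the entries small without exceeding order three.
\<close>

lemma controlled_displacement:
  assumes k: "k < s" and x: "x \<in> {c k..d k}"
  shows "controlled k {0} 2 (\<lambda>t. P 0 x t - P 0 (c k) t)"
    and "controlled k {Suc 0} \<eta> (\<lambda>t. P 0 x t - P 0 (c k) t)"
proof -
  have "\<exists>y\<in>{c k..d k}. \<bar>w \<bullet>\<^sub>\<mu> P 0 x - w \<bullet>\<^sub>\<mu> P 0 (c k)\<bar> \<le> 2 * \<bar>w \<bullet>\<^sub>\<mu> P 0 y\<bar>" for w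
  proof (cases "\<bar>w \<bullet>\<^sub>\<mu> P 0 x\<bar> \<le> \<bar>w \<bullet>\<^sub>\<mu> P 0 (c k)\<bar>")
    case True
    then show ?thesis using base_in_cell[OF k] by (intro bexI[of _ "c k"]) auto
  next
    case False
    then show ?thesis using x by (intro bexI[of _ x]) auto
  qed
  then show "controlled k {0} 2 (\<lambda>t. P 0 x t - P 0 (c k) t)"
    by (simp add: controlled_def)
  have "\<exists>y\<in>{c k..d k}. \<bar>w \<bullet>\<^sub>\<mu> P 0 x - w \<bullet>\<^sub>\<mu> P 0 (c k)\<bar> \<le> \<eta> * \<bar>w \<bullet>\<^sub>\<mu> P (Suc 0) y\<bar>"
    if "w \<in> L2 \<mu>" for w
    by (rule increment_in_cell[OF k _ that x base_in_cell[OF k], of 0]) auto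
  then show "controlled k {Suc 0} \<eta> (\<lambda>t. P 0 x t - P 0 (c k) t)"
    using \<eta>_nonneg by (simp add: controlled_def)
qed

lemma controlled_chord_coarse:
  assumes k: "k < s" and x: "x \<in> {c k..d k}" and y: "y \<in> {c k..d k}"
  shows "controlled k {Suc 0} 3 (chord k x y)"
proof -
  let ?u = "P (Suc 0) (c k)"
  have "\<exists>z\<in>{c k..d k}. \<bar>w \<bullet>\<^sub>\<mu> chord k x y\<bar> \<le> 3 * \<bar>w \<bullet>\<^sub>\<mu> P (Suc 0) z\<bar>" if w: "w \<in> L2 \<mu>" for w
  proof (cases "x = y")
    case True
    then show ?thesis using base_in_cell[OF k] by (auto simp: chord_def)
  next
    case False
    obtain z where z: "z \<in> {c k..d k}"
      and eq: "w \<bullet>\<^sub>\<mu> chord k x y = (w \<bullet>\<^sub>\<mu> P (Suc 0) z) / (?u \<bullet>\<^sub>\<mu> P (Suc 0) z) - w \<bullet>\<^sub>\<mu> ?u"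
      using chord_inner[OF k w x y False] by blast
    let ?v = "?u \<bullet>\<^sub>\<mu> P (Suc 0) z"
    have v: "9 / 10 \<le> ?v" by (rule velocity_correlation[OF k z])
    then have "2 * ?v \<ge> 1" by simp
    then have "\<bar>w \<bullet>\<^sub>\<mu> P (Suc 0) z\<bar> * 1 \<le> \<bar>w \<bullet>\<^sub>\<mu> P (Suc 0) z\<bar> * (2 * ?v)"
      by (intro mult_left_mono) auto
    then have "\<bar>(w \<bullet>\<^sub>\<mu> P (Suc 0) z) / ?v\<bar> \<le> 2 * \<bar>w \<bullet>\<^sub>\<mu> P (Suc 0) z\<bar>"
      using v by (simp add: abs_divide field_simps)
    then have "\<bar>w \<bullet>\<^sub>\<mu> chord k x y\<bar> \<le> 2 * \<bar>w \<bullet>\<^sub>\<mu> P (Suc 0) z\<bar> + \<bar>w \<bullet>\<^sub>\<mu> ?u\<bar>"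
      unfolding eq by linarith
    then show ?thesis
      using z base_in_cell[OF k]
      by (cases "\<bar>w \<bullet>\<^sub>\<mu> P (Suc 0) z\<bar> \<le> \<bar>w \<bullet>\<^sub>\<mu> ?u\<bar>") (auto intro: bexI[of _ "c k"] bexI[of _ z])
  qed
  then show ?thesis by (simp add: controlled_def)
qed

lemma controlled_chord_fine:
  assumes k: "k < s" and x: "x \<in> {c k..d k}" and y: "y \<in> {c k..d k}"
  shows "controlled k {1, 2} (2 * \<eta> * (1 + B)) (chord k x y)"
proof -
  let ?u = "P (Suc 0) (c k)"
  have "\<exists>i\<in>{1, 2}. \<exists>z\<in>{c k..d k}. \<bar>w \<bullet>\<^sub>\<mu> chord k x y\<bar> \<le> 2 * \<eta> * (1 + B) * \<bar>w \<bullet>\<^sub>\<mu> P i z\<bar>"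
    if w: "w \<in> L2 \<mu>" for w
  proof (cases "x = y")
    case True
    then show ?thesis using base_in_cell[OF k] \<eta>_nonneg B_nonneg by (auto simp: chord_def)
  next
    case False
    obtain z where z: "z \<in> {c k..d k}"
      and eq: "w \<bullet>\<^sub>\<mu> chord k x y = (w \<bullet>\<^sub>\<mu> P (Suc 0) z) / (?u \<bullet>\<^sub>\<mu> P (Suc 0) z) - w \<bullet>\<^sub>\<mu> ?u"
      using chord_inner[OF k w x y False] by blast
    let ?v = "?u \<bullet>\<^sub>\<mu> P (Suc 0) z"
    have v: "9 / 10 \<le> ?v" by (rule velocity_correlation[OF k z])
    \<comment> \<open>The component of \<open>w\<close> orthogonal to the velocity at the base point: its correlation with the
      velocity vanishes there.\<close>
    define w' where "w' = (\<lambda>t. w t - (w \<bullet>\<^sub>\<mu> ?u) * ?u t)"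
    have w': "w' \<in> L2 \<mu>" unfolding w'_def using w by simp
    have ip_w': "w' \<bullet>\<^sub>\<mu> f = w \<bullet>\<^sub>\<mu> f - (w \<bullet>\<^sub>\<mu> ?u) * (?u \<bullet>\<^sub>\<mu> f)" if "f \<in> L2 \<mu>" for f
      unfolding w'_def using w that by simp
    obtain z' where z': "z' \<in> {c k..d k}"
      and inc: "\<bar>w' \<bullet>\<^sub>\<mu> P (Suc 0) z - w' \<bullet>\<^sub>\<mu> ?u\<bar> \<le> \<eta> * \<bar>w' \<bullet>\<^sub>\<mu> P (Suc (Suc 0)) z'\<bar>"
      using increment_in_cell[OF k, of "Suc 0" w' z "c k"] z w' base_in_cell[OF k] by auto
    have "\<bar>w' \<bullet>\<^sub>\<mu> P 2 z'\<bar> \<le> \<bar>w \<bullet>\<^sub>\<mu> P 2 z'\<bar> + \<bar>w \<bullet>\<^sub>\<mu> ?u\<bar> * \<bar>?u \<bullet>\<^sub>\<mu> P 2 z'\<bar>"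
      by (simp add: ip_w' abs_mult[symmetric])
    also have "\<dots> \<le> \<bar>w \<bullet>\<^sub>\<mu> P 2 z'\<bar> + \<bar>w \<bullet>\<^sub>\<mu> ?u\<bar> * B"
      using P21_in_cell[OF k z'] by (intro add_left_mono mult_left_mono) auto
    finally have w'2: "\<bar>w' \<bullet>\<^sub>\<mu> P 2 z'\<bar> \<le> \<bar>w \<bullet>\<^sub>\<mu> P 2 z'\<bar> + \<bar>w \<bullet>\<^sub>\<mu> ?u\<bar> * B" .
    have "w \<bullet>\<^sub>\<mu> chord k x y = (w' \<bullet>\<^sub>\<mu> P (Suc 0) z - w' \<bullet>\<^sub>\<mu> ?u) / ?v"
      unfolding eq using v by (simp add: ip_w' field_simps)
    then have "\<bar>w \<bullet>\<^sub>\<mu> chord k x y\<bar> = \<bar>w' \<bullet>\<^sub>\<mu> P (Suc 0) z - w' \<bullet>\<^sub>\<mu> ?u\<bar> / ?v"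
      using v by simp
    also have "\<dots> \<le> \<bar>w' \<bullet>\<^sub>\<mu> P (Suc 0) z - w' \<bullet>\<^sub>\<mu> ?u\<bar> / (1 / 2)"
      using v by (intro divide_left_mono) auto
    also have "\<dots> \<le> 2 * (\<eta> * (\<bar>w \<bullet>\<^sub>\<mu> P 2 z'\<bar> + \<bar>w \<bullet>\<^sub>\<mu> ?u\<bar> * B))"
      using inc mult_left_mono[OF w'2 \<eta>_nonneg] by (simp add: numeral_2_eq_2)
    finally have le: "\<bar>w \<bullet>\<^sub>\<mu> chord k x y\<bar> \<le> 2 * (\<eta> * (\<bar>w \<bullet>\<^sub>\<mu> P 2 z'\<bar> + \<bar>w \<bullet>\<^sub>\<mu> ?u\<bar> * B))" .
    have comb: "2 * (\<eta> * (m + m' * B)) \<le> 2 * \<eta> * (1 + B) * M" if "m \<le> M" "m' \<le> M" for m m' M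
    proof -
      have "m + m' * B \<le> M + M * B" using that B_nonneg by (intro add_mono mult_right_mono)
      then have "\<eta> * (m + m' * B) \<le> \<eta> * (M + M * B)" using \<eta>_nonneg by (rule mult_left_mono)
      then show ?thesis by (simp add: algebra_simps)
    qed
    show ?thesis
    proof (cases "\<bar>w \<bullet>\<^sub>\<mu> P 2 z'\<bar> \<le> \<bar>w \<bullet>\<^sub>\<mu> ?u\<bar>")
      case True
      then have "\<bar>w \<bullet>\<^sub>\<mu> chord k x y\<bar> \<le> 2 * \<eta> * (1 + B) * \<bar>w \<bullet>\<^sub>\<mu> P 1 (c k)\<bar>"
        using order_trans[OF le comb] by simp
      then show ?thesis using base_in_cell[OF k] by blast
    next
      case False
      then have "\<bar>w \<bullet>\<^sub>\<mu> chord k x y\<bar> \<le> 2 * \<eta> * (1 + B) * \<bar>w \<bullet>\<^sub>\<mu> P 2 z'\<bar>"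
        using order_trans[OF le comb] by simp
      then show ?thesis using z' by blast
    qed
  qed
  then show ?thesis using \<eta>_nonneg B_nonneg by (simp add: controlled_def)
qed

lemma controlled_norm:
  assumes k: "k < s" and I: "I \<subseteq> {0, 1, 2}" and e: "controlled k I C e"
  shows "L2_norm \<mu> e \<le> C * (1 + B)"
proof -
  have eL2: "e \<in> L2 \<mu>" and C: "0 \<le> C" using e by (auto simp: controlled_def)
  obtain i z where i: "i \<in> I" and z: "z \<in> {c k..d k}" and le: "\<bar>e \<bullet>\<^sub>\<mu> e\<bar> \<le> C * \<bar>e \<bullet>\<^sub>\<mu> P i z\<bar>"
    using e eL2 by (auto simp: controlled_def)
  have i2: "i \<in> {0, 1, 2}" using i I by auto
  have P: "L2_norm \<mu> (P i z) \<le> 1 + B" "P i z \<in> L2 \<mu>"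
    using i2 P2_in_cell[OF k z] B_nonneg by auto
  have "(L2_norm \<mu> e)\<^sup>2 \<le> C * \<bar>e \<bullet>\<^sub>\<mu> P i z\<bar>" using le by (simp add: L2_norm_square)
  also have "\<dots> \<le> C * (L2_norm \<mu> e * (1 + B))"
    using L2_Cauchy_Schwarz[OF eL2 P(2)] mult_left_mono[OF P(1), of "L2_norm \<mu> e"] C
    by (intro mult_left_mono) auto
  finally have "L2_norm \<mu> e * L2_norm \<mu> e \<le> C * (1 + B) * L2_norm \<mu> e"
    by (simp add: power2_eq_square ac_simps)
  moreover have "0 \<le> C * (1 + B)" using C B_nonneg by simp
  ultimately show ?thesis
    by (cases "L2_norm \<mu> e = 0") (auto simp: mult_le_cancel_right not_less order.strict_iff_order)
qed

end

section \<open>Comparison of mixtures with the same cells\<close>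

context short_cells
begin

text \<open>
  The difference of two mixtures with the same cells is a main part \<open>M0 + M1\<close>, made of features
  and velocities at the base points, plus an error \<open>E0 + E1\<close>, made of displacements and chords with
  the same coefficients \<open>x k\<close> and \<open>y k\<close>. Let \<open>N\<close> be the Euclidean norm of the coefficients. By
  near orthonormality the main part has norm at least \<open>4/5 N\<close>, and the error has norm at most
  \<open>N / 20\<close>. So \<open>N\<close> is bounded by twice the norm of the difference, and the error contributes only a
  small multiple of the norm of \<open>g\<close>.
\<close>

lemma cell_comparison:
  fixes \<beta> \<beta>' \<theta> \<theta>' :: "nat \<Rightarrow> real"
  assumes \<theta>: "\<And>k. k < s \<Longrightarrow> \<theta> k \<in> {c k..d k}" and \<theta>': "\<And>k. k < s \<Longrightarrow> \<theta>' k \<in> {c k..d k}"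
    and g: "g \<in> L2 \<mu>"
    and g0: "\<And>k. k < s \<Longrightarrow> \<bar>g \<bullet>\<^sub>\<mu> P 0 (c k)\<bar> \<le> \<kappa>" and g1: "\<And>k. k < s \<Longrightarrow> \<bar>g \<bullet>\<^sub>\<mu> P (Suc 0) (c k)\<bar> \<le> \<kappa>"
    and \<kappa>: "0 \<le> \<kappa>"
  defines "D \<equiv> (\<lambda>t. (\<Sum>k<s. \<beta> k * P 0 (\<theta> k) t) - (\<Sum>k<s. \<beta>' k * P 0 (\<theta>' k) t))"
  shows "\<bar>g \<bullet>\<^sub>\<mu> D\<bar> \<le> (2 * \<kappa> * sqrt (2 * s) + L2_norm \<mu> g / 10) * L2_norm \<mu> D"
proof -
  \<comment> \<open>The term of the first mixture is written with the amplitude of the second plus \<open>x k\<close>; what is left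
    is the second amplitude times a displacement, a vector with velocity component \<open>y k\<close>.\<close>
  define x where "x k = \<beta> k - \<beta>' k" for k
  define y where "y k = \<beta>' k * shift k (\<theta> k) (\<theta>' k)" for k
  define \<xi> where "\<xi> k = (\<lambda>t. P 0 (\<theta> k) t - P 0 (c k) t)" for k
  define \<zeta> where "\<zeta> k = chord k (\<theta> k) (\<theta>' k)" for k
  define M0 where "M0 = (\<lambda>t. \<Sum>k<s. x k * P 0 (c k) t)"
  define M1 where "M1 = (\<lambda>t. \<Sum>k<s. y k * P (Suc 0) (c k) t)"
  define E0 where "E0 = (\<lambda>t. \<Sum>k<s. x k * \<xi> k t)"
  define E1 where "E1 = (\<lambda>t. \<Sum>k<s. y k * \<zeta> k t)"
  define X Y where "X = (\<Sum>k<s. (x k)\<^sup>2)" and "Y = (\<Sum>k<s. (y k)\<^sup>2)"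
  define N where "N = sqrt (X + Y)"
  have L2s [simp]: "\<xi> k \<in> L2 \<mu>" "\<zeta> k \<in> L2 \<mu>" "M0 \<in> L2 \<mu>" "M1 \<in> L2 \<mu>" "E0 \<in> L2 \<mu>" "E1 \<in> L2 \<mu>" for k
    by (simp_all add: \<xi>_def \<zeta>_def M0_def M1_def E0_def E1_def)
  have XY: "0 \<le> X" "0 \<le> Y" by (auto simp: X_def Y_def sum_nonneg)
  have N2: "N\<^sup>2 = X + Y" and N: "0 \<le> N" using XY by (auto simp: N_def)

  have "\<beta> k * P 0 (\<theta> k) t - \<beta>' k * P 0 (\<theta>' k) t
      = x k * P 0 (c k) t + y k * P (Suc 0) (c k) t + (x k * \<xi> k t + y k * \<zeta> k t)" if k: "k < s" for k t
  proof (cases "\<theta> k = \<theta>' k")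
    case True
    then show ?thesis by (simp add: x_def y_def \<xi>_def \<zeta>_def shift_def chord_def algebra_simps)
  next
    case False
    have "shift k (\<theta> k) (\<theta>' k) \<noteq> 0"
      using shift_quotient[OF k L2_zero \<theta>[OF k] \<theta>'[OF k] False] by blast
    then show ?thesis using False
      by (simp add: x_def y_def \<xi>_def \<zeta>_def chord_def field_simps)
  qed
  then have D: "D = (\<lambda>t. (M0 t + M1 t) + (E0 t + E1 t))"
    unfolding D_def M0_def M1_def E0_def E1_def
    by (simp add: fun_eq_iff sum_subtractf[symmetric] sum.distrib[symmetric])

  note ctrl\<xi> = controlled_displacement[OF _ \<theta>, folded \<xi>_def]
  note ctrl\<zeta> = controlled_chord_coarse[OF _ \<theta> \<theta>', folded \<zeta>_def]
    controlled_chord_fine[OF _ \<theta> \<theta>', folded \<zeta>_def]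
  have ctrlP: "controlled k {i} 1 (P i (c k))" if "k < s" "i \<le> 2" for k i
    using controlled_P that base_in_cell by simp

  have rowsP: "(\<Sum>l\<in>{..<s} - {k}. \<bar>P i (c k) \<bullet>\<^sub>\<mu> P j (c l)\<bar>) \<le> 1 / 6"
    if "k \<in> {..<s}" "i \<le> 1" "j \<le> 1" for k i j
    using controlled_rows[of k "{i}" 1 "P i (c k)" j 1 "\<lambda>l. P j (c l)"] that ctrlP by auto
  have MM: "\<bar>M0 \<bullet>\<^sub>\<mu> M0 - X\<bar> \<le> X / 6" "\<bar>M1 \<bullet>\<^sub>\<mu> M1 - Y\<bar> \<le> Y / 6" "\<bar>M0 \<bullet>\<^sub>\<mu> M1\<bar> \<le> (X + Y) / 12"
    using L2_inner_lincomb_off_diagonal[of "{..<s}" "\<lambda>k. P 0 (c k)" \<mu> "\<lambda>k. P 0 (c k)" "1/6" x x]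
      L2_inner_lincomb_off_diagonal[of "{..<s}" "\<lambda>k. P (Suc 0) (c k)" \<mu> "\<lambda>k. P (Suc 0) (c k)" "1/6" y y]
      L2_inner_lincomb_off_diagonal[of "{..<s}" "\<lambda>k. P 0 (c k)" \<mu> "\<lambda>k. P (Suc 0) (c k)" "1/6" x y]
      rowsP
    by (simp_all add: M0_def M1_def X_def Y_def power2_eq_square)
  have "(L2_norm \<mu> (\<lambda>t. M0 t + M1 t))\<^sup>2 = M0 \<bullet>\<^sub>\<mu> M0 + 2 * (M0 \<bullet>\<^sub>\<mu> M1) + M1 \<bullet>\<^sub>\<mu> M1"
    by (simp add: L2_norm_square L2_inner_commute[of _ M1 M0])
  also have "\<dots> \<ge> (4 / 5 * N)\<^sup>2"
    unfolding power_mult_distrib N2 using MM[unfolded abs_le_iff] XY by (simp add: power2_eq_square)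
  finally have M: "4 / 5 * N \<le> L2_norm \<mu> (\<lambda>t. M0 t + M1 t)"
    by (rule power2_le_imp_le) simp

  have "(L2_norm \<mu> E0)\<^sup>2 \<le> (1 / 40)\<^sup>2 * X"
  proof -
    have "\<bar>E0 \<bullet>\<^sub>\<mu> E0 - (\<Sum>k<s. x k * x k * (\<xi> k \<bullet>\<^sub>\<mu> \<xi> k))\<bar> \<le> \<eta> * 2 / 6 * (X + X) / 2"
      unfolding E0_def X_def
      using controlled_rows[OF _ ctrl\<xi>(2) ctrl\<xi>(1)]
      by (intro L2_inner_lincomb_off_diagonal) auto
    note abs_le_D1[OF this]
    moreover have "(\<Sum>k<s. x k * x k * (\<xi> k \<bullet>\<^sub>\<mu> \<xi> k)) \<le> (\<Sum>k<s. x k * x k * (1 / 2000)\<^sup>2)"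
    proof (intro sum_mono mult_left_mono)
      fix k assume "k \<in> {..<s}"
      then have "L2_norm \<mu> (\<xi> k) \<le> 1 / 2000"
        using controlled_norm[OF _ _ ctrl\<xi>(2)] \<eta>_consequences(3) by (force intro: order_trans)
      then show "\<xi> k \<bullet>\<^sub>\<mu> \<xi> k \<le> (1 / 2000)\<^sup>2"
        unfolding L2_norm_square[symmetric] by (intro power_mono) auto
    qed simp
    moreover have "\<dots> = X * (1 / 2000)\<^sup>2" by (simp add: X_def power2_eq_square sum_distrib_right)
    moreover have "\<eta> * X \<le> 1 / 2000 * X" using \<eta>_consequences(1) XY(1) by (rule mult_right_mono)
    ultimately show ?thesis unfolding L2_norm_square using XY by (simp add: power2_eq_square abs_le_iff mult.commute[of X \<eta>])
  qed
  moreover have "(L2_norm \<mu> E1)\<^sup>2 \<le> (1 / 40)\<^sup>2 * Y"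
  proof -
    have rows: "(\<Sum>l\<in>{..<s} - {k}. \<bar>\<zeta> k \<bullet>\<^sub>\<mu> \<zeta> l\<bar>) \<le> 2 * \<eta> * (1 + B) * 3 / 6" if "k < s" for k
      using that by (intro controlled_rows[OF _ ctrl\<zeta>(2) ctrl\<zeta>(1)]) auto
    have "\<bar>E1 \<bullet>\<^sub>\<mu> E1 - (\<Sum>k<s. y k * y k * (\<zeta> k \<bullet>\<^sub>\<mu> \<zeta> k))\<bar> \<le> 2 * \<eta> * (1 + B) * 3 / 6 * (Y + Y) / 2"
      unfolding E1_def Y_def
      using rows by (intro L2_inner_lincomb_off_diagonal) auto
    note abs_le_D1[OF this]
    moreover have "(\<Sum>k<s. y k * y k * (\<zeta> k \<bullet>\<^sub>\<mu> \<zeta> k)) \<le> (\<Sum>k<s. y k * y k * (1 / 1000)\<^sup>2)"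
    proof (intro sum_mono mult_left_mono)
      fix k assume "k \<in> {..<s}"
      then have "L2_norm \<mu> (\<zeta> k) \<le> 2 * \<eta> * (1 + B) * (1 + B)"
        using controlled_norm[OF _ _ ctrl\<zeta>(2)] by auto
      also have "\<dots> \<le> 1 / 1000" using \<eta>_small by (simp add: power2_eq_square ac_simps)
      finally show "\<zeta> k \<bullet>\<^sub>\<mu> \<zeta> k \<le> (1 / 1000)\<^sup>2"
        unfolding L2_norm_square[symmetric] by (intro power_mono) auto
    qed simp
    moreover have "\<dots> = Y * (1 / 1000)\<^sup>2" by (simp add: Y_def power2_eq_square sum_distrib_right)
    moreover have "\<eta> * (1 + B) * Y \<le> 1 / 2000 * Y" using \<eta>_consequences(3) XY(2) by (rule mult_right_mono)
    ultimately show ?thesis unfolding L2_norm_square using XY by (simp add: power2_eq_square abs_le_iff)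
  qed
  moreover have "(1 / 40)\<^sup>2 * X \<le> (N / 40)\<^sup>2" "(1 / 40)\<^sup>2 * Y \<le> (N / 40)\<^sup>2"
    using XY by (auto simp: power_divide N2)
  ultimately have "L2_norm \<mu> E0 \<le> N / 40" "L2_norm \<mu> E1 \<le> N / 40"
    using N by (meson power2_le_imp_le order_trans divide_nonneg_pos zero_less_numeral)+
  then have E: "L2_norm \<mu> (\<lambda>t. E0 t + E1 t) \<le> N / 20"
    using L2_norm_triangle[of E0 \<mu> E1] by simp

  have "L2_norm \<mu> (\<lambda>t. M0 t + M1 t) \<le> L2_norm \<mu> D + L2_norm \<mu> (\<lambda>t. E0 t + E1 t)"
    using L2_norm_triangle_diff[of D \<mu> "\<lambda>t. E0 t + E1 t"] by (simp add: D)
  then have ND: "N \<le> 2 * L2_norm \<mu> D" using M E N by linarith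

  have sums: "(\<Sum>k<s. \<bar>x k\<bar>) + (\<Sum>k<s. \<bar>y k\<bar>) \<le> sqrt (2 * s) * N"
  proof (rule power2_le_imp_le)
    have "((\<Sum>k<s. \<bar>x k\<bar>) + (\<Sum>k<s. \<bar>y k\<bar>))\<^sup>2 \<le> 2 * ((\<Sum>k<s. \<bar>x k\<bar>)\<^sup>2 + (\<Sum>k<s. \<bar>y k\<bar>)\<^sup>2)"
      using sum_squares_bound[of "\<Sum>k<s. \<bar>x k\<bar>" "\<Sum>k<s. \<bar>y k\<bar>"] by (simp add: power2_sum)
    also have "\<dots> \<le> 2 * (X * s + Y * s)"
      using sum_squared_le_sum_of_squares[of "\<lambda>k. \<bar>x k\<bar>" "{..<s}"] sum_squared_le_sum_of_squares[of "\<lambda>k. \<bar>y k\<bar>" "{..<s}"]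
      by (simp add: X_def Y_def)
    finally show "((\<Sum>k<s. \<bar>x k\<bar>) + (\<Sum>k<s. \<bar>y k\<bar>))\<^sup>2 \<le> (sqrt (2 * s) * N)\<^sup>2"
      by (simp add: power_mult_distrib N2 algebra_simps)
  qed (simp add: N)

  have lin: "\<bar>\<Sum>k<s. u k * v k\<bar> \<le> (\<Sum>k<s. \<bar>u k\<bar>) * \<kappa>" if "\<And>k. k < s \<Longrightarrow> \<bar>v k\<bar> \<le> \<kappa>" for u v :: "nat \<Rightarrow> real"
    unfolding sum_distrib_right
    by (rule order_trans[OF sum_abs sum_mono]) (auto simp: abs_mult intro!: mult_left_mono that)
  have "g \<bullet>\<^sub>\<mu> D = (\<Sum>k<s. x k * (g \<bullet>\<^sub>\<mu> P 0 (c k))) + (\<Sum>k<s. y k * (g \<bullet>\<^sub>\<mu> P (Suc 0) (c k)))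
      + g \<bullet>\<^sub>\<mu> (\<lambda>t. E0 t + E1 t)"
    unfolding D using g by (simp add: M0_def M1_def L2_inner_sum_right)
  then have "\<bar>g \<bullet>\<^sub>\<mu> D\<bar> \<le> (\<Sum>k<s. \<bar>x k\<bar>) * \<kappa> + (\<Sum>k<s. \<bar>y k\<bar>) * \<kappa> + \<bar>g \<bullet>\<^sub>\<mu> (\<lambda>t. E0 t + E1 t)\<bar>"
    using lin[where u = x and v = "\<lambda>k. g \<bullet>\<^sub>\<mu> P 0 (c k)", OF g0]
      lin[where u = y and v = "\<lambda>k. g \<bullet>\<^sub>\<mu> P (Suc 0) (c k)", OF g1] by linarith
  also have "\<dots> \<le> sqrt (2 * s) * N * \<kappa> + L2_norm \<mu> g * (N / 20)"
    using mult_right_mono[OF sums \<kappa>] L2_Cauchy_Schwarz[OF g, of "\<lambda>t. E0 t + E1 t"]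
      mult_left_mono[OF E, of "L2_norm \<mu> g"]
    by (simp add: distrib_right)
  also have "\<dots> = (\<kappa> * sqrt (2 * s) + L2_norm \<mu> g / 20) * N" by (simp add: algebra_simps)
  also have "\<dots> \<le> (\<kappa> * sqrt (2 * s) + L2_norm \<mu> g / 20) * (2 * L2_norm \<mu> D)"
    using ND \<kappa> by (intro mult_left_mono) auto
  finally show ?thesis by (simp add: algebra_simps)
qed

end

text \<open>Expand the square of \<open>\<parallel>g\<parallel>\<close> along \<open>g = (f - f\<^sub>A) + (f\<^sub>A - f\<^sub>0)\<close>. Since the reference is no
  more than twice as far from \<open>f\<^sub>0\<close> as \<open>f\<close> is, the summands have norms at most \<open>3 \<parallel>g\<parallel>\<close> and
  \<open>2 \<parallel>g\<parallel>\<close>, and the quadratic term of the hypothesis on \<open>f - f\<^sub>A\<close> can be absorbed on the left.\<close>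

lemma L2_norm_le_from_reference:
  assumes L2: "f \<in> L2 \<mu>" "f\<^sub>0 \<in> L2 \<mu>" "f\<^sub>A \<in> L2 \<mu>"
  defines "g \<equiv> (\<lambda>x. f x - f\<^sub>0 x)"
  assumes near: "L2_norm \<mu> (\<lambda>x. f\<^sub>A x - f\<^sub>0 x) \<le> 2 * L2_norm \<mu> g"
    and A: "\<bar>L2_inner \<mu> g (\<lambda>x. f\<^sub>A x - f\<^sub>0 x)\<bar> \<le> Y * L2_norm \<mu> (\<lambda>x. f\<^sub>A x - f\<^sub>0 x)"
    and cmp: "\<bar>L2_inner \<mu> g (\<lambda>x. f x - f\<^sub>A x)\<bar> \<le> (X + L2_norm \<mu> g / 10) * L2_norm \<mu> (\<lambda>x. f x - f\<^sub>A x)"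
    and nonneg: "0 \<le> X" "0 \<le> Y"
  shows "L2_norm \<mu> g \<le> 5 * X + 3 * Y"
proof -
  let ?n = "L2_norm \<mu> g"
  have gL2: "g \<in> L2 \<mu>" using L2 by (simp add: g_def)
  have split: "f x - f\<^sub>A x = g x - (f\<^sub>A x - f\<^sub>0 x)" for x by (simp add: g_def)
  have "L2_norm \<mu> (\<lambda>x. f x - f\<^sub>A x) \<le> ?n + L2_norm \<mu> (\<lambda>x. f\<^sub>A x - f\<^sub>0 x)"
    unfolding split using L2 gL2 by (intro L2_norm_triangle_diff) auto
  then have dist: "L2_norm \<mu> (\<lambda>x. f x - f\<^sub>A x) \<le> 3 * ?n" using near by simp
  have "L2_inner \<mu> g g = L2_inner \<mu> g (\<lambda>x. f x - f\<^sub>A x) + L2_inner \<mu> g (\<lambda>x. f\<^sub>A x - f\<^sub>0 x)"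
    unfolding split using L2 gL2 by simp
  then have "?n\<^sup>2 \<le> (X + ?n / 10) * (3 * ?n) + Y * (2 * ?n)"
    unfolding L2_norm_square
    using cmp A mult_left_mono[OF dist, of "X + ?n / 10"] mult_left_mono[OF near nonneg(2)] nonneg
    by (simp add: L2_norm_nonneg)
  then have "?n * ((7 / 10) * ?n) \<le> ?n * (3 * X + 2 * Y)"
    by (simp add: power2_eq_square algebra_simps)
  then have "?n = 0 \<or> (7 / 10) * ?n \<le> 3 * X + 2 * Y"
    using mult_left_le_imp_le[of ?n "(7 / 10) * ?n" "3 * X + 2 * Y"] L2_norm_nonneg[of \<mu> g]
    by linarith
  then show ?thesis using nonneg by auto
qed

section \<open>Tails of the noise\<close>

text \<open>Where \<open>\<bar>x\<bar>\<close> exceeds \<open>t\<close>, the centred density is at most the tail factor times the density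
  centred at \<open>t\<close> or \<open>- t\<close>, whichever has the sign of \<open>x\<close>, because
  \<open>t\<^sup>2 + (\<bar>x\<bar> - t)\<^sup>2 \<le> x\<^sup>2\<close>.\<close>

lemma gaussian_tail:
  assumes v: "0 \<le> v" "v \<le> V" and V: "0 < V" and t: "0 \<le> t"
  shows "emeasure (gaussian 0 v) {x. t < \<bar>x\<bar>} \<le> ennreal (2 * exp (- t\<^sup>2 / (2 * V)))"
proof (cases "v = 0")
  case True
  then show ?thesis using t by (simp add: gaussian_def)
next
  case False
  then have "0 < v" using v by simp
  let ?n = "\<lambda>m. normal_density m (sqrt v)"
  have dens: "?n 0 x \<le> exp (- t\<^sup>2 / (2 * V)) * (?n t x + ?n (- t) x)" if x: "t < \<bar>x\<bar>" for x
  proof -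
    define m where "m = (if 0 \<le> x then t else - t)"
    have sq: "t\<^sup>2 + (x - m)\<^sup>2 \<le> x\<^sup>2"
      using x t mult_left_mono[of t "\<bar>x\<bar>" t] by (auto simp: m_def power2_eq_square algebra_simps)
    have "t\<^sup>2 / (2 * V) \<le> t\<^sup>2 / (2 * v)" using v \<open>0 < v\<close> by (intro divide_left_mono) auto
    moreover have "(t\<^sup>2 + (x - m)\<^sup>2) / (2 * v) \<le> x\<^sup>2 / (2 * v)"
      using sq \<open>0 < v\<close> by (intro divide_right_mono) auto
    ultimately have "- x\<^sup>2 / (2 * v) \<le> - t\<^sup>2 / (2 * V) + - (x - m)\<^sup>2 / (2 * v)"
      by (simp add: add_divide_distrib)
    then have "exp (- x\<^sup>2 / (2 * v)) \<le> exp (- t\<^sup>2 / (2 * V)) * exp (- (x - m)\<^sup>2 / (2 * v))"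
      by (simp add: exp_add[symmetric])
    then have "1 / sqrt (2 * pi * v) * exp (- x\<^sup>2 / (2 * v)) \<le>
        1 / sqrt (2 * pi * v) * (exp (- t\<^sup>2 / (2 * V)) * exp (- (x - m)\<^sup>2 / (2 * v)))"
      using \<open>0 < v\<close> by (intro mult_left_mono) auto
    then have "?n 0 x \<le> exp (- t\<^sup>2 / (2 * V)) * ?n m x"
      using \<open>0 < v\<close> by (simp add: normal_density_def)
    also have "\<dots> \<le> exp (- t\<^sup>2 / (2 * V)) * (?n t x + ?n (- t) x)"
      by (intro mult_left_mono) (auto simp: m_def)
    finally show ?thesis .
  qed
  have one: "(\<integral>\<^sup>+x. ennreal (?n m x) \<partial>lborel) = 1" for m
    using prob_space.emeasure_space_1[OF prob_space_normal_density[of "sqrt v" m]] \<open>0 < v\<close>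
    by (simp add: emeasure_density)
  have "emeasure (gaussian 0 v) {x. t < \<bar>x\<bar>} = (\<integral>\<^sup>+x. ennreal (?n 0 x) * indicator {x. t < \<bar>x\<bar>} x \<partial>lborel)"
    using False by (simp add: gaussian_def emeasure_density)
  also have "\<dots> \<le> (\<integral>\<^sup>+x. ennreal (exp (- t\<^sup>2 / (2 * V))) * (ennreal (?n t x) + ennreal (?n (- t) x)) \<partial>lborel)"
    using dens by (intro nn_integral_mono)
      (auto simp: indicator_def ennreal_plus[symmetric] ennreal_mult'[symmetric] simp del: ennreal_plus
        intro!: ennreal_leI)
  also have "\<dots> = ennreal (exp (- t\<^sup>2 / (2 * V))) * 2"
    by (simp add: nn_integral_cmult nn_integral_add one)
  also have "\<dots> = ennreal (2 * exp (- t\<^sup>2 / (2 * V)))"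
    by (simp add: ennreal_mult mult.commute)
  finally show ?thesis .
qed

lemma noise_tail:
  assumes noise: "noise_assumption \<mu> W \<sigma> \<Delta>" and pos: "0 < \<sigma>" "0 < \<Delta>"
    and d: "d \<in> L2 \<mu>" "L2_norm \<mu> d \<le> 1" and t: "0 \<le> t"
  shows "{w \<in> space W. t < \<bar>L2_inner \<mu> w d\<bar>} \<in> sets W"
    and "emeasure W {w \<in> space W. t < \<bar>L2_inner \<mu> w d\<bar>} \<le> ennreal (2 * exp (- t\<^sup>2 / (2 * (\<sigma>\<^sup>2 * \<Delta>))))"
proof -
  have sets: "sets W = sets (L2_borel \<mu>)" using noise by (simp add: noise_assumption_def)
  have meas: "(\<lambda>w. L2_inner \<mu> w d) \<in> borel_measurable W"
    using L2_inner_measurable[OF d(1)] by (simp add: measurable_cong_sets[OF sets refl])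
  then show "{w \<in> space W. t < \<bar>L2_inner \<mu> w d\<bar>} \<in> sets W" by measurable
  obtain v where v: "0 \<le> v" "v \<le> \<sigma>\<^sup>2 * \<Delta> * (L2_norm \<mu> d)\<^sup>2"
    and distr: "distr W borel (\<lambda>w. L2_inner \<mu> d w) = gaussian 0 v"
    using noise d(1) by (auto simp: noise_assumption_def)
  have "\<sigma>\<^sup>2 * \<Delta> * (L2_norm \<mu> d)\<^sup>2 \<le> \<sigma>\<^sup>2 * \<Delta> * 1\<^sup>2"
    using d(2) pos by (intro mult_left_mono power_mono) auto
  then have "v \<le> \<sigma>\<^sup>2 * \<Delta>" using v(2) by simp
  then have "emeasure (gaussian 0 v) {x. t < \<bar>x\<bar>} \<le> ennreal (2 * exp (- t\<^sup>2 / (2 * (\<sigma>\<^sup>2 * \<Delta>))))"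
    using pos v(1) t by (intro gaussian_tail) auto
  also have "emeasure (gaussian 0 v) {x. t < \<bar>x\<bar>} = emeasure W ((\<lambda>w. L2_inner \<mu> w d) -` {x. t < \<bar>x\<bar>} \<inter> space W)"
    unfolding distr[symmetric] L2_inner_commute[of _ d] using meas
    by (intro emeasure_distr) (auto simp: L2_inner_commute[of _ d])
  also have "(\<lambda>w. L2_inner \<mu> w d) -` {x. t < \<bar>x\<bar>} \<inter> space W = {w \<in> space W. t < \<bar>L2_inner \<mu> w d\<bar>}" by auto
  finally show "emeasure W {w \<in> space W. t < \<bar>L2_inner \<mu> w d\<bar>} \<le> ennreal (2 * exp (- t\<^sup>2 / (2 * (\<sigma>\<^sup>2 * \<Delta>))))" .
qed

section \<open>Offsets\<close>

lemma offset_abs_le: "\<bar>offset D d\<bar> \<le> \<bar>d\<bar>"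
proof (cases D)
  case Torus
  define n where "n = \<lceil>d - 1 / 2\<rceil>"
  have "d - 1 / 2 \<le> of_int n" "of_int n < d + 1 / 2" unfolding n_def by linarith+
  moreover have "n = 0 \<or> (1::real) \<le> of_int n \<or> of_int n \<le> (-1::real)" by linarith
  ultimately have "\<bar>d - of_int n\<bar> \<le> \<bar>d\<bar>" by linarith
  then show ?thesis using Torus by (simp add: n_def)
qed simp

lemma offset_Torus_shift: "offset Torus (d + of_int n) = offset Torus d"
proof -
  have "\<lceil>d + of_int n - 1 / 2\<rceil> = \<lceil>d - 1 / 2\<rceil> + n"
    using ceiling_add_of_int[of "d - 1 / 2" n] by (simp add: algebra_simps)
  then show ?thesis by simp
qed

lemma offset_proj: "offset D (proj D x - proj D y) = offset D (x - y)"
proof (cases D)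
  case Torus
  have "frac x - frac y = (x - y) + of_int (\<lfloor>y\<rfloor> - \<lfloor>x\<rfloor>)" by (simp add: frac_def)
  then have "offset Torus (frac x - frac y) = offset Torus (x - y)"
    using offset_Torus_shift[of "x - y"] by metis
  then show ?thesis by (simp only: Torus proj.simps)
qed simp

lemma offset_offset_diff: "offset D (offset D x - offset D y) = offset D (x - y)"
proof (cases D)
  case Torus
  have "offset Torus x - offset Torus y = (x - y) + of_int (\<lceil>y - 1 / 2\<rceil> - \<lceil>x - 1 / 2\<rceil>)" by simp
  then show ?thesis using Torus offset_Torus_shift[of "x - y"] by metis
qed simp

text \<open>Representatives, seen from a common origin, are at least as far apart on the line as the points
  are on the torus. In this way separated points of the torus become separated points of the line.\<close>

lemma offset_diff_le: "\<bar>offset D (x - y)\<bar> \<le> \<bar>offset D x - offset D y\<bar>"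
  using offset_abs_le[of D "offset D x - offset D y"] by (simp add: offset_offset_diff)

lemma offset_zero [simp]: "offset D 0 = 0"
  using offset_abs_le[of D 0] by simp

lemma offset_abs_minus: "\<bar>offset D (- d)\<bar> = \<bar>offset D d\<bar>"
  using offset_diff_le[of D 0 d] offset_diff_le[of D 0 "- d"] by simp

text \<open>Negativity excludes the representative $1/2$, which is its own opposite on the torus.\<close>

lemma offset_minus_neg:
  assumes "offset D d < 0"
  shows "offset D (- d) = - offset D d"
proof (cases D)
  case Torus
  have "\<lceil>- d - 1 / 2\<rceil> = - \<lceil>d - 1 / 2\<rceil>"
    using assms Torus by (intro ceiling_unique) (simp_all, linarith+)
  then show ?thesis using Torus by simp
qed simp

lemma offset_triangle: "\<bar>offset D (x - z)\<bar> \<le> \<bar>offset D (x - y)\<bar> + \<bar>offset D (y - z)\<bar>"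
proof -
  have "\<bar>offset D ((x - y) - (z - y))\<bar> \<le> \<bar>offset D (x - y) - offset D (z - y)\<bar>" by (rule offset_diff_le)
  moreover have "\<bar>offset D (z - y)\<bar> = \<bar>offset D (y - z)\<bar>" using offset_abs_minus[of D "y - z"] by simp
  ultimately show ?thesis by simp
qed

section \<open>The limiting kernel\<close>

lemma nderiv_cong_open:
  assumes S: "open S" "S \<subseteq> A" "S \<subseteq> B" and eq: "\<And>x. x \<in> S \<Longrightarrow> f x = g x" and x: "x \<in> S"
  shows "nderiv A n f x = nderiv B n g x"
  using x
proof (induction n arbitrary: x)
  case 0
  then show ?case using eq by simp
next
  case (Suc n)
  have at: "at x within A = at x within S" "at x within B = at x within S"
    using S Suc.prems at_within_open_subset[of x S A] at_within_open_subset[of x S B] at_within_open[of x S]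
    by auto
  have "(nderiv A n f has_vector_derivative d) (at x within S) \<longleftrightarrow>
      (nderiv B n g has_vector_derivative d) (at x within S)" for d
    using Suc.IH Suc.prems has_vector_derivative_transform[of x S "nderiv A n f" "nderiv B n g" d]
      has_vector_derivative_transform[of x S "nderiv B n g" "nderiv A n f" d] by auto
  then show ?case by (simp add: vector_derivative_def at)
qed

lemma Fd_even_pos: "0 < x \<Longrightarrow> Fd_even F n x = Fd F n x"
  unfolding Fd_even_def Fd_def by (rule nderiv_cong_open[of "{0<..}"]) auto

lemma F_near_zero:
  assumes "F_properties F"
  obtains x\<^sub>0 where "0 < x\<^sub>0" "\<And>x. 0 \<le> x \<Longrightarrow> x \<le> x\<^sub>0 \<Longrightarrow> 1 / 6 < \<bar>F x\<bar>"
proof -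
  have "Ck_on 6 F {0..}" and F0: "F 0 = 1" using assms by (auto simp: F_properties_def)
  then have "nderiv {0..} 0 F differentiable (at 0 within {0..})" unfolding Ck_on_def by fastforce
  then have "continuous (at 0 within {0..}) F" by (simp add: differentiable_imp_continuous_within)
  then have "(F \<longlongrightarrow> 1) (at 0 within {0..})" using F0 by (simp add: continuous_within)
  then have "\<forall>\<^sub>F x in at 0 within {0..}. 1 / 6 < F x" by (rule order_tendstoD) simp
  then obtain e where e: "0 < e" "\<And>x. 0 \<le> x \<Longrightarrow> x \<noteq> 0 \<Longrightarrow> dist x 0 < e \<Longrightarrow> 1 / 6 < F x"
    unfolding eventually_at by auto
  show thesis
  proof (rule that[of "e / 2"])
    fix x assume x: "0 \<le> x" "x \<le> e / 2"
    then show "1 / 6 < \<bar>F x\<bar>" using e(2)[of x] e(1) F0 by (cases "x = 0") (auto simp: dist_real_def)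
  qed (use e in simp)
qed

text \<open>A separation that makes the sums of \<open>\<bar>F\<bar>\<close> at most $1/6$ exceeds the scale on which \<open>F\<close> stays
  close to \<open>F 0 = 1\<close>.\<close>

lemma delta_lower_bound:
  assumes x\<^sub>0: "\<And>x. 0 \<le> x \<Longrightarrow> x \<le> x\<^sub>0 \<Longrightarrow> 1 / 6 < \<bar>F x\<bar>" and u: "u \<le> 1 / 6" and s: "2 \<le> s"
    and g: "0 < ginf F"
  shows "ereal x\<^sub>0 \<le> delta F u s"
  unfolding delta_def
proof (rule INF_greatest, safe)
  fix d :: real assume d: "0 < d"
    and sums: "\<forall>i\<le>3. \<forall>xs\<in>sep_vecs Line UNIV s d. \<forall>l<s.
        (\<Sum>k\<in>{..<s} - {l}. ginf F powr (- real i / 2) * \<bar>Fd F i \<bar>xs ! l - xs ! k\<bar>\<bar>) \<le> u"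
  show "ereal x\<^sub>0 \<le> ereal d"
  proof (rule ccontr)
    assume "\<not> ereal x\<^sub>0 \<le> ereal d"
    then have less: "d < x\<^sub>0" by simp
    \<comment> \<open>An arithmetic progression of step \<open>x\<^sub>0\<close> is separated by more than \<open>d\<close>, but \<open>\<bar>F\<bar>\<close> is
      too large at its first step.\<close>
    define xs where "xs = map (\<lambda>k. real k * x\<^sub>0) [0..<s]"
    have "d < gap Line (xs ! k) (xs ! l)" if "k < s" "l < s" "k \<noteq> l" for k l
    proof -
      have "gap Line (xs ! k) (xs ! l) = \<bar>real k - real l\<bar> * x\<^sub>0"
        using that d less by (simp add: xs_def gap_def left_diff_distrib[symmetric] abs_mult)
      moreover have "1 * x\<^sub>0 \<le> \<bar>real k - real l\<bar> * x\<^sub>0"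
        using that d less by (intro mult_right_mono) auto
      ultimately show ?thesis using less by simp
    qed
    then have xs: "xs \<in> sep_vecs Line UNIV s d" by (simp add: sep_vecs_def xs_def)
    let ?f = "\<lambda>k. ginf F powr (- real 0 / 2) * \<bar>Fd F 0 \<bar>xs ! 0 - xs ! k\<bar>\<bar>"
    have "?f 1 \<le> (\<Sum>k\<in>{..<s} - {0}. ?f k)" using s by (intro member_le_sum) auto
    also have "\<dots> \<le> u" using sums[rule_format, of 0 xs 0] xs s by simp
    finally have "\<bar>F \<bar>xs ! 0 - xs ! 1\<bar>\<bar> \<le> u" using g by (simp add: Fd_def)
    moreover have "\<bar>xs ! 0 - xs ! 1\<bar> = x\<^sub>0" using s d less by (simp add: xs_def)
    ultimately show False using x\<^sub>0[of x\<^sub>0] d less u by simp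
  qed
qed

lemma delta_sum_le:
  assumes less: "delta F u s < ereal m" and X: "\<And>k l. k < s \<Longrightarrow> l < s \<Longrightarrow> k \<noteq> l \<Longrightarrow> m \<le> \<bar>X k - X l\<bar>"
    and l: "l < s" and i: "i \<le> 3"
  shows "(\<Sum>k\<in>{..<s} - {l}. ginf F powr (- real i / 2) * \<bar>Fd F i \<bar>X l - X k\<bar>\<bar>) \<le> u"
proof -
  obtain d where d: "d < m" and sums: "\<forall>i\<le>3. \<forall>xs\<in>sep_vecs Line UNIV s d. \<forall>l<s.
        (\<Sum>k\<in>{..<s} - {l}. ginf F powr (- real i / 2) * \<bar>Fd F i \<bar>xs ! l - xs ! k\<bar>\<bar>) \<le> u"
    using less unfolding delta_def Inf_less_iff by auto
  define xs where "xs = map X [0..<s]"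
  have nth: "k < s \<Longrightarrow> xs ! k = X k" for k by (simp add: xs_def)
  have "xs \<in> sep_vecs Line UNIV s d"
    using X d by (fastforce simp: sep_vecs_def gap_def xs_def)
  then have "(\<Sum>k\<in>{..<s} - {l}. ginf F powr (- real i / 2) * \<bar>Fd F i \<bar>xs ! l - xs ! k\<bar>\<bar>) \<le> u"
    using sums i l by blast
  then show ?thesis using l by (simp add: nth)
qed

section \<open>The curve of features\<close>

lemma L2_deriv_has_deriv: "L2_has_deriv \<mu> f d \<theta> \<Longrightarrow> L2_has_deriv \<mu> f (L2_deriv \<mu> f \<theta>) \<theta>"
  unfolding L2_deriv_def by (rule someI[of "\<lambda>d. L2_has_deriv \<mu> f d \<theta>"])

text \<open>Features on the torus are periodic functions on the line, and so are all objects derived from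
  them. An interval of the torus can therefore be replaced by an interval of reals, on which mean
  value theorems are available.\<close>

lemma L2_has_deriv_shift:
  assumes per: "\<And>t. f (t + p) = f t"
  shows "L2_has_deriv \<mu> f d (\<theta> + p) \<longleftrightarrow> L2_has_deriv \<mu> f d \<theta>"
proof -
  have nhds: "nhds (\<theta> + p) = filtermap (\<lambda>x. x + p) (nhds \<theta>)"
    using filtermap_nhds_shift[of "- p" \<theta>] by simp
  have at: "at (\<theta> + p) = filtermap (\<lambda>x. x + p) (at \<theta>)"
    using filtermap_at_shift[of "- p" \<theta>] by simp
  show ?thesis
    by (simp add: L2_has_deriv_def nhds at eventually_filtermap filterlim_filtermap per)
qed

lemma L2_deriv_shift:
  assumes "\<And>t. f (t + p) = f t"
  shows "L2_deriv \<mu> f (\<theta> + p) = L2_deriv \<mu> f \<theta>"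
  by (simp add: L2_deriv_def L2_has_deriv_shift[of f p, OF assms])

lemma hfun_shift_int:
  assumes "\<And>x. hfun M (x + 1) \<sigma> = hfun M x \<sigma>"
  shows "hfun M (x + of_int n) \<sigma> = hfun M x \<sigma>"
proof -
  have nat: "hfun M (x + of_nat m) \<sigma> = hfun M x \<sigma>" for x m
    by (induction m) (simp_all add: assms add.assoc[symmetric] add.commute[of 1])
  show ?thesis
  proof (cases "0 \<le> n")
    case True then show ?thesis using nat[of x "nat n"] by simp
  next
    case False then show ?thesis using nat[of "x + of_int n" "nat (- n)"] by simp
  qed
qed

lemma proj_shift:
  assumes "valid_model M T"
  obtains p where "proj (dom_of M) t = t + p" "\<And>u. phi M T (u + p) = phi M T u"
proof (cases "dom_of M")
  case Line
  then show ?thesis using that[of 0] by simp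
next
  case Torus
  have "hfun M (x + 1) (sig M T) = hfun M x (sig M T)" for x
    using assms Torus by (auto simp: valid_model_def)
  then have "hfun M (u + of_int n - x) (sig M T) = hfun M (u - x) (sig M T)" for u x n
    using hfun_shift_int[of M "sig M T" "u - x" n] by (simp add: algebra_simps)
  then have "phi M T (u + of_int n) = phi M T u" for u n
    by (simp add: phi_def varphi_def)
  from this[of _ "- \<lfloor>t\<rfloor>"] show ?thesis
    using that[of "of_int (- \<lfloor>t\<rfloor>)"] Torus by (simp add: frac_def)
qed

lemma gT_shift: "(\<And>u. phi M T (u + p) = phi M T u) \<Longrightarrow> gT M T (t + p) = gT M T t"
  by (simp add: gT_def L2_deriv_shift[of "phi M T" p])

lemma Dtilde_shift:
  assumes "\<And>u. phi M T (u + p) = phi M T u"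
  shows "Dtilde M T i (phi M T) (t + p) = Dtilde M T i (phi M T) t"
proof (induction i arbitrary: t)
  case (Suc i)
  show ?case
    by (simp add: L2_deriv_shift[of "Dtilde M T i (phi M T)" p, OF Suc] gT_shift[OF assms])
qed (simp add: assms)

lemma
  assumes "valid_model M T"
  shows gT_proj: "gT M T (proj (dom_of M) t) = gT M T t"
    and phi_proj: "phi M T (proj (dom_of M) t) = phi M T t"
    and KT_proj: "KT M T i j (proj (dom_of M) t) (proj (dom_of M) t') =
      L2_inner (lam M T) (Dtilde M T i (phi M T) t) (Dtilde M T j (phi M T) t')"
proof -
  have "gT M T (proj (dom_of M) t) = gT M T t \<and> phi M T (proj (dom_of M) t) = phi M T t \<and>
      Dtilde M T i (phi M T) (proj (dom_of M) t) = Dtilde M T i (phi M T) t" for t i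
    using proj_shift[OF assms, of t] by (metis gT_shift Dtilde_shift)
  then show "gT M T (proj (dom_of M) t) = gT M T t" "phi M T (proj (dom_of M) t) = phi M T t"
    "KT M T i j (proj (dom_of M) t) (proj (dom_of M) t') =
      L2_inner (lam M T) (Dtilde M T i (phi M T) t) (Dtilde M T j (phi M T) t')"
    by (auto simp: KT_def)
qed

lemma proj_in_points: "proj D t \<in> points D"
  by (cases D) (auto simp: frac_lt_1)

lemma Dtilde_has_deriv:
  assumes valid: "valid_model M T" and diff: "features_differentiable M T" and i: "i < 3"
  shows "L2_has_deriv (lam M T) (Dtilde M T i (phi M T)) (L2_deriv (lam M T) (Dtilde M T i (phi M T)) t) t"
proof -
  obtain p where p: "proj (dom_of M) t = t + p" "\<And>u. phi M T (u + p) = phi M T u"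
    using proj_shift[OF valid] by blast
  obtain d where "L2_has_deriv (lam M T) (Dtilde M T i (phi M T)) d (t + p)"
    using diff i proj_in_points[of "dom_of M" t] unfolding features_differentiable_def p(1) by blast
  then have "L2_has_deriv (lam M T) (Dtilde M T i (phi M T)) d t"
    using L2_has_deriv_shift[of "Dtilde M T i (phi M T)" p, OF Dtilde_shift[OF p(2)]] by simp
  then show ?thesis by (rule L2_deriv_has_deriv)
qed

lemma Dtilde_L2:
  assumes "valid_model M T" "features_differentiable M T" "i \<le> 2"
  shows "Dtilde M T i (phi M T) t \<in> L2 (lam M T)"
  using Dtilde_has_deriv[OF assms(1,2), of i t] assms(3)
  by (auto simp: L2_has_deriv_def dest!: eventually_nhds_x_imp_x)

lemma phi_unit:
  assumes "valid_model M T" "smooth_features M T"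
  shows "L2_norm (lam M T) (phi M T t) = 1"
proof -
  have "0 < L2_norm (lam M T) (varphi M T (proj (dom_of M) t))"
    using assms(2) proj_in_points[of "dom_of M" t] by (simp add: smooth_features_def Let_def varphi_def)
  then have "L2_norm (lam M T) (phi M T (proj (dom_of M) t)) = 1"
    by (simp add: phi_def)
  then show ?thesis by (simp add: phi_proj[OF assms(1)])
qed

lemma gT_pos:
  assumes "valid_model M T" "positive_gT M T"
  shows "0 < gT M T t"
  using assms(2) proj_in_points[of "dom_of M" t] gT_proj[OF assms(1), of t] by (auto simp: positive_gT_def)

lemma velocity_unit:
  assumes "valid_model M T" "positive_gT M T"
  shows "L2_norm (lam M T) (Dtilde M T (Suc 0) (phi M T) t) = 1"
  using gT_pos[OF assms, of t] by (simp add: gT_def)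

lemma H1inf_le: "H1inf F r \<le> 1 / 2" and H2inf_le: "H2inf F r \<le> 1 / 6"
  by (simp_all add: H1inf_def H2inf_def)

lemma KT_Kprox_le_VT:
  assumes "i \<le> 2" "j \<le> 2" "\<theta> \<in> ThetaT M T" "\<theta>' \<in> ThetaT M T"
  shows "ereal \<bar>KT M T i j \<theta> \<theta>' - Kprox F M T i j \<theta> \<theta>'\<bar> \<le> VT F M T"
  unfolding VT_def using assms
  by (intro max.coboundedI1 SUP_upper2[of i] SUP_upper2[of j] SUP_upper2[of \<theta>] SUP_upper) auto

text \<open>On the diagonal \<open>Kprox\<close> of orders $(2,2)$ has the first summand as its absolute value, and $1/2$ bounds the
  approximation error; the square root bounds the norm of the second derivative of the curve.\<close>

definition curvature_bound :: "(real \<Rightarrow> real) \<Rightarrow> real" where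
  "curvature_bound F = sqrt (\<bar>ginf F powr (- 2) * Fd_even F 4 0\<bar> + 1 / 2)"

text \<open>\<open>ThetaT\<close> is lifted to \<open>{a..b}\<close>, and the approximation error of the kernels is a real number \<open>V\<close>.\<close>

locale lifted_model =
  fixes F :: "real \<Rightarrow> real" and M :: model and T :: nat and a b V :: real
  assumes valid: "valid_model M T" and smooth: "smooth_features M T"
    and diff: "features_differentiable M T" and pos: "positive_gT M T"
    and F: "F_properties F" and CT2: "CT F M T \<le> 2"
    and ab: "a \<le> b" and Theta: "ThetaT M T = proj (dom_of M) ` {a..b}"
    and VT: "VT F M T = ereal V" and V: "V \<le> 1 / 2"
begin

abbreviation "\<sigma> \<equiv> sig M T"
abbreviation "curve i \<equiv> Dtilde M T i (phi M T)"
abbreviation "dot \<equiv> L2_inner (lam M T)"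
abbreviation "os \<equiv> offset (dom_of M)"

lemma \<sigma>_pos: "0 < \<sigma>"
  using valid by (auto simp: valid_model_def)

lemma g_pos: "0 < ginf F"
  using F by (simp add: F_properties_def)

lemma kernel_le:
  assumes i: "i \<le> 2" "j \<le> 2" and t: "t \<in> {a..b}" "t' \<in> {a..b}"
  shows "\<bar>dot (curve i t) (curve j t')\<bar> \<le>
    \<bar>ginf F powr (- real (i + j) / 2) * Fd_even F (i + j) (os (t - t') / \<sigma>)\<bar> + V"
proof -
  have "\<bar>KT M T i j (proj (dom_of M) t) (proj (dom_of M) t') -
      Kprox F M T i j (proj (dom_of M) t) (proj (dom_of M) t')\<bar> \<le> V"
    using KT_Kprox_le_VT[of i j _ M T _ F] i t by (auto simp: Theta VT)
  moreover have "\<bar>Kprox F M T i j (proj (dom_of M) t) (proj (dom_of M) t')\<bar> =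
      \<bar>ginf F powr (- real (i + j) / 2) * Fd_even F (i + j) (os (t - t') / \<sigma>)\<bar>"
    by (simp add: Kprox_def offset_proj abs_mult)
  ultimately show ?thesis unfolding KT_proj[OF valid] by linarith
qed

text \<open>By the symmetry of the inner product the arguments can be ordered such that the offset is
  positive. There the even extension of \<open>F\<close> has the derivatives of \<open>F\<close>.\<close>

lemma kernel_off_diagonal_le:
  assumes i: "i \<le> 2" "j \<le> 2" and t: "t \<in> {a..b}" "t' \<in> {a..b}" and ne: "os (t - t') \<noteq> 0"
  shows "\<bar>dot (curve i t) (curve j t')\<bar> \<le>
    ginf F powr (- real (i + j) / 2) * \<bar>Fd F (i + j) \<bar>os (t - t') / \<sigma>\<bar>\<bar> + V"
proof (cases "0 < os (t - t')")
  case True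
  then show ?thesis
    using kernel_le[OF i t] \<sigma>_pos by (simp add: Fd_even_pos abs_mult)
next
  case False
  then have neg: "os (t - t') < 0" using ne by simp
  then have os: "os (t' - t) = - os (t - t')" using offset_minus_neg[OF neg] by simp
  have "\<bar>dot (curve j t') (curve i t)\<bar> \<le>
      \<bar>ginf F powr (- real (i + j) / 2) * Fd_even F (i + j) (- os (t - t') / \<sigma>)\<bar> + V"
    using kernel_le[OF i(2,1) t(2,1)] by (simp only: os add.commute[of j i])
  moreover have "0 < - os (t - t') / \<sigma>" "\<bar>os (t - t') / \<sigma>\<bar> = - os (t - t') / \<sigma>"
    using neg \<sigma>_pos by (simp_all add: divide_pos_pos divide_neg_pos)
  ultimately show ?thesis
    by (simp add: Fd_even_pos abs_mult L2_inner_commute[of _ "curve j t'"] del: minus_divide_left[symmetric])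
qed

sublocale unit_speed_curve "lam M T" curve "\<lambda>t. sqrt (gT M T t)" a b
  "2 * sqrt (ginf F) / sig M T" "curvature_bound F"
proof
  fix i :: nat and t :: real and w
  show "i \<le> 2 \<Longrightarrow> curve i t \<in> L2 (lam M T)"
    by (rule Dtilde_L2[OF valid diff])
  show "((\<lambda>t. dot w (curve i t)) has_real_derivative sqrt (gT M T t) * dot w (curve (Suc i) t)) (at t)"
    if "i < 2" "w \<in> L2 (lam M T)"
    using L2_has_deriv_inner[OF Dtilde_has_deriv[OF valid diff, of i t] that(2)] that(1) gT_pos[OF valid pos, of t]
    by simp
  show "0 < sqrt (gT M T t)" using gT_pos[OF valid pos] by simp
  show "L2_norm (lam M T) (curve 0 t) = 1" using phi_unit[OF valid smooth] by simp
  show "L2_norm (lam M T) (curve (Suc 0) t) = 1"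
    by (rule velocity_unit[OF valid pos])
  show "sqrt (gT M T t) \<le> 2 * sqrt (ginf F) / \<sigma>" if t: "t \<in> {a..b}"
  proof -
    have "ereal (sqrt (gT M T (proj (dom_of M) t) / gprox F M T)) \<le> CT F M T"
      unfolding CT_def using t by (intro max.coboundedI2 SUP_upper) (auto simp: Theta)
    from order_trans[OF this CT2] have "sqrt (gT M T t / gprox F M T) \<le> 2"
      by (simp add: gT_proj[OF valid])
    then have "sqrt (gT M T t) / (sqrt (ginf F) / \<sigma>) \<le> 2"
      using \<sigma>_pos by (simp add: gprox_def real_sqrt_divide real_sqrt_mult)
    then show ?thesis using g_pos \<sigma>_pos by (simp add: field_simps)
  qed
  show "L2_norm (lam M T) (curve 2 t) \<le> curvature_bound F" if t: "t \<in> {a..b}"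
    using kernel_le[of 2 2 t t] t V
    unfolding curvature_bound_def by (intro real_le_rsqrt) (simp add: L2_norm_square)
  show "0 \<le> curvature_bound F" by (simp add: curvature_bound_def)
qed

text \<open>The limiting kernel contributes at most \<open>\<eta> * H2inf F r\<close> to a row, by the definition of \<open>delta\<close>,
  and the approximation error contributes \<open>V\<close> for each of the \<open>s - 1\<close> entries. The bounds add up to
  at most \<open>H2inf F r\<close>.\<close>

lemma kernel_row:
  assumes sV: "(real s - 1) * V \<le> (1 - \<eta>) * H2inf F r"
    and less: "delta F (\<eta> * H2inf F r) s < ereal m" and m: "0 < m"
    and z: "\<And>l. l < s \<Longrightarrow> z l \<in> {a..b}"
    and sep: "\<And>k l. k < s \<Longrightarrow> l < s \<Longrightarrow> k \<noteq> l \<Longrightarrow> m * \<sigma> \<le> \<bar>os (z k - z l)\<bar>"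
    and k: "k < s" and ij: "i \<le> 2" "j \<le> 2" "i + j \<le> 3"
  shows "(\<Sum>l\<in>{..<s} - {k}. \<bar>dot (curve i (z k)) (curve j (z l))\<bar>) \<le> 1 / 6"
proof -
  \<comment> \<open>The points seen from \<open>z k\<close>, on the line and in units of \<open>\<sigma>\<close>.\<close>
  define X where "X l = os (z l - z k) / \<sigma>" for l
  have Xk: "X k = 0" by (simp add: X_def)
  have Xsep: "m \<le> \<bar>X l - X l'\<bar>" if "l < s" "l' < s" "l \<noteq> l'" for l l'
  proof -
    have "m * \<sigma> \<le> \<bar>os (z l - z k) - os (z l' - z k)\<bar>"
      using sep[OF that] offset_diff_le[of "dom_of M" "z l - z k" "z l' - z k"] by simp
    also have "\<dots> = \<bar>X l - X l'\<bar> * \<sigma>"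
      using \<sigma>_pos by (simp add: X_def diff_divide_distrib[symmetric] abs_divide)
    finally show ?thesis using \<sigma>_pos by simp
  qed
  have "(\<Sum>l\<in>{..<s} - {k}. \<bar>dot (curve i (z k)) (curve j (z l))\<bar>) \<le>
      (\<Sum>l\<in>{..<s} - {k}. ginf F powr (- real (i + j) / 2) * \<bar>Fd F (i + j) \<bar>X k - X l\<bar>\<bar> + V)"
  proof (intro sum_mono)
    fix l assume l: "l \<in> {..<s} - {k}"
    have "0 < \<bar>os (z k - z l)\<bar>"
      using l by (intro less_le_trans[OF mult_pos_pos[OF m \<sigma>_pos] sep[OF k]]) auto
    then have "os (z k - z l) \<noteq> 0" by simp
    moreover have "\<bar>os (z k - z l) / \<sigma>\<bar> = \<bar>X k - X l\<bar>"
      using offset_abs_minus[of "dom_of M" "z l - z k"] \<sigma>_pos by (simp add: Xk X_def abs_divide)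
    ultimately show "\<bar>dot (curve i (z k)) (curve j (z l))\<bar> \<le>
        ginf F powr (- real (i + j) / 2) * \<bar>Fd F (i + j) \<bar>X k - X l\<bar>\<bar> + V"
      using kernel_off_diagonal_le[OF ij(1,2) z[OF k] z[of l]] l by auto
  qed
  also have "\<dots> \<le> \<eta> * H2inf F r + (real s - 1) * V"
    using delta_sum_le[OF less Xsep k ij(3)] k by (simp add: sum.distrib)
  also have "\<dots> \<le> H2inf F r" using sV by (simp add: algebra_simps)
  finally show ?thesis using H2inf_le[of F r] by simp
qed

text \<open>
  Parameters separated by \<open>Sigma_sep\<close> are at distance more than \<open>8 \<delta> \<sigma>\<close>, where \<open>\<delta>\<close> is the
  value of \<open>delta\<close>. If there are two of them, the width \<open>\<omega> \<sigma>\<close> of the cells is at most \<open>\<delta> \<sigma>\<close>,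
  because \<open>\<bar>F\<bar>\<close> exceeds $1/6$ on \<open>{0..\<omega>}\<close>. Hence points chosen anywhere in the cells are still separated by \<open>6 \<delta> \<sigma>\<close>, which is
  more than \<open>delta\<close> requires.
\<close>

lemma short_cells_around:
  fixes \<omega> :: real and J :: "nat \<Rightarrow> nat" and \<theta> :: "nat \<Rightarrow> real"
  defines "c \<equiv> \<lambda>l. a + real (J l) * (\<omega> * \<sigma>)"
  defines "d \<equiv> \<lambda>l. min b (c l + \<omega> * \<sigma>)"
  assumes sV: "(real s - 1) * V \<le> (1 - \<eta>) * H2inf F r"
    and \<eta>: "0 < \<eta>" "\<eta> < 1"
    and fin: "delta F (\<eta> * H2inf F r) s < \<infinity>"
    and sep: "\<And>k l. k < s \<Longrightarrow> l < s \<Longrightarrow> k \<noteq> l \<Longrightarrow>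
      ereal \<sigma> * Sigma_sep F \<eta> r s < ereal \<bar>os (\<theta> k - \<theta> l)\<bar>"
    and \<theta>: "\<And>k. k < s \<Longrightarrow> \<theta> k \<in> {c k..d k}"
    and \<omega>: "0 < \<omega>" "\<And>x. 0 \<le> x \<Longrightarrow> x \<le> \<omega> \<Longrightarrow> 1 / 6 < \<bar>F x\<bar>"
      "4000 * (sqrt (ginf F) * \<omega> * (1 + curvature_bound F)\<^sup>2) \<le> 1"
  shows "short_cells (lam M T) curve (\<lambda>t. sqrt (gT M T t)) a b
    (2 * sqrt (ginf F) / \<sigma>) (curvature_bound F) s c d (2 * sqrt (ginf F) * \<omega>)"
proof
  have ca: "a \<le> c l" for l using \<omega>(1) \<sigma>_pos by (simp add: c_def)
  show "c k \<le> d k" if "k < s" for k using \<theta>[OF that] by auto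
  show "{c k..d k} \<subseteq> {a..b}" if "k < s" for k using ca[of k] by (auto simp: d_def)
  show "2 * sqrt (ginf F) / \<sigma> * (d k - c k) \<le> 2 * sqrt (ginf F) * \<omega>" if "k < s" for k
  proof -
    have "2 * sqrt (ginf F) / \<sigma> * (d k - c k) \<le> 2 * sqrt (ginf F) / \<sigma> * (\<omega> * \<sigma>)"
      using g_pos \<sigma>_pos by (intro mult_left_mono) (auto simp: d_def)
    then show ?thesis using \<sigma>_pos by simp
  qed
  show "0 \<le> 2 * sqrt (ginf F) * \<omega>" using g_pos \<omega>(1) by simp
  show "2000 * (2 * sqrt (ginf F) * \<omega> * (1 + curvature_bound F)\<^sup>2) \<le> 1" using \<omega>(3) by simp
  fix k x and y :: "nat \<Rightarrow> real" and i j :: nat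
  assume k: "k < s" and x: "x \<in> {c k..d k}" and y: "\<And>l. l < s \<Longrightarrow> y l \<in> {c l..d l}"
    and ij: "i \<le> 2" "j \<le> 2" "i + j \<le> 3"
  show "(\<Sum>l\<in>{..<s} - {k}. \<bar>dot (curve i x) (curve j (y l))\<bar>) \<le> 1 / 6"
  proof (cases "s < 2")
    case True
    then have empty: "{..<s} - {k} = {}" using k by auto
    show ?thesis unfolding empty by simp
  next
    case False
    define z where "z = y(k := x)"
    have z: "z l \<in> {c l..d l}" if "l < s" for l using x y[OF that] by (auto simp: z_def)
    have u: "\<eta> * H2inf F r \<le> 1 / 6"
    proof -
      have "\<eta> * H2inf F r \<le> \<eta> * (1 / 6)" using \<eta> H2inf_le[of F r] by (intro mult_left_mono) auto
      then show ?thesis using \<eta> by linarith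
    qed
    have low: "ereal \<omega> \<le> delta F (\<eta> * H2inf F r) s"
      using delta_lower_bound[OF \<omega>(2) u _ g_pos] False by simp
    then obtain \<delta> where \<delta>: "delta F (\<eta> * H2inf F r) s = ereal \<delta>" and \<omega>\<delta>: "\<omega> \<le> \<delta>"
      using fin by (cases "delta F (\<eta> * H2inf F r) s") auto
    have Sig: "ereal \<sigma> * (4 * (2 * ereal \<delta>)) \<le> ereal \<sigma> * Sigma_sep F \<eta> r s"
      unfolding Sigma_sep_def \<delta> using \<sigma>_pos by (intro ereal_mult_left_mono) auto
    have "6 * \<delta> * \<sigma> \<le> \<bar>os (z k' - z l)\<bar>" if kl: "k' < s" "l < s" "k' \<noteq> l" for k' l
    proof -
      have close: "\<bar>os (z m - \<theta> m)\<bar> \<le> \<omega> * \<sigma>" if "m < s" for m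
        using offset_abs_le[of "dom_of M" "z m - \<theta> m"] z[OF that] \<theta>[OF that] by (auto simp: d_def)
      have "8 * \<delta> * \<sigma> < \<bar>os (\<theta> k' - \<theta> l)\<bar>"
        using le_less_trans[OF Sig sep[OF kl]] by (simp add: ac_simps)
      also have "\<dots> \<le> \<bar>os (\<theta> k' - z k')\<bar> + \<bar>os (z k' - z l)\<bar> + \<bar>os (z l - \<theta> l)\<bar>"
        using offset_triangle[of "dom_of M" "\<theta> k'" "\<theta> l" "z k'"]
          offset_triangle[of "dom_of M" "z k'" "\<theta> l" "z l"] by simp
      also have "\<dots> \<le> \<omega> * \<sigma> + \<bar>os (z k' - z l)\<bar> + \<omega> * \<sigma>"
        using close[OF kl(1)] close[OF kl(2)] offset_abs_minus[of "dom_of M" "\<theta> k' - z k'"] by simp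
      also have "\<dots> \<le> \<delta> * \<sigma> + \<bar>os (z k' - z l)\<bar> + \<delta> * \<sigma>"
        using \<omega>\<delta> \<sigma>_pos by (intro add_mono mult_right_mono) auto
      finally show ?thesis by (simp add: algebra_simps)
    qed
    then have "(\<Sum>l\<in>{..<s} - {k}. \<bar>dot (curve i (z k)) (curve j (z l))\<bar>) \<le> 1 / 6"
      using \<delta> \<omega>\<delta> \<omega>(1) z ca k ij
      by (intro kernel_row[OF sV, of "6 * \<delta>"]) (auto simp: d_def intro: order_trans[OF ca])
    moreover have "(\<Sum>l\<in>{..<s} - {k}. \<bar>dot (curve i (z k)) (curve j (z l))\<bar>) =
        (\<Sum>l\<in>{..<s} - {k}. \<bar>dot (curve i x) (curve j (y l))\<bar>)"
      by (intro sum.cong) (auto simp: z_def)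
    ultimately show ?thesis by simp
  qed
qed

end

section \<open>Finite tests\<close>

text \<open>Let \<open>R\<close> be the event that the noise alone exceeds a threshold. Outside \<open>R\<close> the test makes no
  error: under the null hypothesis it sees nothing but noise, and under an alternative the noise
  cannot bring the inner product in the detecting direction below its threshold.\<close>

lemma minimax_risk_le_finite_test:
  fixes M :: model and T :: nat and d :: "'i \<Rightarrow> real \<Rightarrow> real" and t :: "'i \<Rightarrow> real"
  defines "\<mu> \<equiv> lam M T"
  assumes noise: "noise_assumption \<mu> W \<sigma> \<Delta>" and pos: "0 < \<sigma>" "0 < \<Delta>" and \<alpha>: "0 < \<alpha>"
    and mix: "\<And>\<beta> \<theta>s. mixture M T \<beta> \<theta>s \<in> L2 \<mu>"
    and I: "finite I" and d: "\<And>i. i \<in> I \<Longrightarrow> d i \<in> L2 \<mu>" "\<And>i. i \<in> I \<Longrightarrow> L2_norm \<mu> (d i) \<le> 1"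
    and t: "\<And>i. i \<in> I \<Longrightarrow> 0 \<le> t i"
    and total: "(\<Sum>i\<in>I. 2 * exp (- (t i)\<^sup>2 / (2 * (\<sigma>\<^sup>2 * \<Delta>)))) \<le> \<alpha> / 2"
    and detect: "\<And>\<beta> \<theta>s. (\<beta>, \<theta>s) \<in> H1 M T s \<delta> \<beta>0 \<theta>0 \<rho> \<Longrightarrow>
      \<exists>i\<in>I. 2 * t i < \<bar>L2_inner \<mu> (\<lambda>x. mixture M T \<beta> \<theta>s x - mixture M T \<beta>0 \<theta>0 x) (d i)\<bar>"
  shows "minimax_risk M T W s \<delta> \<beta>0 \<theta>0 \<rho> \<le> ennreal \<alpha>"
proof -
  let ?f0 = "mixture M T \<beta>0 \<theta>0"
  define R where "R = (\<Union>i\<in>I. {w \<in> space W. t i < \<bar>L2_inner \<mu> w (d i)\<bar>})"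
  have sets: "sets W = sets (L2_borel \<mu>)" using noise by (simp add: noise_assumption_def)
  have space: "space W = L2 \<mu>" using sets_eq_imp_space_eq[OF sets] by simp
  have R_sets: "R \<in> sets W" unfolding R_def
    using I noise_tail(1)[OF noise pos d t] by (intro sets.finite_UN) auto
  have "emeasure W R \<le> (\<Sum>i\<in>I. emeasure W {w \<in> space W. t i < \<bar>L2_inner \<mu> w (d i)\<bar>})"
    unfolding R_def using I noise_tail(1)[OF noise pos d t] by (intro emeasure_subadditive_finite) auto
  also have "\<dots> \<le> (\<Sum>i\<in>I. ennreal (2 * exp (- (t i)\<^sup>2 / (2 * (\<sigma>\<^sup>2 * \<Delta>)))))"
    by (intro sum_mono noise_tail(2)[OF noise pos d t])
  also have "\<dots> \<le> ennreal (\<alpha> / 2)"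
    using total by (subst sum_ennreal) (auto intro: ennreal_leI)
  finally have R_small: "emeasure W R \<le> ennreal (\<alpha> / 2)" .

  define A where "A = {y \<in> space (L2_borel \<mu>). \<exists>i\<in>I. t i < \<bar>L2_inner \<mu> y (d i) - L2_inner \<mu> ?f0 (d i)\<bar>}"
  have "{y \<in> space (L2_borel \<mu>). t i < \<bar>L2_inner \<mu> y (d i) - L2_inner \<mu> ?f0 (d i)\<bar>} \<in> sets (L2_borel \<mu>)"
    if "i \<in> I" for i
  proof -
    note [measurable] = L2_inner_measurable[OF d(1)[OF that]]
    show ?thesis by measurable
  qed
  then have "A \<in> sets (L2_borel \<mu>)"
    unfolding A_def using I by (intro sets.sets_Collect_finite_Ex)
  then have \<Psi>: "indicator A \<in> tests \<mu>"
    by (auto simp: tests_def indicator_def)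

  have obs: "(\<lambda>x. mixture M T \<beta> \<theta>s x + w x) \<in> A \<longleftrightarrow>
      (\<exists>i\<in>I. t i < \<bar>L2_inner \<mu> w (d i) + L2_inner \<mu> (\<lambda>x. mixture M T \<beta> \<theta>s x - ?f0 x) (d i)\<bar>)"
    if "w \<in> space W" for \<beta> \<theta>s w
  proof -
    have w: "w \<in> L2 \<mu>" using that space by simp
    have "L2_inner \<mu> (\<lambda>x. mixture M T \<beta> \<theta>s x + w x) (d i) - L2_inner \<mu> ?f0 (d i) =
        L2_inner \<mu> w (d i) + L2_inner \<mu> (\<lambda>x. mixture M T \<beta> \<theta>s x - ?f0 x) (d i)" if "i \<in> I" for i
      using d(1)[OF that] mix w by simp
    then show ?thesis using w mix by (simp add: A_def)
  qed

  have le_R: "(\<integral>\<^sup>+w. ennreal (h w) \<partial>W) \<le> ennreal (\<alpha> / 2)"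
    if "\<And>w. w \<in> space W \<Longrightarrow> h w \<le> indicator R w" for h :: "(real \<Rightarrow> real) \<Rightarrow> real"
  proof -
    have "(\<integral>\<^sup>+w. ennreal (h w) \<partial>W) \<le> (\<integral>\<^sup>+w. indicator R w \<partial>W)"
      using that by (intro nn_integral_mono) (metis ennreal_indicator ennreal_leI)
    also have "\<dots> = emeasure W R" using R_sets by simp
    finally show ?thesis using R_small by simp
  qed

  have "(SUP p\<in>insert (\<beta>0, \<theta>0) (H0 M T s \<delta> \<beta>0 \<theta>0). expect M T W p (indicator A)) \<le> ennreal (\<alpha> / 2)"
  proof (rule SUP_least, unfold expect_def, rule le_R)
    fix p w assume p: "p \<in> insert (\<beta>0, \<theta>0) (H0 M T s \<delta> \<beta>0 \<theta>0)" and w: "w \<in> space W"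
    have "AE x in \<mu>. mixture M T (fst p) (snd p) x - ?f0 x = 0"
      unfolding \<mu>_def using p by (auto simp: H0_def)
    then have "L2_inner \<mu> (\<lambda>x. mixture M T (fst p) (snd p) x - ?f0 x) (d i) = 0" for i
      unfolding L2_inner_def by (intro integral_eq_zero_AE) (auto elim!: eventually_mono)
    then show "indicator A (\<lambda>x. mixture M T (fst p) (snd p) x + w x) \<le> (indicator R w :: real)"
      using obs[OF w, of "fst p" "snd p"] w by (auto simp: indicator_def R_def)
  qed
  moreover have "(SUP p\<in>H1 M T s \<delta> \<beta>0 \<theta>0 \<rho>. expect M T W p (\<lambda>y. 1 - indicator A y)) \<le> ennreal (\<alpha> / 2)"
  proof (rule SUP_least, unfold expect_def, rule le_R)
    fix p w assume p: "p \<in> H1 M T s \<delta> \<beta>0 \<theta>0 \<rho>" and w: "w \<in> space W"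
    obtain i where i: "i \<in> I"
      and big: "2 * t i < \<bar>L2_inner \<mu> (\<lambda>x. mixture M T (fst p) (snd p) x - ?f0 x) (d i)\<bar>"
      using detect[of "fst p" "snd p"] p by auto
    show "1 - indicator A (\<lambda>x. mixture M T (fst p) (snd p) x + w x) \<le> (indicator R w :: real)"
    proof (cases "w \<in> R")
      case False
      then have "\<bar>L2_inner \<mu> w (d i)\<bar> \<le> t i" using i w by (auto simp: R_def not_less)
      then have "t i < \<bar>L2_inner \<mu> w (d i) + L2_inner \<mu> (\<lambda>x. mixture M T (fst p) (snd p) x - ?f0 x) (d i)\<bar>"
        using big by linarith
      then show ?thesis using obs[OF w, of "fst p" "snd p"] i by (auto simp: indicator_def)
    qed (simp add: indicator_def)
  qed
  ultimately have "risk M T W s \<delta> \<beta>0 \<theta>0 \<rho> (indicator A) \<le> ennreal (\<alpha> / 2) + ennreal (\<alpha> / 2)"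
    unfolding risk_def by (rule add_mono)
  also have "\<dots> = ennreal \<alpha>" using \<alpha> by (simp add: ennreal_plus[symmetric] del: ennreal_plus)
  finally show ?thesis
    unfolding minimax_risk_def using \<Psi> by (auto simp: \<mu>_def intro: INF_lower2)
qed

lemma near_minimizer:
  fixes h :: "'p \<Rightarrow> real"
  assumes "P \<noteq> {}" and \<rho>: "0 < \<rho>" "\<And>p. p \<in> P \<Longrightarrow> \<rho> \<le> h p"
  obtains q where "q \<in> P" "\<And>p. p \<in> P \<Longrightarrow> h q \<le> 2 * h p"
proof -
  have bdd: "bdd_below (h ` P)" using \<rho>(2) by (rule bdd_belowI2)
  have "\<rho> \<le> Inf (h ` P)" using assms by (intro cINF_greatest)
  then have "Inf (h ` P) < 2 * Inf (h ` P)" using \<rho>(1) by simp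
  then obtain q where q: "q \<in> P" "h q < 2 * Inf (h ` P)"
    using cInf_lessD[of "h ` P" "2 * Inf (h ` P)"] assms(1) by auto
  have "h q \<le> 2 * h p" if "p \<in> P" for p
    using cINF_lower[OF bdd that] q(2) by simp
  then show thesis using that q(1) by blast
qed

text \<open>
  The base vectors \<open>e j\<close> are tested at level \<open>t\<^sub>1\<close>, the directions \<open>u \<kappa>\<close> of the class
  references at the larger level \<open>t\<^sub>2\<close>. The union bound is then at most \<open>4 x + 2 x ^ S\<close> with
  \<open>x = N exp (- \<Lambda>)\<close>, hence at most \<open>6 x\<close>. If an alternative \<open>f p\<close> escaped all tests, its distance to
  the null signal would be at most \<open>20 t\<^sub>1 sqrt (2 S) + 6 t\<^sub>2\<close>, that is
  \<open>(40 + 6 sqrt 2) \<sigma> sqrt (S \<Delta> \<Lambda>)\<close>, and this is below the separation.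
\<close>

lemma minimax_risk_le_classes:
  fixes M :: model and T :: nat and e :: "'j \<Rightarrow> real \<Rightarrow> real" and cls :: "real list \<times> real list \<Rightarrow> 'c" and N S :: nat and \<sigma> \<Delta> \<alpha> \<Lambda> :: real
  defines "\<mu> \<equiv> lam M T" and "f \<equiv> \<lambda>p. mixture M T (fst p) (snd p)"
  assumes noise: "noise_assumption \<mu> W \<sigma> \<Delta>" and pos: "0 < \<sigma>" "0 < \<Delta>" and \<alpha>: "0 < \<alpha>" "\<alpha> < 1"
    and mix: "\<And>\<beta> \<theta>s. mixture M T \<beta> \<theta>s \<in> L2 \<mu>"
    and J: "finite J" "card J \<le> 2 * N"
    and e: "\<And>j. j \<in> J \<Longrightarrow> e j \<in> L2 \<mu>" "\<And>j. j \<in> J \<Longrightarrow> L2_norm \<mu> (e j) \<le> 1"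
    and C: "finite C" "card C \<le> N ^ S" and cls: "\<And>p. p \<in> params M T s \<delta> \<Longrightarrow> cls p \<in> C"
    and S: "1 \<le> S" and \<Lambda>: "0 < \<Lambda>" "real N * exp (- \<Lambda>) \<le> \<alpha> / 12"
    and compare: "\<And>p q g \<kappa>. p \<in> params M T s \<delta> \<Longrightarrow> q \<in> params M T s \<delta> \<Longrightarrow> cls p = cls q \<Longrightarrow>
      g \<in> L2 \<mu> \<Longrightarrow> 0 \<le> \<kappa> \<Longrightarrow> (\<And>j. j \<in> J \<Longrightarrow> \<bar>L2_inner \<mu> g (e j)\<bar> \<le> \<kappa>) \<Longrightarrow>
      \<bar>L2_inner \<mu> g (\<lambda>x. f p x - f q x)\<bar> \<le>
        (2 * \<kappa> * sqrt (2 * S) + L2_norm \<mu> g / 10) * L2_norm \<mu> (\<lambda>x. f p x - f q x)"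
  shows "minimax_risk M T W s \<delta> \<beta>0 \<theta>0 (50 * \<sigma> * sqrt (S * \<Delta> * \<Lambda>)) \<le> ennreal \<alpha>"
proof -
  let ?\<rho> = "50 * \<sigma> * sqrt (S * \<Delta> * \<Lambda>)" and ?f0 = "mixture M T \<beta>0 \<theta>0"
  define P where "P \<kappa> = {p \<in> H1 M T s \<delta> \<beta>0 \<theta>0 ?\<rho>. cls p = \<kappa>}" for \<kappa>
  define dist where "dist p = L2_norm \<mu> (\<lambda>x. f p x - ?f0 x)" for p
  have \<rho>: "0 < ?\<rho>" using pos S \<Lambda> by simp
  have H1: "p \<in> params M T s \<delta>" "?\<rho> \<le> dist p" if "p \<in> H1 M T s \<delta> \<beta>0 \<theta>0 ?\<rho>" for p
    using that by (auto simp: H1_def dist_def f_def \<mu>_def)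
  have "\<forall>\<kappa>. \<exists>q. P \<kappa> \<noteq> {} \<longrightarrow> q \<in> P \<kappa> \<and> (\<forall>p\<in>P \<kappa>. dist q \<le> 2 * dist p)"
  proof
    fix \<kappa>
    show "\<exists>q. P \<kappa> \<noteq> {} \<longrightarrow> q \<in> P \<kappa> \<and> (\<forall>p\<in>P \<kappa>. dist q \<le> 2 * dist p)"
    proof (cases "P \<kappa> = {}")
      case False
      obtain q where "q \<in> P \<kappa>" "\<And>p. p \<in> P \<kappa> \<Longrightarrow> dist q \<le> 2 * dist p"
        using near_minimizer[OF False \<rho>, of dist] H1(2) by (auto simp: P_def)
      then show ?thesis by blast
    qed simp
  qed
  then obtain q where q: "\<And>\<kappa>. P \<kappa> \<noteq> {} \<Longrightarrow> q \<kappa> \<in> P \<kappa>"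
    and q_near: "\<And>\<kappa> p. p \<in> P \<kappa> \<Longrightarrow> dist (q \<kappa>) \<le> 2 * dist p"
    by (metis empty_iff)
  define u where "u \<kappa> = (\<lambda>x. (f (q \<kappa>) x - ?f0 x) / dist (q \<kappa>))" for \<kappa>
  have fL2 [simp]: "f p \<in> L2 \<mu>" for p unfolding f_def by (rule mix)
  have [simp]: "?f0 \<in> L2 \<mu>" by (rule mix)
  have u: "u \<kappa> \<in> L2 \<mu>" "L2_norm \<mu> (u \<kappa>) \<le> 1" for \<kappa>
    unfolding u_def by (simp_all add: dist_def[symmetric]) (simp add: dist_def divide_self_if)

  define D where "D = case_sum e u"
  define t\<^sub>1 where "t\<^sub>1 = \<sigma> * sqrt (2 * \<Delta> * \<Lambda>)"
  define t\<^sub>2 where "t\<^sub>2 = \<sigma> * sqrt (2 * S * \<Delta> * \<Lambda>)"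
  define t where "t = case_sum (\<lambda>_::'j. t\<^sub>1) (\<lambda>_::'c. t\<^sub>2)"
  have t_pos: "0 \<le> t\<^sub>1" "0 \<le> t\<^sub>2" using pos \<Lambda> by (auto simp: t\<^sub>1_def t\<^sub>2_def)
  have t\<^sub>1_exp: "exp (- (t\<^sub>1\<^sup>2 / (2 * (\<sigma>\<^sup>2 * \<Delta>)))) = exp (- \<Lambda>)"
    using pos \<Lambda> by (simp add: t\<^sub>1_def power_mult_distrib)
  have "t\<^sub>2\<^sup>2 / (2 * (\<sigma>\<^sup>2 * \<Delta>)) = S * \<Lambda>"
    using pos \<Lambda> by (simp add: t\<^sub>2_def power_mult_distrib)
  then have t\<^sub>2_exp: "exp (- (t\<^sub>2\<^sup>2 / (2 * (\<sigma>\<^sup>2 * \<Delta>)))) = exp (- \<Lambda>) ^ S"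
    by (simp add: exp_of_nat_mult[symmetric])
  show ?thesis
    unfolding \<mu>_def
  proof (rule minimax_risk_le_finite_test[where I = "J <+> C" and d = D and t = t,
        OF noise[unfolded \<mu>_def] pos \<alpha>(1) mix[unfolded \<mu>_def]], fold \<mu>_def)
    show "finite (J <+> C)" using J C by simp
    show "D i \<in> L2 \<mu>" "L2_norm \<mu> (D i) \<le> 1" "0 \<le> t i" if "i \<in> J <+> C" for i
      using that e u t_pos by (auto simp: D_def t_def)
    have "(\<Sum>i\<in>J <+> C. 2 * exp (- (t i)\<^sup>2 / (2 * (\<sigma>\<^sup>2 * \<Delta>)))) =
        card J * (2 * exp (- \<Lambda>)) + card C * (2 * exp (- \<Lambda>) ^ S)"
      using J C by (simp add: sum.Plus t_def t\<^sub>1_exp t\<^sub>2_exp)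
    also have "\<dots> \<le> real (2 * N) * (2 * exp (- \<Lambda>)) + real (N ^ S) * (2 * exp (- \<Lambda>) ^ S)"
      using J C by (intro add_mono mult_right_mono) (auto simp del: of_nat_power of_nat_mult)
    also have "\<dots> = 4 * (N * exp (- \<Lambda>)) + 2 * (N * exp (- \<Lambda>)) ^ S"
      by (simp add: power_mult_distrib)
    also have "\<dots> \<le> 4 * (N * exp (- \<Lambda>)) + 2 * (N * exp (- \<Lambda>)) ^ 1"
      using S \<Lambda>(2) \<alpha>(2) by (intro add_left_mono mult_left_mono power_decreasing) auto
    also have "\<dots> \<le> \<alpha> / 2" using \<Lambda>(2) by simp
    finally show "(\<Sum>i\<in>J <+> C. 2 * exp (- (t i)\<^sup>2 / (2 * (\<sigma>\<^sup>2 * \<Delta>)))) \<le> \<alpha> / 2" .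
  next
    fix \<beta> \<theta>s assume p: "(\<beta>, \<theta>s) \<in> H1 M T s \<delta> \<beta>0 \<theta>0 ?\<rho>"
    define p where "p = (\<beta>, \<theta>s)"
    define g where "g = (\<lambda>x. f p x - ?f0 x)"
    have pH1: "p \<in> H1 M T s \<delta> \<beta>0 \<theta>0 ?\<rho>" using p by (simp add: p_def)
    have pP: "p \<in> P (cls p)" using pH1 by (simp add: P_def)
    then have qP: "q (cls p) \<in> P (cls p)" using q by blast
    let ?q = "q (cls p)"
    have qH1: "?q \<in> H1 M T s \<delta> \<beta>0 \<theta>0 ?\<rho>" "cls ?q = cls p" using qP by (auto simp: P_def)
    show "\<exists>i\<in>J <+> C. 2 * t i < \<bar>L2_inner \<mu> (\<lambda>x. mixture M T \<beta> \<theta>s x - ?f0 x) (D i)\<bar>"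
    proof (rule ccontr)
      assume "\<not> ?thesis"
      then have small: "\<bar>L2_inner \<mu> g (D i)\<bar> \<le> 2 * t i" if "i \<in> J <+> C" for i
        using that by (auto simp: g_def f_def p_def not_less)
      have "\<bar>L2_inner \<mu> g (e j)\<bar> \<le> 2 * t\<^sub>1" if "j \<in> J" for j
        using small[OF InlI[OF that]] by (simp add: D_def t_def)
      then have cmp: "\<bar>L2_inner \<mu> g (\<lambda>x. f p x - f ?q x)\<bar> \<le>
          (2 * (2 * t\<^sub>1) * sqrt (2 * S) + L2_norm \<mu> g / 10) * L2_norm \<mu> (\<lambda>x. f p x - f ?q x)"
        using t_pos H1(1)[OF pH1] H1(1)[OF qH1(1)] qH1(2) by (intro compare) (auto simp: g_def)
      have "\<bar>L2_inner \<mu> g (u (cls p))\<bar> \<le> 2 * t\<^sub>2"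
        using small[OF InrI[OF cls[OF H1(1)[OF pH1]]]] by (simp add: D_def t_def)
      moreover have "L2_inner \<mu> g (u (cls p)) = L2_inner \<mu> g (\<lambda>x. f ?q x - ?f0 x) / dist ?q"
        by (simp add: u_def)
      moreover have "0 < dist ?q" using H1(2)[OF qH1(1)] \<rho> by simp
      ultimately have ref: "\<bar>L2_inner \<mu> g (\<lambda>x. f ?q x - ?f0 x)\<bar> \<le> 2 * t\<^sub>2 * L2_norm \<mu> (\<lambda>x. f ?q x - ?f0 x)"
        by (simp add: dist_def[symmetric] abs_divide field_simps)
      have "dist p \<le> 5 * (2 * (2 * t\<^sub>1) * sqrt (2 * S)) + 3 * (2 * t\<^sub>2)"
        unfolding dist_def
        using q_near[OF pP] ref cmp t_pos
        by (intro L2_norm_le_from_reference[of _ _ _ "f ?q"]) (auto simp: g_def dist_def)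
      also have "\<dots> = 20 * (t\<^sub>1 * sqrt (2 * S)) + 6 * t\<^sub>2" by simp
      also have "t\<^sub>1 * sqrt (2 * S) = 2 * (\<sigma> * sqrt (S * \<Delta> * \<Lambda>))"
        by (simp add: t\<^sub>1_def real_sqrt_mult)
      also have "t\<^sub>2 = sqrt 2 * (\<sigma> * sqrt (S * \<Delta> * \<Lambda>))"
        by (simp add: t\<^sub>2_def real_sqrt_mult)
      also have "20 * (2 * (\<sigma> * sqrt (S * \<Delta> * \<Lambda>))) + 6 * (sqrt 2 * (\<sigma> * sqrt (S * \<Delta> * \<Lambda>))) =
          (40 + 6 * sqrt 2) * (\<sigma> * sqrt (S * \<Delta> * \<Lambda>))"
        by (simp add: algebra_simps)
      also have "\<dots> < 50 * (\<sigma> * sqrt (S * \<Delta> * \<Lambda>))"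
      proof (rule mult_strict_right_mono)
        have "sqrt 2 < sqrt ((3 / 2)\<^sup>2)" by (intro real_sqrt_less_mono) (simp add: power2_eq_square)
        then show "40 + 6 * sqrt 2 < (50::real)" by simp
        show "0 < \<sigma> * sqrt (S * \<Delta> * \<Lambda>)" using \<rho> by simp
      qed
      finally show False using H1(2)[OF pH1] by simp
    qed
  qed
qed

section \<open>Length of the lifted interval\<close>

text \<open>Among the half-open unit intervals with integer end points, the interval meets at most those that
  start at the integer part \<open>n\<close> of \<open>a\<close> and at \<open>n + 1\<close>. Its traces there, moved to \<open>{0..<1}\<close>, overlap in at most one point.\<close>

lemma interval_length_le:
  assumes ab: "a \<le> b" and Torus: "D = Torus \<Longrightarrow> b - a \<le> 1"
  shows "b - a \<le> measure lborel (proj D ` {a..b})"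
proof (cases D)
  case Line
  then have "proj D ` {a..b} = {a..b}" by (auto simp: image_iff)
  then show ?thesis using ab by simp
next
  case T: Torus
  define n :: real where "n = of_int \<lfloor>a\<rfloor>"
  have n: "n \<le> a" "a < n + 1" unfolding n_def by linarith+
  have len1: "b - a \<le> 1" using Torus T by simp
  let ?A = "{0..<1} \<inter> {a - n..b - n}" and ?B = "{0..<1} \<inter> {a - n - 1..b - n - 1}"
  have "proj D ` {a..b} = ?A \<union> ?B"
  proof (intro equalityI subsetI)
    fix y assume "y \<in> proj D ` {a..b}"
    then obtain x where x: "x \<in> {a..b}" "y = frac x" using T by auto
    have "\<lfloor>x\<rfloor> = \<lfloor>a\<rfloor> \<or> \<lfloor>x\<rfloor> = \<lfloor>a\<rfloor> + 1" using x(1) len1 by auto linarith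
    then have "y = x - n \<or> y = x - n - 1" using x(2) by (auto simp: frac_def n_def)
    moreover have "0 \<le> y" "y < 1" using x(2) by (auto simp: frac_lt_1)
    ultimately show "y \<in> ?A \<union> ?B" using x(1) by auto
  next
    fix y assume y: "y \<in> ?A \<union> ?B"
    have "frac (y + n) = y" "frac (y + n + 1) = y"
      using y by (auto simp: frac_unique_iff n_def)
    then show "y \<in> proj D ` {a..b}"
      using y T by (auto simp: image_iff intro: bexI[of _ "y + n"] bexI[of _ "y + n + 1"])
  qed
  moreover have fm: "?A \<union> ?B \<in> fmeasurable lborel"
    by (rule fmeasurableI2[of "{0..1}"]) (auto simp: fmeasurable_def)
  have "b - a \<le> measure lborel (?A \<union> ?B)"
  proof (cases "b - n \<le> 1")
    case True
    have "b - a = measure lborel {a - n<..<b - n}" using ab by simp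
    also have "\<dots> \<le> measure lborel (?A \<union> ?B)"
      using True n by (intro measure_mono_fmeasurable) (use fm in auto)
    finally show ?thesis .
  next
    case False
    have "b - a = measure lborel {a - n<..<1} + measure lborel {0<..<b - n - 1}"
      using n False by simp
    also have "\<dots> = measure lborel ({a - n<..<1} \<union> {0<..<b - n - 1})"
      using len1 n False by (intro measure_Union[symmetric]) auto
    also have "\<dots> \<le> measure lborel (?A \<union> ?B)"
      using False n len1 by (intro measure_mono_fmeasurable) (use fm in auto)
    finally show ?thesis .
  qed
  ultimately show ?thesis by simp
qed


section \<open>The separation rate\<close>

lemma exp_minus_ln_div:
  assumes "0 < y" "0 < z"
  shows "exp (- ln (y / z)) = z / (y::real)"
  using assms by (simp add: exp_minus)

text \<open>The cells have width \<open>\<omega>\<close> times the scale. Since \<open>len M T\<close> is at least one scale, their number is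
  at most \<open>(1 / \<omega> + 1) * len M T / sig M T\<close>, and the logarithm in the rate makes the union bound at
  most \<open>\<alpha> / 2\<close>. The class of a mixture is the list of its cells. For \<open>s = 0\<close> there is one class,
  whose only member is the zero signal.\<close>

lemma separation_rate_le:
  fixes \<omega> :: real
  assumes F: "F_properties F"
    and \<omega>: "0 < \<omega>" "\<And>x. 0 \<le> x \<Longrightarrow> x \<le> \<omega> \<Longrightarrow> 1 / 6 < \<bar>F x\<bar>"
      "4000 * (sqrt (ginf F) * \<omega> * (1 + curvature_bound F)\<^sup>2) \<le> 1"
    and valid: "valid_model M T" and \<eta>: "0 < \<eta>" "\<eta> < 1"
    and \<delta>: "ereal (sig M T) * Sigma_sep F \<eta> r s \<le> ereal \<delta>"
    and main: "main_assumption F M T s r \<eta> Q"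
    and noise: "noise_assumption (lam M T) W \<sigma> \<Delta>" and pos: "0 < \<sigma>" "0 < \<Delta>"
    and len: "1 \<le> len M T / sig M T" and \<alpha>: "0 < \<alpha>" "\<alpha> < 1" and S: "s \<le> S" "1 \<le> S"
  shows "separation_rate M T W s \<delta> \<beta>0 \<theta>0 \<alpha> \<le>
    ereal (50 * \<sigma> * sqrt (real S * \<Delta> * ln (12 * (1 / \<omega> + 1) * len M T / (\<alpha> * sig M T))))"
proof -
  let ?\<mu> = "lam M T" and ?D = "dom_of M"
  define c\<^sub>1 where "c\<^sub>1 = 1 / \<omega> + 1"
  define \<Lambda> where "\<Lambda> = ln (12 * c\<^sub>1 * len M T / (\<alpha> * sig M T))"
  define w where "w = \<omega> * sig M T"
  have sig: "0 < sig M T" using valid by (auto simp: valid_model_def)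
  have w: "0 < w" using \<omega>(1) sig by (simp add: w_def)
  have c\<^sub>1: "1 \<le> c\<^sub>1" using \<omega>(1) by (simp add: c\<^sub>1_def)
  have smooth: "smooth_features M T" and diff: "features_differentiable M T"
    and gpos: "positive_gT M T" and CT: "CT F M T \<le> 2"
    using main by (auto simp: main_assumption_def)
  obtain a b where ab: "a \<le> b" "?D = Torus \<Longrightarrow> b - a \<le> 1" and Theta: "ThetaT M T = proj ?D ` {a..b}"
    using valid by (auto simp: valid_model_def compact_interval_def)
  have ab_len: "b - a \<le> len M T" unfolding len_def Theta by (rule interval_length_le[OF ab])

  define n where "n = nat \<lfloor>(b - a) / w\<rfloor>"
  have len_pos: "sig M T \<le> len M T" using len sig by (simp add: field_simps)
  have "\<alpha> * sig M T \<le> 1 * len M T" using \<alpha> sig len_pos by (intro mult_mono) auto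
  also have "\<dots> < 12 * c\<^sub>1 * len M T" using c\<^sub>1 sig len_pos by (intro mult_strict_right_mono) auto
  finally have \<Lambda>: "0 < \<Lambda>"
    unfolding \<Lambda>_def using \<alpha> sig by (intro ln_gt_zero) (simp add: less_divide_eq)
  have "real n \<le> (b - a) / w" using ab w by (simp add: n_def)
  also have "\<dots> \<le> len M T / w" using ab_len w by (intro divide_right_mono) auto
  also have "\<dots> = len M T / sig M T * (1 / \<omega>)" by (simp add: w_def)
  finally have "real n + 1 \<le> len M T / sig M T * (1 / \<omega>) + len M T / sig M T"
    using len by (rule add_mono)
  also have "\<dots> = c\<^sub>1 * (len M T / sig M T)" 
    by (simp only: c\<^sub>1_def distrib_right mult_1_left mult.commute[of "1 / \<omega>"])
  finally have "real (Suc n) \<le> c\<^sub>1 * (len M T / sig M T)" by simp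
  then have "real (Suc n) * exp (- \<Lambda>) \<le> c\<^sub>1 * (len M T / sig M T) * exp (- \<Lambda>)"
    by (intro mult_right_mono) auto
  also have "\<dots> = \<alpha> / 12"
    unfolding \<Lambda>_def using \<alpha> sig c\<^sub>1 len_pos by (subst exp_minus_ln_div) auto
  finally have count: "real (Suc n) * exp (- \<Lambda>) \<le> \<alpha> / 12" .

  define lift where "lift \<theta> = (SOME t. t \<in> {a..b} \<and> proj ?D t = \<theta>)" for \<theta>
  have lift: "lift \<theta> \<in> {a..b}" "proj ?D (lift \<theta>) = \<theta>" if "\<theta> \<in> ThetaT M T" for \<theta>
  proof -
    have "\<exists>t. t \<in> {a..b} \<and> proj ?D t = \<theta>" using that by (auto simp: Theta)
    from someI_ex[OF this] show "lift \<theta> \<in> {a..b}" "proj ?D (lift \<theta>) = \<theta>" by (auto simp: lift_def)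
  qed
  define cell where "cell \<theta> = nat \<lfloor>(lift \<theta> - a) / w\<rfloor>" for \<theta>
  have cell: "cell \<theta> \<le> n" "lift \<theta> \<in> {a + real (cell \<theta>) * w..min b (a + real (cell \<theta>) * w + w)}"
    if "\<theta> \<in> ThetaT M T" for \<theta>
  proof -
    have l: "a \<le> lift \<theta>" "lift \<theta> \<le> b" using lift(1)[OF that] by auto
    show "cell \<theta> \<le> n" unfolding cell_def n_def using l w
      by (intro nat_mono floor_mono divide_right_mono) auto
    have "real (cell \<theta>) \<le> (lift \<theta> - a) / w" "(lift \<theta> - a) / w < real (cell \<theta>) + 1"
      using l w by (simp_all add: cell_def)
    then show "lift \<theta> \<in> {a + real (cell \<theta>) * w..min b (a + real (cell \<theta>) * w + w)}"
      using l w by (simp add: field_simps)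
  qed

  define cls where "cls = (\<lambda>p::real list \<times> real list. map cell (snd p))"
  define e where "e = (\<lambda>(i::nat, j::nat). Dtilde M T i (phi M T) (a + real j * w))"
  let ?J = "{..1} \<times> {..n}" and ?C = "{xs. set xs \<subseteq> {..n} \<and> length xs = s}"
  have mix_lift: "mixture M T \<beta> \<theta>s = (\<lambda>x. \<Sum>k<s. \<beta> ! k * Dtilde M T 0 (phi M T) (lift (\<theta>s ! k)) x)"
    if "(\<beta>, \<theta>s) \<in> params M T s \<delta>" for \<beta> \<theta>s
  proof -
    have "length \<theta>s = s" "set \<theta>s \<subseteq> ThetaT M T" using that by (auto simp: params_def sep_vecs_def)
    then have "phi M T (\<theta>s ! k) = phi M T (lift (\<theta>s ! k))" if "k < s" for k
    proof -
      have "\<theta>s ! k \<in> ThetaT M T"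
        using \<open>length \<theta>s = s\<close> \<open>set \<theta>s \<subseteq> ThetaT M T\<close> nth_mem[of k \<theta>s] that by auto
      then show ?thesis using lift(2) phi_proj[OF valid, of "lift (\<theta>s ! k)"] by simp
    qed
    then show ?thesis using \<open>length \<theta>s = s\<close> by (simp add: mixture_def)
  qed

  have "minimax_risk M T W s \<delta> \<beta>0 \<theta>0 (50 * \<sigma> * sqrt (S * \<Delta> * \<Lambda>)) \<le> ennreal \<alpha>"
  proof (rule minimax_risk_le_classes[OF noise pos \<alpha>, where J = ?J and C = ?C and e = e
        and cls = cls and N = "Suc n"])
    show "mixture M T \<beta> \<theta>s \<in> L2 ?\<mu>" for \<beta> \<theta>s
      unfolding mixture_def using Dtilde_L2[OF valid diff, of 0] by simp
    show "e j \<in> L2 ?\<mu>" "L2_norm ?\<mu> (e j) \<le> 1" if j: "j \<in> ?J" for j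
    proof -
      obtain i k where ik: "j = (i, k)" "i = 0 \<or> i = Suc 0" using j by (cases j) (auto simp: le_Suc_eq)
      show "e j \<in> L2 ?\<mu>" using ik Dtilde_L2[OF valid diff, of i] by (auto simp: e_def)
      show "L2_norm ?\<mu> (e j) \<le> 1"
        using ik phi_unit[OF valid smooth] velocity_unit[OF valid gpos] by (auto simp: e_def)
    qed
    have "Suc n ^ s \<le> Suc n ^ S" using S by (intro power_increasing) auto
    then show "card ?C \<le> Suc n ^ S" by (simp add: card_lists_length_eq)
    show "cls p \<in> ?C" if "p \<in> params M T s \<delta>" for p
      using that cell(1) by (auto simp: cls_def params_def sep_vecs_def)
    show "1 \<le> S" "0 < \<Lambda>" "real (Suc n) * exp (- \<Lambda>) \<le> \<alpha> / 12" by fact+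
  next
    fix p q :: "real list \<times> real list" and g :: "real \<Rightarrow> real" and \<kappa> :: real
    let ?d = "\<lambda>x. mixture M T (fst p) (snd p) x - mixture M T (fst q) (snd q) x"
    assume p: "p \<in> params M T s \<delta>" and q: "q \<in> params M T s \<delta>" and same: "cls p = cls q"
      and g: "g \<in> L2 ?\<mu>" and \<kappa>: "0 \<le> \<kappa>" and test: "\<And>j. j \<in> ?J \<Longrightarrow> \<bar>L2_inner ?\<mu> g (e j)\<bar> \<le> \<kappa>"
    have mix: "?d = (\<lambda>x. (\<Sum>k<s. fst p ! k * Dtilde M T 0 (phi M T) (lift (snd p ! k)) x) -
        (\<Sum>k<s. fst q ! k * Dtilde M T 0 (phi M T) (lift (snd q ! k)) x))"
      using mix_lift[of "fst p" "snd p"] mix_lift[of "fst q" "snd q"] p q by simp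
    have len_pq: "length (snd p) = s" "length (snd q) = s"
      using p q by (auto simp: params_def sep_vecs_def)
    have in_Theta: "snd p ! k \<in> ThetaT M T" "snd q ! k \<in> ThetaT M T" if "k < s" for k
      using p q that by (auto simp: params_def sep_vecs_def)
    have same_cell: "cell (snd q ! k) = cell (snd p ! k)" if "k < s" for k
      using arg_cong[OF same, of "\<lambda>xs. xs ! k"] that len_pq by (simp add: cls_def)
    have "\<bar>L2_inner ?\<mu> g ?d\<bar> \<le> (2 * \<kappa> * sqrt (2 * s) + L2_norm ?\<mu> g / 10) * L2_norm ?\<mu> ?d"
    proof (cases "s = 0")
      case True
      then show ?thesis by (simp add: mix)
    next
      case False
      have VT_le: "VT F M T \<le> ereal (H1inf F r)"
        and sVT: "ereal (real s - 1) * VT F M T \<le> ereal ((1 - \<eta>) * H2inf F r)"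
        and fin: "delta F (\<eta> * H2inf F r) s < \<infinity>"
        using main False by (auto simp: main_assumption_def)
      have "0 \<le> VT F M T"
        by (rule order_trans[OF _ KT_Kprox_le_VT[of 0 0 "snd p ! 0" M T "snd p ! 0" F]])
          (use in_Theta(1)[of 0] False in auto)
      then obtain V where VT_V: "VT F M T = ereal V" using VT_le by (cases "VT F M T") auto
      interpret lifted_model F M T a b V
        using VT_le VT_V H1inf_le[of F r] valid smooth diff gpos F CT ab Theta
        by unfold_locales auto
      let ?J' = "\<lambda>k. cell (snd p ! k)"
      interpret short_cells "lam M T" "\<lambda>i. Dtilde M T i (phi M T)" "\<lambda>t. sqrt (gT M T t)" a b
        "2 * sqrt (ginf F) / sig M T" "curvature_bound F" s
        "\<lambda>k. a + real (?J' k) * (\<omega> * sig M T)" "\<lambda>k. min b (a + real (?J' k) * (\<omega> * sig M T) + \<omega> * sig M T)"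
        "2 * sqrt (ginf F) * \<omega>"
      proof (rule short_cells_around[where \<theta> = "\<lambda>k. lift (snd p ! k)" and r = r, OF _ \<eta> fin _ _ \<omega>])
        show "(real s - 1) * V \<le> (1 - \<eta>) * H2inf F r" using sVT by (simp add: VT_V)
        show "lift (snd p ! k) \<in> {a + real (?J' k) * (\<omega> * sig M T)..
            min b (a + real (?J' k) * (\<omega> * sig M T) + \<omega> * sig M T)}" if "k < s" for k
          using cell(2)[OF in_Theta(1)[OF that]] by (simp add: w_def)
        show "ereal (sig M T) * Sigma_sep F \<eta> r s < ereal \<bar>offset ?D (lift (snd p ! k) - lift (snd p ! l))\<bar>"
          if kl: "k < s" "l < s" "k \<noteq> l" for k l
        proof -
          have "\<delta> < gap ?D (snd p ! k) (snd p ! l)"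
            using p kl by (auto simp: params_def sep_vecs_def)
          also have "\<dots> = \<bar>offset ?D (lift (snd p ! k) - lift (snd p ! l))\<bar>"
            using offset_proj[of ?D "lift (snd p ! k)" "lift (snd p ! l)"] lift(2) in_Theta(1) kl
            by (simp add: gap_def)
          finally show ?thesis by (intro le_less_trans[OF \<delta>]) simp
        qed
      qed
      show ?thesis
        unfolding mix
      proof (rule cell_comparison[OF _ _ g _ _ \<kappa>])
        fix k assume k: "k < s"
        show "lift (snd p ! k) \<in> {a + real (?J' k) * (\<omega> * sig M T)..
            min b (a + real (?J' k) * (\<omega> * sig M T) + \<omega> * sig M T)}"
          using cell(2)[OF in_Theta(1)[OF k]] by (simp add: w_def)
        show "lift (snd q ! k) \<in> {a + real (?J' k) * (\<omega> * sig M T)..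
            min b (a + real (?J' k) * (\<omega> * sig M T) + \<omega> * sig M T)}"
          using cell(2)[OF in_Theta(2)[OF k]] same_cell[OF k] by (simp add: w_def)
        show "\<bar>L2_inner ?\<mu> g (Dtilde M T 0 (phi M T) (a + real (?J' k) * (\<omega> * sig M T)))\<bar> \<le> \<kappa>"
          "\<bar>L2_inner ?\<mu> g (Dtilde M T (Suc 0) (phi M T) (a + real (?J' k) * (\<omega> * sig M T)))\<bar> \<le> \<kappa>"
          using test[of "(0, ?J' k)"] test[of "(Suc 0, ?J' k)"] cell(1)[OF in_Theta(1)[OF k]]
          by (auto simp: e_def w_def)
      qed
    qed
    also have "\<dots> \<le> (2 * \<kappa> * sqrt (2 * S) + L2_norm ?\<mu> g / 10) * L2_norm ?\<mu> ?d"
      using S \<kappa> by (intro mult_right_mono add_right_mono mult_left_mono real_sqrt_le_mono) auto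
    finally show "\<bar>L2_inner ?\<mu> g ?d\<bar> \<le> (2 * \<kappa> * sqrt (2 * S) + L2_norm ?\<mu> g / 10) * L2_norm ?\<mu> ?d" .
  qed (simp_all add: finite_lists_length_eq)
  moreover have "0 < 50 * \<sigma> * sqrt (S * \<Delta> * \<Lambda>)" using pos S \<Lambda> by simp
  ultimately show ?thesis
    unfolding separation_rate_def by (intro Inf_lower) (auto simp: \<Lambda>_def c\<^sub>1_def)
qed

theorem corollary4p5:
  fixes F :: "real \<Rightarrow> real" and r :: real
  assumes "0 < r" and "r < 1 / sqrt (2 * ginf F * Lsup F 2)"
  shows "\<exists>c>0. \<exists>C>0.
    \<forall>(M :: model) (T :: nat) (s0 :: nat) (s :: nat) (K :: nat) (\<eta> :: real)
      (\<delta>star :: real) (\<delta>0 :: real) \<beta>star \<theta>star \<beta>0 \<theta>0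
      (W :: nat \<Rightarrow> (real \<Rightarrow> real) measure) (\<sigma>bar :: real) (\<Delta> :: nat \<Rightarrow> real).
      valid_model M T \<and> s0 \<le> K \<and> s \<le> K \<and> 0 < \<eta> \<and> \<eta> < 1 \<and>
      ereal \<delta>star \<ge> ereal (sig M T) * Sigma_sep F \<eta> r s \<and>
      ereal \<delta>0 \<ge> ereal (sig M T) * Sigma_sep F \<eta> r s0 \<and>
      \<beta>star \<in> nonzero_vecs s \<and> \<theta>star \<in> sep_vecs (dom_of M) (ThetaT M T) s \<delta>star \<and>
      \<beta>0 \<in> nonzero_vecs s0 \<and> \<theta>0 \<in> sep_vecs (dom_of M) (ThetaT M T) s0 \<delta>0 \<and>
      main_assumption F M T s r \<eta> (set \<theta>star) \<and>
      main_assumption F M T s0 r \<eta> (set \<theta>0) \<and>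
      \<sigma>bar > 0 \<and> \<Delta> T > 0 \<and> noise_assumption (lam M T) (W T) \<sigma>bar (\<Delta> T) \<and>
      len M T / sig M T \<ge> 1
      \<longrightarrow> (\<forall>\<alpha>. 0 < \<alpha> \<and> \<alpha> < 1 \<longrightarrow>
            separation_rate M T (W T) s \<delta>star \<beta>0 \<theta>0 \<alpha>
              \<le> ereal (C * \<sigma>bar * sqrt (real (max s (max s0 1)) * \<Delta> T *
                    ln (c * len M T / (\<alpha> * sig M T)))))"
proof (cases "F_properties F")
  case True
  then have g: "0 < ginf F" by (simp add: F_properties_def)
  obtain x\<^sub>0 where x\<^sub>0: "0 < x\<^sub>0" "\<And>x. 0 \<le> x \<Longrightarrow> x \<le> x\<^sub>0 \<Longrightarrow> 1 / 6 < \<bar>F x\<bar>"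
    using F_near_zero[OF True] by blast
  let ?m = "sqrt (ginf F) * (1 + curvature_bound F)\<^sup>2"
  \<comment> \<open>Cells narrow enough for \<open>\<bar>F\<bar>\<close> to stay above $1/6$ on their width, and for the curve to be almost
    straight inside them.\<close>
  define \<omega> where "\<omega> = min x\<^sub>0 (1 / (4000 * ?m))"
  have "0 \<le> curvature_bound F" by (simp add: curvature_bound_def)
  then have m: "0 < ?m" using g by simp
  have \<omega>: "0 < \<omega>" using x\<^sub>0(1) m by (simp add: \<omega>_def)
  have "\<omega> * (4000 * ?m) \<le> 1 / (4000 * ?m) * (4000 * ?m)"
    using m by (intro mult_right_mono) (auto simp: \<omega>_def)
  then have \<omega>_small: "4000 * (sqrt (ginf F) * \<omega> * (1 + curvature_bound F)\<^sup>2) \<le> 1"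
    using m by (auto simp: ac_simps split: if_splits)
  have \<omega>_F: "1 / 6 < \<bar>F x\<bar>" if "0 \<le> x" "x \<le> \<omega>" for x using that x\<^sub>0(2) by (simp add: \<omega>_def)
  show ?thesis
  proof (intro exI conjI allI impI)
    show "0 < 12 * (1 / \<omega> + 1)" using \<omega> by (simp add: add_pos_pos)
    show "(0::real) < 50" by simp
    fix M :: model and T s0 s K :: nat and \<eta> \<delta>star \<delta>0 :: real and \<beta>star \<theta>star \<beta>0 \<theta>0 :: "real list"
      and W :: "nat \<Rightarrow> (real \<Rightarrow> real) measure" and \<sigma>bar :: real and \<Delta> :: "nat \<Rightarrow> real" and \<alpha> :: real
    assume *: "valid_model M T \<and> s0 \<le> K \<and> s \<le> K \<and> 0 < \<eta> \<and> \<eta> < 1 \<and>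
      ereal \<delta>star \<ge> ereal (sig M T) * Sigma_sep F \<eta> r s \<and>
      ereal \<delta>0 \<ge> ereal (sig M T) * Sigma_sep F \<eta> r s0 \<and>
      \<beta>star \<in> nonzero_vecs s \<and> \<theta>star \<in> sep_vecs (dom_of M) (ThetaT M T) s \<delta>star \<and>
      \<beta>0 \<in> nonzero_vecs s0 \<and> \<theta>0 \<in> sep_vecs (dom_of M) (ThetaT M T) s0 \<delta>0 \<and>
      main_assumption F M T s r \<eta> (set \<theta>star) \<and>
      main_assumption F M T s0 r \<eta> (set \<theta>0) \<and>
      \<sigma>bar > 0 \<and> \<Delta> T > 0 \<and> noise_assumption (lam M T) (W T) \<sigma>bar (\<Delta> T) \<and>
      len M T / sig M T \<ge> 1" and \<alpha>: "0 < \<alpha> \<and> \<alpha> < 1"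
    show "separation_rate M T (W T) s \<delta>star \<beta>0 \<theta>0 \<alpha>
      \<le> ereal (50 * \<sigma>bar * sqrt (real (max s (max s0 1)) * \<Delta> T *
            ln (12 * (1 / \<omega> + 1) * len M T / (\<alpha> * sig M T))))"
      using * \<alpha> by (intro separation_rate_le[OF True \<omega> \<omega>_F \<omega>_small, where \<eta> = \<eta> and r = r
          and Q = "set \<theta>star"]) auto
  qed
next
  case False
  then have "\<not> main_assumption F M T s r \<eta> Q" for M T s \<eta> Q by (simp add: main_assumption_def)
  then show ?thesis by (intro exI[of _ "1::real"] conjI) auto
qed

end
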